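(* For every $n\ge5$, $$6\le\operatorname{reg}(S_{G_n}/J_{G_n})\le2n-2.$$
   Context: Graph $G_n$: let $X=\{u_0,\dots,u_{n-1}\}$ and $Y=\{v_0,\dots,v_{n-1}\}$ be disjoint, indices modulo $n$. $G_n$ is the bipartite graph on $X\sqcup Y$ with $\{u_i,v_j\}\in E(G_n)$ iff $j\notin\{i,i-1\}$ modulo $n$ (the bipartite complement of the cycle $C_{2n}$ with edges $\{u_i,v_i\},\{u_i,v_{i-1}\}$). Binomial edge ideal: let $\mathbb K$ be an arbitrary field. For a finite simple graph $G$, $S_G=\mathbb K[x_w,y_w:w\in V(G)]$ (standard graded) and $J_G\subseteq S_G$ is the ideal generated by $x_ay_b-x_by_a$ for all edges $\{a,b\}\in E(G)$. $\operatorname{reg}$ is the Castelnuovo–Mumford regularity: $\operatorname{reg}R=\max\{j-i:\beta_{i,j}(R)\ne0\}$, with $\beta_{i,j}(R)$ the graded Betti numbers of $R=S_G/J_G$ over $S_G$. *)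

theory Defs
  imports
    "HOL-Library.Poly_Mapping"
    "HOL-Algebra.QuotRing"
    "HOL-Number_Theory.Cong"
    "Jordan_Normal_Form.Matrix"
begin

section \<open>Polynomial rings on a set of variables\<close>

type_synonym ('v, 'k) mpoly = "('v \<Rightarrow>\<^sub>0 nat) \<Rightarrow>\<^sub>0 'k"

definition Var :: "'v \<Rightarrow> ('v, 'k::field) mpoly" where
  "Var v = Poly_Mapping.single (Poly_Mapping.single v 1) 1"

text \<open>The subring $K[A]$ of all polynomials whose variables lie in \<open>A\<close>.\<close>

definition poly_ring :: "'v set \<Rightarrow> ('v, 'k::field) mpoly ring" where
  "poly_ring A = \<lparr>carrier = {p. \<forall>m \<in> Poly_Mapping.keys p. Poly_Mapping.keys m \<subseteq> A},
     monoid.mult = (*), one = 1, zero = 0, add = (+)\<rparr>"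

lemma poly_ring_sel [simp]:
  "monoid.mult (poly_ring A) = (*)" "one (poly_ring A) = 1"
  "zero (poly_ring A) = 0" "add (poly_ring A) = (+)"
  by (simp_all add: poly_ring_def)

lemma cring_poly_ring: "cring (poly_ring A)"
proof -
  have add: "p + q \<in> carrier (poly_ring A)"
    if "p \<in> carrier (poly_ring A)" "q \<in> carrier (poly_ring A)" for p q :: "('a, 'b) mpoly"
  proof -
    have "Poly_Mapping.keys (p + q) \<subseteq> Poly_Mapping.keys p \<union> Poly_Mapping.keys q"
      by (rule Poly_Mapping.keys_add)
    then show ?thesis using that unfolding poly_ring_def by (simp, blast)
  qed
  have neg: "- p \<in> carrier (poly_ring A)" if "p \<in> carrier (poly_ring A)" for p :: "('a, 'b) mpoly"
    using that unfolding poly_ring_def by simp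
  have mult: "p * q \<in> carrier (poly_ring A)"
    if p: "p \<in> carrier (poly_ring A)" and q: "q \<in> carrier (poly_ring A)"
    for p q :: "('a, 'b) mpoly"
  proof -
    have "Poly_Mapping.keys m \<subseteq> A" if m: "m \<in> Poly_Mapping.keys (p * q)" for m
    proof -
      obtain a b where ab: "m = a + b" "a \<in> Poly_Mapping.keys p" "b \<in> Poly_Mapping.keys q"
        using m Poly_Mapping.keys_mult[of p q] by blast
      then have "Poly_Mapping.keys a \<subseteq> A" "Poly_Mapping.keys b \<subseteq> A"
        using p q by (simp_all add: poly_ring_def)
      then show ?thesis
        using Poly_Mapping.keys_add[of a b] unfolding ab(1) by blast
    qed
    then show ?thesis by (simp add: poly_ring_def)
  qed
  have zero: "(0 :: ('a, 'b) mpoly) \<in> carrier (poly_ring A)"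
    and one: "(1 :: ('a, 'b) mpoly) \<in> carrier (poly_ring A)"
    by (simp_all add: poly_ring_def)
  have "abelian_group (poly_ring A :: ('a, 'b) mpoly ring)"
  proof (rule abelian_groupI)
    fix p :: "('a, 'b) mpoly" assume "p \<in> carrier (poly_ring A)"
    then show "\<exists>q \<in> carrier (poly_ring A). q \<oplus>\<^bsub>poly_ring A\<^esub> p = \<zero>\<^bsub>poly_ring A\<^esub>"
      using neg by (intro bexI[of _ "- p"]) simp_all
  qed (simp_all add: add zero add.assoc add.commute)
  moreover have "comm_monoid (poly_ring A :: ('a, 'b) mpoly ring)"
    by (rule comm_monoidI) (simp_all add: mult one mult.assoc mult.commute)
  ultimately show ?thesis
    by (rule cringI) (simp add: distrib_right)
qed

text \<open>The zero polynomial is homogeneous of every degree.\<close>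

definition homogeneous :: "int \<Rightarrow> ('v, 'k::field) mpoly \<Rightarrow> bool" where
  "homogeneous d p \<longleftrightarrow>
     (\<forall>m \<in> Poly_Mapping.keys p. int (\<Sum>v \<in> Poly_Mapping.keys m. Poly_Mapping.lookup m v) = d)"

definition irrelevant_ideal :: "'v set \<Rightarrow> ('v, 'k::field) mpoly set" where
  "irrelevant_ideal A = Idl\<^bsub>poly_ring A\<^esub> (Var ` A)"

section \<open>Minimal graded free resolutions and graded Betti numbers\<close>

definition free_mod :: "'v set \<Rightarrow> nat \<Rightarrow> ('v, 'k::field) mpoly vec set" where
  "free_mod A r = {w \<in> carrier_vec r. \<forall>k < r. w $ k \<in> carrier (poly_ring A)}"

text \<open>
  With $S = K[A]$, this says that
  \[ \cdots \to F_2 \to F_1 \to F_0 \to S/J \to 0 \]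
  is a graded free resolution, where $F_i = \bigoplus_k S(-\,a_{i,k})$ has the list \<open>a i\<close> as the
  degrees of its basis, the map $F_{i+1} \to F_i$ is multiplication by the matrix \<open>D i\<close>, and
  \<open>g $ k\<close> is a homogeneous lift to $S$ of the image in $S/J$ of the \<open>k\<close>-th basis element of $F_0$.
  The conditions on homogeneity say that all maps have degree 0.
\<close>

definition graded_free_resolution ::
  "'v set \<Rightarrow> ('v, 'k::field) mpoly set \<Rightarrow>
   (nat \<Rightarrow> int list) \<Rightarrow> ('v, 'k) mpoly vec \<Rightarrow> (nat \<Rightarrow> ('v, 'k) mpoly mat) \<Rightarrow> bool" where
  "graded_free_resolution A J a g D \<longleftrightarrow>
     (let S = poly_ring A;
          F = (\<lambda>i. free_mod A (length (a i)));
          aug = (\<lambda>w. J +>\<^bsub>S\<^esub> (w \<bullet> g))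
      in
        g \<in> F 0 \<and> (\<forall>k < length (a 0). homogeneous (a 0 ! k) (g $ k)) \<and>
        (\<forall>i. D i \<in> carrier_mat (length (a i)) (length (a (Suc i))) \<and>
           (\<forall>k < length (a i). \<forall>l < length (a (Suc i)).
              D i $$ (k, l) \<in> carrier S \<and>
              homogeneous (a (Suc i) ! l - a i ! k) (D i $$ (k, l)))) \<and>
        aug ` F 0 = carrier (S Quot J) \<and>
        {w \<in> F 0. aug w = \<zero>\<^bsub>S Quot J\<^esub>} = (\<lambda>w. D 0 *\<^sub>v w) ` F 1 \<and>
        (\<forall>i. {w \<in> F (Suc i). D i *\<^sub>v w = 0\<^sub>v (length (a i))} =
             (\<lambda>w. D (Suc i) *\<^sub>v w) ` F (Suc (Suc i))))"

definition minimal_graded_free_resolution ::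
  "'v set \<Rightarrow> ('v, 'k::field) mpoly set \<Rightarrow>
   (nat \<Rightarrow> int list) \<Rightarrow> ('v, 'k) mpoly vec \<Rightarrow> (nat \<Rightarrow> ('v, 'k) mpoly mat) \<Rightarrow> bool" where
  "minimal_graded_free_resolution A J a g D \<longleftrightarrow>
     graded_free_resolution A J a g D \<and>
     (\<forall>i. \<forall>k < length (a i). \<forall>l < length (a (Suc i)). D i $$ (k, l) \<in> irrelevant_ideal A)"

text \<open>
  For finite \<open>A\<close> and a homogeneous ideal \<open>J\<close> of $K[A]$, a minimal graded free resolution of
  $K[A]/J$ exists and is unique up to isomorphism, so \<open>a i\<close> is determined up to permutation and
  the Betti numbers do not depend on the choice made here.
\<close>

definition resolution_degrees :: "'v set \<Rightarrow> ('v, 'k::field) mpoly set \<Rightarrow> nat \<Rightarrow> int list" where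
  "resolution_degrees A J = (SOME a. \<exists>g D. minimal_graded_free_resolution A J a g D)"

definition graded_betti :: "'v set \<Rightarrow> ('v, 'k::field) mpoly set \<Rightarrow> nat \<Rightarrow> int \<Rightarrow> nat" where
  "graded_betti A J i j = count_list (resolution_degrees A J i) j"

text \<open>The Castelnuovo--Mumford regularity of $K[A]/J$ over $K[A]$ (not of the ideal \<open>J\<close>).\<close>

definition regularity :: "'v set \<Rightarrow> ('v, 'k::field) mpoly set \<Rightarrow> int" where
  "regularity A J = Max {j - int i | i j. graded_betti A J i j \<noteq> 0}"

section \<open>Binomial edge ideals\<close>

text \<open>Graphs are given by a vertex set \<open>V\<close> and a set \<open>E\<close> of two-element subsets of \<open>V\<close>.\<close>

datatype 'w edge_var = X 'w | Y 'w

definition edge_vars :: "'w set \<Rightarrow> 'w edge_var set" where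
  "edge_vars V = X ` V \<union> Y ` V"

definition binomial_edge_ideal ::
  "'w set \<Rightarrow> 'w set set \<Rightarrow> ('w edge_var, 'k::field) mpoly set" where
  "binomial_edge_ideal V E = Idl\<^bsub>poly_ring (edge_vars V)\<^esub>
     {Var (X a) * Var (Y b) - Var (X b) * Var (Y a) | a b. {a, b} \<in> E}"

section \<open>The bipartite complement of an even cycle\<close>

text \<open>The vertex $u_i$ is \<open>Inl i\<close> and $v_j$ is \<open>Inr j\<close>.\<close>

definition G_verts :: "nat \<Rightarrow> (nat + nat) set" where
  "G_verts n = Inl ` {..<n} \<union> Inr ` {..<n}"

definition G_edges :: "nat \<Rightarrow> (nat + nat) set set" where
  "G_edges n = {{Inl i, Inr j} | i j. i < n \<and> j < n \<and>
     \<not> [int j = int i] (mod int n) \<and> \<not> [int j = int i - 1] (mod int n)}"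

end

theory Submission
  imports Defs "HOL-Library.Function_Algebras"
begin

text \<open>Let $S = K[A]$ be the polynomial ring in the variables of the graph and $J$ its binomial edge ideal.
Both bounds are statements about the vanishing of $\mathrm{Tor}^S_p(S/J,K)_j$, and this is computed
as the Koszul homology $H_p(S/J)_j$ of $S/J$ with respect to the variables. The regularity of $S/J$
is at most $r$ iff $H_p(S/J)_j = 0$ whenever $j - p > r$; this is \<open>reg_le\<close>.

\<^bold>\<open>Upper bound.\<close> For a vertex $v$ of a graph $G$ let $G_v$ be the graph in which the neighbourhood of
$v$ has been completed. Ohtani's identity $J_G = J_{G_v} \cap (x_v, y_v, J_{G - v})$ gives an exact
sequence $0 \to S/J_G \to S/J_{G_v} \oplus S/(x_v, y_v, J_{G-v}) \to S/(x_v, y_v, J_{G_v - v}) \to 0$, hence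
\[ \mathrm{reg}\,J_G \le \max\{\mathrm{reg}\,J_{G_v},\ \mathrm{reg}\,J_{G-v},\ \mathrm{reg}\,J_{G_v-v} + 1\}, \]
where $\mathrm{reg}\,J$ abbreviates the regularity of the quotient by $J$.
By induction on the number of non-edges this reduces every graph to disjoint unions of complete
graphs, and it yields $|V| - 1$ for every nonempty graph and $|V| - 2$ for every graph that contains
a triangle (\<open>reg_le_graph\<close>). In $G_n$ the neighbourhood of $u_0$ has $n - 2 \ge 3$ vertices, so
that with $v = u_0$ both $G_v$ and $G_v - v$ contain triangles; the three terms of the maximum are at most
$2n - 2$, $(2n - 1) - 1$ and $(2n - 1) - 2 + 1$.

A disjoint union of complete graphs is handled by its toric parametrization, from which every
variable is seen to be a nonzerodivisor modulo the ideal (\<open>clique_variable_nonzerodivisor\<close>).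
Dividing by $x_w$ and splitting by multiplication with $y_w$ then removes either the vertex $w$ or its whole
component, the latter at the price of $1$ in the regularity (\<open>reg_le_clique_step\<close>).

\<^bold>\<open>Lower bound.\<close> The bipartite complement of a path on $7$ vertices is a path on $7$ vertices, so
$G_n$ contains an induced path $P_7$. The six generators of $J_{P_7}$ form a regular sequence of
quadrics, and dividing by one of them shifts nonvanishing Koszul homology from $(p, j)$ to
$(p + 1, j + 2)$; hence $H_6(S'/J_{P_7})_{12} \ne 0$ over the polynomial ring $S'$ of the path. Setting the remaining
variables to zero is a retraction of Koszul complexes, so that $H_6(S/J)_{12} \ne 0$ as well
(\<open>koszul_vanish_induced_path\<close>).

\<^bold>\<open>Betti numbers.\<close> The regularity is defined through a chosen minimal graded free resolution. For
any such resolution dimension shifting shows that a generator of degree $j$ occurs in homological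
degree $i$ iff $H_i(S/J)_j \ne 0$ (\<open>min_res_degrees\<close>). A resolution exists (\<open>min_res_exists\<close>): since
the regularity is bounded, the syzygy modules are generated in bounded degrees, thus
by finitely many elements, and a generating set of minimal cardinality makes the next map minimal.
\<close>

section \<open>Koszul homology of commuting operators\<close>

text \<open>The Koszul complex of operators $x_0, \dots, x_{n-1}$ on $M$. A chain \<open>z\<close> gives the coefficient
\<open>z T\<close> of the basis element $e_T$ of the exterior algebra. The complex for $x_0, \dots, x_n$ is the mapping cone of
$x_n$ on the complex for $x_0, \dots, x_{n-1}$, with $d(e_n \wedge b) = x_n b - e_n \wedge d b$. Stated as a
recursion this needs no explicit signs and no basis-dependent sums.\<close>

primrec koszul_d :: "(nat \<Rightarrow> 'm \<Rightarrow> 'm) \<Rightarrow> nat \<Rightarrow> (nat set \<Rightarrow> 'm::ab_group_add) \<Rightarrow> nat set \<Rightarrow> 'm" where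
  "koszul_d x 0 z = (\<lambda>T. 0)"
| "koszul_d x (Suc N) z = (\<lambda>T. if N \<in> T then - koszul_d x N (\<lambda>T'. z (insert N T')) (T - {N})
                        else koszul_d x N z T + x N (z (insert N T)))"

text \<open>Chains of homological degree $p$ and internal degree $j$; as $e_T$ has degree $|T|$, its coefficient has
degree $j - p$. The degree \<open>p\<close> is an integer so that $p - 1$ also makes sense for $p = 0$. Values
at other sets are left free, since the differential at sets of size $p - 1$ does not read them.\<close>

definition koszul_chain :: "nat \<Rightarrow> (int \<Rightarrow> 'm set) \<Rightarrow> int \<Rightarrow> int \<Rightarrow> (nat set \<Rightarrow> 'm) \<Rightarrow> bool" where
  "koszul_chain N M p j z \<longleftrightarrow> (\<forall>T \<subseteq> {..<N}. int (card T) = p \<longrightarrow> z T \<in> M (j - p))"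

text \<open>$H_p(x; M/U)_j = 0$, expressed by lifts to \<open>M\<close>, so that no quotient module has to be formed.\<close>

definition koszul_vanish :: "(nat \<Rightarrow> 'm::ab_group_add \<Rightarrow> 'm) \<Rightarrow> nat \<Rightarrow> (int \<Rightarrow> 'm set) \<Rightarrow> (int \<Rightarrow> 'm set) \<Rightarrow> int \<Rightarrow> int \<Rightarrow> bool" where
  "koszul_vanish x N M U p j \<longleftrightarrow> (\<forall>z. koszul_chain N M p j z \<longrightarrow> koszul_chain N U (p - 1) j (koszul_d x N z) \<longrightarrow>
      (\<exists>w. koszul_chain N M (p + 1) j w \<and> koszul_chain N U p j (\<lambda>T. z T - koszul_d x N w T)))"

definition graded_sub :: "(nat \<Rightarrow> 'm::ab_group_add \<Rightarrow> 'm) \<Rightarrow> nat \<Rightarrow> (int \<Rightarrow> 'm set) \<Rightarrow> bool" where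
  "graded_sub x N M \<longleftrightarrow> (\<forall>j. 0 \<in> M j \<and> (\<forall>a\<in>M j. \<forall>b\<in>M j. a - b \<in> M j) \<and> (\<forall>v<N. \<forall>a\<in>M j. x v a \<in> M (j + 1)))"

lemma graded_subD:
  assumes "graded_sub x N M"
  shows "0 \<in> M j" "a \<in> M j \<Longrightarrow> b \<in> M j \<Longrightarrow> a - b \<in> M j" "a \<in> M j \<Longrightarrow> - a \<in> M j"
    "a \<in> M j \<Longrightarrow> b \<in> M j \<Longrightarrow> a + b \<in> M j" "v < N \<Longrightarrow> a \<in> M j \<Longrightarrow> x v a \<in> M (j + 1)"
proof -
  show 0: "0 \<in> M j" and d: "\<And>a b. a \<in> M j \<Longrightarrow> b \<in> M j \<Longrightarrow> a - b \<in> M j"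
    and "v < N \<Longrightarrow> a \<in> M j \<Longrightarrow> x v a \<in> M (j + 1)"
    using assms unfolding graded_sub_def by auto
  show n: "- a \<in> M j" if "a \<in> M j" for a using d[OF 0 that] by simp
  show "a + b \<in> M j" if "a \<in> M j" "b \<in> M j" using d[OF that(1) n[OF that(2)]] by simp
qed

lemma kcD: "koszul_chain N M p j z \<Longrightarrow> T \<subseteq> {..<N} \<Longrightarrow> int (card T) = p \<Longrightarrow> z T \<in> M (j - p)"
  by (simp add: koszul_chain_def)

lemma koszul_chain_diff:
  assumes "graded_sub x N M" "koszul_chain N M p j z" "koszul_chain N M p j w"
  shows "koszul_chain N M p j (\<lambda>T. z T - w T)"
  using assms graded_subD(2)[OF assms(1)] unfolding koszul_chain_def by blast

lemma koszul_chain_add: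
  assumes "graded_sub x N M" "koszul_chain N M p j z" "koszul_chain N M p j w"
  shows "koszul_chain N M p j (\<lambda>T. z T + w T)"
  using assms graded_subD(4)[OF assms(1)] unfolding koszul_chain_def by blast

lemma koszul_chain_mono: "koszul_chain N U p j z \<Longrightarrow> (\<And>i. U i \<subseteq> M i) \<Longrightarrow> koszul_chain N M p j z"
  unfolding koszul_chain_def by blast

lemma finite_subset_lessThan: "T \<subseteq> {..<N::nat} \<Longrightarrow> finite T"
  using finite_subset by blast

lemma card_remove:
  "n \<in> T \<Longrightarrow> finite T \<Longrightarrow> int (card (T - {n})) = int (card T) - 1"
  using card_Suc_Diff1[of T n] by linarith

lemma koszul_d_cong:
  assumes "T0 \<subseteq> {..<N}" "\<And>T. T \<subseteq> {..<N} \<Longrightarrow> card T = Suc (card T0) \<Longrightarrow> z T = z' T"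
  shows "koszul_d x N z T0 = koszul_d x N z' T0"
  using assms
proof (induction N arbitrary: z z' T0)
  case 0
  then show ?case by simp
next
  case (Suc N)
  have fin: "finite T0" using Suc.prems(1) by (rule finite_subset_lessThan)
  show ?case
  proof (cases "N \<in> T0")
    case True
    have "koszul_d x N (\<lambda>T'. z (insert N T')) (T0 - {N}) = koszul_d x N (\<lambda>T'. z' (insert N T')) (T0 - {N})"
    proof (rule Suc.IH)
      show "T0 - {N} \<subseteq> {..<N}" using Suc.prems(1) by (auto simp: less_Suc_eq)
      fix T assume T: "T \<subseteq> {..<N}" "card T = Suc (card (T0 - {N}))"
      then have "card (insert N T) = Suc (card T0)"
        using True fin finite_subset_lessThan[OF T(1)] by (subst card_insert_disjoint) (use card_Suc_Diff1[OF fin True] in auto)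
      moreover have "insert N T \<subseteq> {..<Suc N}" using T by auto
      ultimately show "z (insert N T) = z' (insert N T)" by (rule Suc.prems(2)[rotated])
    qed
    then show ?thesis using True by simp
  next
    case False
    then have T0: "T0 \<subseteq> {..<N}" using Suc.prems(1) by (auto simp: less_Suc_eq)
    have "koszul_d x N z T0 = koszul_d x N z' T0"
      using T0 Suc.prems(2) by (intro Suc.IH) (auto simp: subset_iff less_Suc_eq)
    moreover have "z (insert N T0) = z' (insert N T0)"
      using False fin T0 by (intro Suc.prems(2)) auto
    ultimately show ?thesis using False by simp
  qed
qed

text \<open>The reason why Koszul homology is functorial in the module.\<close>

lemma koszul_d_hom:
  assumes "\<And>a b. f (a - b) = f a - f b" "\<And>v m. v < N \<Longrightarrow> f (x v m) = y v (f m)"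
  shows "f (koszul_d x N z T) = koszul_d y N (\<lambda>T. f (z T)) T"
proof -
  have f0: "f 0 = 0" using assms(1)[of 0 0] by simp
  have fm: "f (- a) = - f a" for a using assms(1)[of 0 a] f0 by simp
  have fa: "f (a + b) = f a + f b" for a b using assms(1)[of a "- b"] fm[of b] by simp
  show ?thesis using assms(2)
    by (induction N arbitrary: z T) (auto simp: f0 fm fa)
qed

lemma koszul_d_empty: "koszul_d x N z {} = (\<Sum>v<N. x v (z {v}))"
  by (induction N arbitrary: z) auto

locale commuting_operators =
  fixes x :: "nat \<Rightarrow> 'm::ab_group_add \<Rightarrow> 'm" and N :: nat
  assumes x_diff: "x v (a - b) = x v a - x v b"
    and x_comm: "x v (x w a) = x w (x v a)"
begin

lemma x_zero [simp]: "x v 0 = 0"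
  using x_diff[of v 0 0] by simp

lemma x_minus: "x v (- a) = - x v a"
  using x_diff[of v 0 a] by simp

lemma koszul_d_diff: "koszul_d x n (\<lambda>T. z T - w T) T = koszul_d x n z T - koszul_d x n w T"
  by (induction n arbitrary: z w T) (auto simp: x_diff)

lemma koszul_d_zero: "koszul_d x n (\<lambda>T. 0) T = 0"
  using koszul_d_diff[of n "\<lambda>T. 0" "\<lambda>T. 0" T] by simp

lemma koszul_d_minus: "koszul_d x n (\<lambda>T. - z T) T = - koszul_d x n z T"
  using koszul_d_diff[of n "\<lambda>T. 0" z T] by (simp add: koszul_d_zero)

lemma koszul_d_add: "koszul_d x n (\<lambda>T. z T + w T) T = koszul_d x n z T + koszul_d x n w T"
  using koszul_d_diff[of n z "\<lambda>T. - w T" T] by (simp add: koszul_d_minus)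

lemma koszul_d_x: "koszul_d x n (\<lambda>T. x v (z T)) T = x v (koszul_d x n z T)"
  by (rule koszul_d_hom[symmetric]) (auto simp: x_diff x_comm)

lemma koszul_d_koszul_d: "T \<subseteq> {..<n} \<Longrightarrow> koszul_d x n (koszul_d x n z) T = 0"
proof (induction n arbitrary: z T)
  case 0
  then show ?case by simp
next
  case (Suc n)
  show ?case
  proof (cases "n \<in> T")
    case True
    have T: "T - {n} \<subseteq> {..<n}" using Suc.prems by (auto simp: less_Suc_eq)
    have "koszul_d x n (\<lambda>T'. koszul_d x (Suc n) z (insert n T')) (T - {n})
        = koszul_d x n (\<lambda>T'. - koszul_d x n (\<lambda>T'. z (insert n T')) T') (T - {n})"
    proof (rule koszul_d_cong[OF T])
      fix T' assume "T' \<subseteq> {..<n}"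
      then have "insert n T' - {n} = T'" by auto
      then show "koszul_d x (Suc n) z (insert n T') = - koszul_d x n (\<lambda>T'. z (insert n T')) T'" by simp
    qed
    also have "\<dots> = 0" by (simp only: koszul_d_minus Suc.IH[OF T]) simp
    finally show ?thesis using True by simp
  next
    case False
    then have T: "T \<subseteq> {..<n}" using Suc.prems by (auto simp: less_Suc_eq)
    have "koszul_d x n (koszul_d x (Suc n) z) T = koszul_d x n (\<lambda>T'. koszul_d x n z T' + x n (z (insert n T'))) T"
    proof (rule koszul_d_cong[OF T])
      fix T' assume "T' \<subseteq> {..<n}"
      then have "n \<notin> T'" by auto
      then show "koszul_d x (Suc n) z T' = koszul_d x n z T' + x n (z (insert n T'))" by simp
    qed
    also have "\<dots> = x n (koszul_d x n (\<lambda>T'. z (insert n T')) T)"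
      by (simp add: koszul_d_add koszul_d_x Suc.IH[OF T])
    moreover have "insert n T - {n} = T" using False by auto
    ultimately show ?thesis using False by (simp add: x_minus)
  qed
qed

lemma koszul_chain_koszul_d:
  assumes "graded_sub x n M" "koszul_chain n M p j z"
  shows "koszul_chain n M (p - 1) j (koszul_d x n z)"
  using assms
proof (induction n arbitrary: z p j)
  case 0
  then show ?case by (auto simp: koszul_chain_def graded_sub_def)
next
  case (Suc n)
  have gM: "graded_sub x n M" using Suc.prems(1) by (auto simp: graded_sub_def)
  note M = graded_subD[OF Suc.prems(1)]
  have z1: "koszul_chain n M (p - 1) (j - 1) (\<lambda>T'. z (insert n T'))"
    unfolding koszul_chain_def
  proof (intro allI impI)
    fix T assume T: "T \<subseteq> {..<n}" "int (card T) = p - 1"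
    then have "int (card (insert n T)) = p"
      using finite_subset_lessThan[OF T(1)] by (subst card_insert_disjoint) auto
    moreover have "insert n T \<subseteq> {..<Suc n}" using T by auto
    ultimately have "z (insert n T) \<in> M (j - p)" by (intro kcD[OF Suc.prems(2)])
    then show "z (insert n T) \<in> M (j - 1 - (p - 1))" by (simp add: algebra_simps)
  qed
  have z0: "koszul_chain n M p j z" using Suc.prems(2) unfolding koszul_chain_def by (auto simp: subset_iff less_Suc_eq)
  show ?case unfolding koszul_chain_def
  proof (intro allI impI)
    fix T assume T: "T \<subseteq> {..<Suc n}" "int (card T) = p - 1"
    have fin: "finite T" using T(1) by (rule finite_subset_lessThan)
    show "koszul_d x (Suc n) z T \<in> M (j - (p - 1))"
    proof (cases "n \<in> T")
      case True
      have "T - {n} \<subseteq> {..<n}" "int (card (T - {n})) = p - 1 - 1"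
        using T card_remove[OF True fin] by (auto simp only: less_Suc_eq lessThan_iff subset_iff)
      then have "koszul_d x n (\<lambda>T'. z (insert n T')) (T - {n}) \<in> M (j - 1 - (p - 1 - 1))"
        by (intro kcD[OF Suc.IH[OF gM z1]])
      then show ?thesis using True M(3) by (simp add: algebra_simps)
    next
      case False
      then have T': "T \<subseteq> {..<n}" using T(1) by (auto simp: less_Suc_eq)
      have a: "koszul_d x n z T \<in> M (j - (p - 1))" using T' T(2) by (intro kcD[OF Suc.IH[OF gM z0]])
      have "z (insert n T) \<in> M (j - 1 - (p - 1))" using kcD[OF z1 T' T(2)] .
      then have "x n (z (insert n T)) \<in> M (j - 1 - (p - 1) + 1)" by (intro M(5)) auto
      then show ?thesis using False a M(4) by (simp add: algebra_simps)
    qed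
  qed
qed


text \<open>The exterior product with $e_v$. It is a null-homotopy of the operator $x_v$, and for this reason the
variables act by zero on Koszul homology.\<close>

primrec wedge :: "nat \<Rightarrow> nat \<Rightarrow> (nat set \<Rightarrow> 'm) \<Rightarrow> nat set \<Rightarrow> 'm" where
  "wedge v 0 z = (\<lambda>T. 0)"
| "wedge v (Suc n) z = (\<lambda>T. if v = n then (if n \<in> T then z (T - {n}) else 0)
      else if n \<in> T then - wedge v n (\<lambda>T'. z (insert n T')) (T - {n}) else wedge v n z T)"

lemma wedge_cong:
  assumes "T0 \<subseteq> {..<n}" "\<And>T. T \<subseteq> {..<n} \<Longrightarrow> z T = z' T"
  shows "wedge v n z T0 = wedge v n z' T0"
  using assms
proof (induction n arbitrary: z z' T0)
  case 0
  then show ?case by simp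
next
  case (Suc n)
  have T: "T0 - {n} \<subseteq> {..<n}" using Suc.prems(1) by (auto simp: less_Suc_eq)
  have "wedge v n (\<lambda>T'. z (insert n T')) (T0 - {n}) = wedge v n (\<lambda>T'. z' (insert n T')) (T0 - {n})"
    by (rule Suc.IH[OF T]) (rule Suc.prems(2), auto simp: less_Suc_eq subset_iff)
  moreover have "n \<notin> T0 \<Longrightarrow> wedge v n z T0 = wedge v n z' T0"
    using Suc.prems by (intro Suc.IH) (auto simp: less_Suc_eq subset_iff)
  moreover have "z (T0 - {n}) = z' (T0 - {n})"
    by (rule Suc.prems(2)) (use Suc.prems(1) in auto)
  ultimately show ?case by simp
qed

lemma wedge_diff: "wedge v n (\<lambda>T. z T - w T) T = wedge v n z T - wedge v n w T"
  by (induction n arbitrary: z w T) auto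

lemma wedge_zero: "wedge v n (\<lambda>T. 0) T = 0"
  using wedge_diff[of v n "\<lambda>T. 0" "\<lambda>T. 0" T] by simp

lemma wedge_minus: "wedge v n (\<lambda>T. - z T) T = - wedge v n z T"
  using wedge_diff[of v n "\<lambda>T. 0" z T] by (simp add: wedge_zero)

lemma wedge_add: "wedge v n (\<lambda>T. z T + w T) T = wedge v n z T + wedge v n w T"
  using wedge_diff[of v n z "\<lambda>T. - w T" T] by (simp add: wedge_minus)

lemma wedge_x: "wedge v n (\<lambda>T. x u (z T)) T = x u (wedge v n z T)"
  by (induction n arbitrary: z T) (auto simp: x_minus)

lemma koszul_homotopy:
  assumes "v < n" "T \<subseteq> {..<n}"
  shows "koszul_d x n (wedge v n z) T + wedge v n (koszul_d x n z) T = x v (z T)"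
  using assms
proof (induction n arbitrary: z T)
  case 0
  then show ?case by simp
next
  case (Suc n)
  have Tn: "T - {n} \<subseteq> {..<n}" using Suc.prems by (auto simp: less_Suc_eq)
  show ?case
  proof (cases "n \<in> T")
    case T: True
    have ins: "T' - {n} = T'" if "T' \<subseteq> {..<n}" for T' using that by auto
    show ?thesis
    proof (cases "v = n")
      case True
      have "koszul_d x n (\<lambda>T'. wedge v (Suc n) z (insert n T')) (T - {n}) = koszul_d x n z (T - {n})"
        by (rule koszul_d_cong[OF Tn]) (simp add: True ins)
      then show ?thesis using True T by (simp add: insert_absorb)
    next
      case False
      then have "v < n" using Suc.prems by simp
      have "koszul_d x n (\<lambda>T'. wedge v (Suc n) z (insert n T')) (T - {n})
          = koszul_d x n (\<lambda>T'. - wedge v n (\<lambda>T'. z (insert n T')) T') (T - {n})"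
        by (rule koszul_d_cong[OF Tn]) (simp add: ins False)
      moreover have "wedge v n (\<lambda>T'. koszul_d x (Suc n) z (insert n T')) (T - {n})
          = wedge v n (\<lambda>T'. - koszul_d x n (\<lambda>T'. z (insert n T')) T') (T - {n})"
        by (rule wedge_cong[OF Tn]) (simp add: ins False)
      moreover note Suc.IH[OF \<open>v < n\<close> Tn, of "\<lambda>T'. z (insert n T')"]
      ultimately show ?thesis using False T by (simp add: koszul_d_minus wedge_minus insert_absorb)
    qed
  next
    case T: False
    then have Tn: "T \<subseteq> {..<n}" and Tn': "insert n T - {n} = T"
      using Suc.prems by (auto simp: less_Suc_eq)
    have nn: "n \<notin> T'" if "T' \<subseteq> {..<n}" for T' using that by auto
    show ?thesis
    proof (cases "v = n")
      case True
      have "koszul_d x n (wedge v (Suc n) z) T = koszul_d x n (\<lambda>T. 0) T"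
        by (rule koszul_d_cong[OF Tn]) (use nn True in auto)
      then show ?thesis using True T Tn' by (simp add: koszul_d_zero)
    next
      case False
      then have "v < n" using Suc.prems by simp
      have "koszul_d x n (wedge v (Suc n) z) T = koszul_d x n (wedge v n z) T"
        by (rule koszul_d_cong[OF Tn]) (use nn False in auto)
      moreover have "wedge v n (koszul_d x (Suc n) z) T = wedge v n (\<lambda>T. koszul_d x n z T + x n (z (insert n T))) T"
        by (rule wedge_cong[OF Tn]) (use nn False in auto)
      moreover note Suc.IH[OF \<open>v < n\<close> Tn, of z]
      ultimately show ?thesis using False T Tn' by (simp add: wedge_add wedge_x x_minus algebra_simps)
    qed
  qed
qed

lemma koszul_chain_wedge:
  assumes "graded_sub x n M" "koszul_chain n M p j z"
  shows "koszul_chain n M (p + 1) (j + 1) (wedge v n z)"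
  using assms
proof (induction n arbitrary: z p j)
  case 0
  then show ?case by (auto simp: koszul_chain_def graded_sub_def)
next
  case (Suc n)
  have gM: "graded_sub x n M" using Suc.prems(1) by (auto simp: graded_sub_def)
  note M = graded_subD[OF Suc.prems(1)]
  have z1: "koszul_chain n M (p - 1) (j - 1) (\<lambda>T'. z (insert n T'))"
    unfolding koszul_chain_def
  proof (intro allI impI)
    fix T assume T: "T \<subseteq> {..<n}" "int (card T) = p - 1"
    then have "int (card (insert n T)) = p"
      using finite_subset_lessThan[OF T(1)] by (subst card_insert_disjoint) auto
    moreover have "insert n T \<subseteq> {..<Suc n}" using T by auto
    ultimately have "z (insert n T) \<in> M (j - p)" by (intro kcD[OF Suc.prems(2)])
    then show "z (insert n T) \<in> M (j - 1 - (p - 1))" by (simp add: algebra_simps)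
  qed
  have z0: "koszul_chain n M p j z" using Suc.prems(2) unfolding koszul_chain_def by (auto simp: subset_iff less_Suc_eq)
  show ?case unfolding koszul_chain_def
  proof (intro allI impI)
    fix T assume T: "T \<subseteq> {..<Suc n}" "int (card T) = p + 1"
    have fin: "finite T" using T(1) by (rule finite_subset_lessThan)
    have Tn: "T - {n} \<subseteq> {..<n}" using T by (auto simp: less_Suc_eq)
    have c: "int (card (T - {n})) = p" if "n \<in> T"
      using T(2) that card_Suc_Diff1[OF fin that] by linarith
    have "z (T - {n}) \<in> M (j - p)" if "n \<in> T"
      by (rule kcD[OF z0 Tn c[OF that]])
    moreover have "wedge v n (\<lambda>T'. z (insert n T')) (T - {n}) \<in> M (j - p)" if "n \<in> T"
      using kcD[OF Suc.IH[OF gM z1] Tn] c[OF that] by simp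
    moreover have "wedge v n z T \<in> M (j - p)" if "n \<notin> T"
      using kcD[OF Suc.IH[OF gM z0], of T] T that by (auto simp: less_Suc_eq subset_iff)
    ultimately show "wedge v (Suc n) z T \<in> M (j + 1 - (p + 1))" using M(1,3) by auto
  qed
qed


lemma koszul_vanishD:
  assumes "koszul_vanish x n M U p j" "koszul_chain n M p j z" "koszul_chain n U (p - 1) j (koszul_d x n z)"
  obtains w where "koszul_chain n M (p + 1) j w" "koszul_chain n U p j (\<lambda>T. z T - koszul_d x n w T)"
  using assms unfolding koszul_vanish_def by blast

lemma koszul_vanishI:
  assumes "\<And>z. koszul_chain n M p j z \<Longrightarrow> koszul_chain n U (p - 1) j (koszul_d x n z) \<Longrightarrow>
      \<exists>w. koszul_chain n M (p + 1) j w \<and> koszul_chain n U p j (\<lambda>T. z T - koszul_d x n w T)"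
  shows "koszul_vanish x n M U p j"
  using assms unfolding koszul_vanish_def by blast

text \<open>Decomposes chains coefficient by coefficient.\<close>

lemma koszul_chain_pick:
  assumes "koszul_chain n M p j z" "\<And>i a. a \<in> M i \<Longrightarrow> \<exists>b c. a = b + f c \<and> b \<in> P i \<and> c \<in> Q (i - e)"
  obtains s t where "koszul_chain n P p j s" "koszul_chain n Q p (j - e) t"
    "\<And>T. T \<subseteq> {..<n} \<Longrightarrow> int (card T) = p \<Longrightarrow> z T = s T + f (t T)"
proof -
  have "\<exists>g. \<forall>T\<in>{T. T \<subseteq> {..<n} \<and> int (card T) = p}. z T = fst (g T) + f (snd (g T)) \<and> fst (g T) \<in> P (j - p) \<and>
      snd (g T) \<in> Q (j - p - e)"
  proof (rule bchoice, rule ballI)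
    fix T assume "T \<in> {T. T \<subseteq> {..<n} \<and> int (card T) = p}"
    then have "z T \<in> M (j - p)" using kcD[OF assms(1)] by simp
    from assms(2)[OF this] obtain b c where "z T = b + f c \<and> b \<in> P (j - p) \<and> c \<in> Q (j - p - e)" by blast
    then show "\<exists>g. z T = fst g + f (snd g) \<and> fst g \<in> P (j - p) \<and> snd g \<in> Q (j - p - e)"
      by (intro exI[of _ "(b, c)"]) simp
  qed
  then obtain g where g: "\<And>T. T \<subseteq> {..<n} \<Longrightarrow> int (card T) = p \<Longrightarrow> z T = fst (g T) + f (snd (g T)) \<and>
      fst (g T) \<in> P (j - p) \<and> snd (g T) \<in> Q (j - p - e)" by blast
  show ?thesis
  proof (rule that[of "\<lambda>T. fst (g T)" "\<lambda>T. snd (g T)"])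
    show "koszul_chain n P p j (\<lambda>T. fst (g T))" using g by (auto simp: koszul_chain_def)
    have "j - e - p = j - p - e" by simp
    then show "koszul_chain n Q p (j - e) (\<lambda>T. snd (g T))" using g unfolding koszul_chain_def by metis
  qed (use g in blast)
qed

text \<open>Part of the long exact sequence of
$0 \to M/(U_1 \cap U_2) \to M/U_1 \oplus M/U_2 \to M/(U_1 + U_2) \to 0$: a cycle of the first module bounds
in both summands of the second one, and the difference of the bounding chains is a cycle in the third one.\<close>

lemma koszul_vanish_inter:
  assumes M: "graded_sub x n M" and U1: "graded_sub x n U1" and U2: "graded_sub x n U2"
    and sub: "\<And>i. U1 i \<subseteq> M i" "\<And>i. U2 i \<subseteq> M i"
    and sum: "\<And>i a. a \<in> U i \<Longrightarrow> \<exists>b c. a = b + c \<and> b \<in> U1 i \<and> c \<in> U2 i"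
      "\<And>i. U1 i \<subseteq> U i" "\<And>i. U2 i \<subseteq> U i" and U: "graded_sub x n U"
    and v: "koszul_vanish x n M U1 p j" "koszul_vanish x n M U2 p j" "koszul_vanish x n M U (p + 1) j"
  shows "koszul_vanish x n M (\<lambda>i. U1 i \<inter> U2 i) p j"
proof (rule koszul_vanishI)
  fix z assume z: "koszul_chain n M p j z" and dz: "koszul_chain n (\<lambda>i. U1 i \<inter> U2 i) (p - 1) j (koszul_d x n z)"
  have dz1: "koszul_chain n U1 (p - 1) j (koszul_d x n z)" and dz2: "koszul_chain n U2 (p - 1) j (koszul_d x n z)"
    using dz by (auto intro: koszul_chain_mono)
  obtain w1 where w1: "koszul_chain n M (p + 1) j w1" and u1: "koszul_chain n U1 p j (\<lambda>T. z T - koszul_d x n w1 T)"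
    using koszul_vanishD[OF v(1) z dz1] .
  obtain w2 where w2: "koszul_chain n M (p + 1) j w2" and u2: "koszul_chain n U2 p j (\<lambda>T. z T - koszul_d x n w2 T)"
    using koszul_vanishD[OF v(2) z dz2] .
  define w where "w = (\<lambda>T. w1 T - w2 T)"
  have w: "koszul_chain n M (p + 1) j w" unfolding w_def by (rule koszul_chain_diff[OF M w1 w2])
  have "koszul_d x n w = (\<lambda>T. (z T - koszul_d x n w2 T) - (z T - koszul_d x n w1 T))"
    by (auto simp: w_def koszul_d_diff)
  then have dw: "koszul_chain n U (p + 1 - 1) j (koszul_d x n w)"
    using koszul_chain_diff[OF U koszul_chain_mono[OF u2 sum(3)] koszul_chain_mono[OF u1 sum(2)]] by simp
  obtain y where y: "koszul_chain n M (p + 1 + 1) j y" and s: "koszul_chain n U (p + 1) j (\<lambda>T. w T - koszul_d x n y T)"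
    using koszul_vanishD[OF v(3) w dw] .
  obtain s1 s2 where s1: "koszul_chain n U1 (p + 1) j s1" and s2: "koszul_chain n U2 (p + 1) (j - 0) s2"
    and ss: "\<And>T. T \<subseteq> {..<n} \<Longrightarrow> int (card T) = p + 1 \<Longrightarrow> w T - koszul_d x n y T = s1 T + (\<lambda>a. a) (s2 T)"
  proof (rule koszul_chain_pick[OF s, where P = U1 and Q = U2 and f = "\<lambda>a. a" and e = 0])
  qed (use sum(1) in auto)
  have "koszul_chain n M (p + 1) j (\<lambda>T. w1 T - s1 T)"
    by (rule koszul_chain_diff[OF M w1 koszul_chain_mono[OF s1 sub(1)]])
  moreover have "koszul_chain n U1 p j (\<lambda>T. z T - koszul_d x n (\<lambda>T. w1 T - s1 T) T)"
    using koszul_chain_add[OF U1 u1 koszul_chain_koszul_d[OF U1 s1, simplified]] by (simp add: koszul_d_diff algebra_simps)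
  moreover have "koszul_chain n U2 p j (\<lambda>T. z T - koszul_d x n (\<lambda>T. w1 T - s1 T) T)"
  proof -
    have "koszul_d x n (\<lambda>T. w1 T - s1 T) T = koszul_d x n w2 T + koszul_d x n s2 T" if T: "T \<subseteq> {..<n}" "int (card T) = p" for T
    proof -
      have "koszul_d x n (\<lambda>T. w1 T - s1 T) T = koszul_d x n (\<lambda>T. w2 T + (s2 T + koszul_d x n y T)) T"
        by (rule koszul_d_cong[OF T(1)]) (use ss T in \<open>auto simp: w_def algebra_simps\<close>)
      also have "\<dots> = koszul_d x n w2 T + koszul_d x n s2 T"
        by (simp add: koszul_d_add koszul_d_koszul_d[OF T(1)])
      finally show ?thesis .
    qed
    moreover have "koszul_chain n U2 p j (\<lambda>T. (z T - koszul_d x n w2 T) - koszul_d x n s2 T)"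
      using koszul_chain_diff[OF U2 u2 koszul_chain_koszul_d[OF U2 s2, simplified]] .
    ultimately show ?thesis unfolding koszul_chain_def by (auto simp: algebra_simps)
  qed
  ultimately show "\<exists>w. koszul_chain n M (p + 1) j w \<and> koszul_chain n (\<lambda>i. U1 i \<inter> U2 i) p j (\<lambda>T. z T - koszul_d x n w T)"
    by (intro exI[of _ "\<lambda>T. w1 T - s1 T"]) (auto simp: koszul_chain_def)
qed

end

text \<open>Here \<open>y\<close> stands for the multiplication by a homogeneous ring element of degree \<open>e\<close>. The module \<open>U'\<close> is the
colon module $U : y$ and \<open>V\<close> is $U + yM$, so that
$0 \to (M/U')(-e) \to M/U \to M/V \to 0$ is exact; the next lemmas are parts of its long exact sequence.\<close>

locale colon_setup = commuting_operators x n for x :: "nat \<Rightarrow> 'm::ab_group_add \<Rightarrow> 'm" and n :: nat +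
  fixes M U U' V :: "int \<Rightarrow> 'm set" and y :: "'m \<Rightarrow> 'm" and e :: int
  assumes gM: "graded_sub x n M" and gU: "graded_sub x n U" and gU': "graded_sub x n U'" and gV: "graded_sub x n V"
    and y_diff: "y (a - b) = y a - y b" and y_comm: "y (x v a) = x v (y a)"
    and y_M: "a \<in> M i \<Longrightarrow> y a \<in> M (i + e)"
    and U_M: "U i \<subseteq> M i"
    and U'_iff: "a \<in> U' i \<longleftrightarrow> a \<in> M i \<and> y a \<in> U (i + e)"
    and V_iff: "a \<in> V i \<longleftrightarrow> (\<exists>b c. a = b + y c \<and> b \<in> U i \<and> c \<in> M (i - e))"
begin

lemma y_zero [simp]: "y 0 = 0" using y_diff[of 0 0] by simp

lemma koszul_d_y: "koszul_d x n (\<lambda>T. y (z T)) T = y (koszul_d x n z T)"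
  by (rule koszul_d_hom[symmetric]) (auto simp: y_diff y_comm)

lemma U_V: "U i \<subseteq> V i"
proof
  fix a assume "a \<in> U i"
  then show "a \<in> V i" unfolding V_iff using graded_subD(1)[OF gM]
    by (intro exI[of _ a] exI[of _ 0]) simp
qed

lemma koszul_chain_y: "koszul_chain n M p j z \<Longrightarrow> koszul_chain n M p (j + e) (\<lambda>T. y (z T))"
  unfolding koszul_chain_def using y_M by (simp add: algebra_simps) (metis add_diff_eq add.commute)

lemma koszul_chain_U': "koszul_chain n U' p j z \<longleftrightarrow> koszul_chain n M p j z \<and> koszul_chain n U p (j + e) (\<lambda>T. y (z T))"
proof -
  have "j - p + e = j + e - p" by simp
  then show ?thesis unfolding koszul_chain_def U'_iff by metis
qed

lemma koszul_vanish_of_colon: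
  assumes "koszul_vanish x n M V p j" "koszul_vanish x n M U' p (j - e)"
  shows "koszul_vanish x n M U p j"
proof (rule koszul_vanishI)
  fix z assume z: "koszul_chain n M p j z" and dz: "koszul_chain n U (p - 1) j (koszul_d x n z)"
  obtain w where w: "koszul_chain n M (p + 1) j w" and u: "koszul_chain n V p j (\<lambda>T. z T - koszul_d x n w T)"
    using koszul_vanishD[OF assms(1) z koszul_chain_mono[OF dz U_V]] .
  obtain s t where s: "koszul_chain n U p j s" and t: "koszul_chain n M p (j - e) t"
    and st: "\<And>T. T \<subseteq> {..<n} \<Longrightarrow> int (card T) = p \<Longrightarrow> z T - koszul_d x n w T = s T + y (t T)"
    using koszul_chain_pick[OF u, where P = U and Q = M and f = y and e = e] V_iff by metis
  have "koszul_chain n U' (p - 1) (j - e) (koszul_d x n t)"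
    unfolding koszul_chain_U'
  proof
    show "koszul_chain n M (p - 1) (j - e) (koszul_d x n t)" by (rule koszul_chain_koszul_d[OF gM t])
    have "y (koszul_d x n t T) = koszul_d x n z T - koszul_d x n s T" if T: "T \<subseteq> {..<n}" "int (card T) = p - 1" for T
    proof -
      have "koszul_d x n (\<lambda>T. y (t T)) T = koszul_d x n (\<lambda>T. z T - koszul_d x n w T - s T) T"
        by (rule koszul_d_cong[OF T(1)]) (use st T in \<open>auto simp: algebra_simps\<close>)
      then show ?thesis by (simp add: koszul_d_diff koszul_d_koszul_d[OF T(1)] koszul_d_y)
    qed
    moreover have "koszul_chain n U (p - 1) j (\<lambda>T. koszul_d x n z T - koszul_d x n s T)"
      by (rule koszul_chain_diff[OF gU dz koszul_chain_koszul_d[OF gU s]])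
    ultimately show "koszul_chain n U (p - 1) (j - e + e) (\<lambda>T. y (koszul_d x n t T))" by (simp add: koszul_chain_def)
  qed
  then obtain w' where w': "koszul_chain n M (p + 1) (j - e) w'" and u': "koszul_chain n U' p (j - e) (\<lambda>T. t T - koszul_d x n w' T)"
    using koszul_vanishD[OF assms(2) t] by blast
  define W where "W = (\<lambda>T. w T + y (w' T))"
  have "koszul_chain n M (p + 1) j W"
    unfolding W_def using koszul_chain_add[OF gM w] koszul_chain_y[OF w'] by simp
  moreover have "z T - koszul_d x n W T = s T + y (t T - koszul_d x n w' T)" if T: "T \<subseteq> {..<n}" "int (card T) = p" for T
    using st[OF T] by (simp add: W_def koszul_d_add koszul_d_y y_diff algebra_simps)
  then have "koszul_chain n U p j (\<lambda>T. z T - koszul_d x n W T)"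
    using koszul_chain_add[OF gU s, of "\<lambda>T. y (t T - koszul_d x n w' T)"] u' unfolding koszul_chain_U' by (simp add: koszul_chain_def)
  ultimately show "\<exists>w. koszul_chain n M (p + 1) j w \<and> koszul_chain n U p j (\<lambda>T. z T - koszul_d x n w T)" by blast
qed

lemma koszul_vanish_of_quotient:
  assumes "koszul_vanish x n M U p j" "koszul_vanish x n M U' (p - 1) (j - e)"
  shows "koszul_vanish x n M V p j"
proof (rule koszul_vanishI)
  fix z assume z: "koszul_chain n M p j z" and dz: "koszul_chain n V (p - 1) j (koszul_d x n z)"
  obtain s t where s: "koszul_chain n U (p - 1) j s" and t: "koszul_chain n M (p - 1) (j - e) t"
    and st: "\<And>T. T \<subseteq> {..<n} \<Longrightarrow> int (card T) = p - 1 \<Longrightarrow> koszul_d x n z T = s T + y (t T)"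
    using koszul_chain_pick[OF dz, where P = U and Q = M and f = y and e = e] V_iff by metis
  have "koszul_chain n U' (p - 1 - 1) (j - e) (koszul_d x n t)"
    unfolding koszul_chain_U'
  proof
    show "koszul_chain n M (p - 1 - 1) (j - e) (koszul_d x n t)" by (rule koszul_chain_koszul_d[OF gM t])
    have "y (koszul_d x n t T) = - koszul_d x n s T" if T: "T \<subseteq> {..<n}" "int (card T) = p - 1 - 1" for T
    proof -
      have "koszul_d x n (\<lambda>T. y (t T)) T = koszul_d x n (\<lambda>T. koszul_d x n z T - s T) T"
        by (rule koszul_d_cong[OF T(1)]) (use st T in \<open>auto simp: algebra_simps\<close>)
      then show ?thesis by (simp add: koszul_d_diff koszul_d_koszul_d[OF T(1)] koszul_d_y)
    qed
    moreover have "koszul_chain n U (p - 1 - 1) j (\<lambda>T. - koszul_d x n s T)"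
      using koszul_chain_koszul_d[OF gU s] graded_subD(3)[OF gU] by (auto simp: koszul_chain_def)
    ultimately show "koszul_chain n U (p - 1 - 1) (j - e + e) (\<lambda>T. y (koszul_d x n t T))" by (simp add: koszul_chain_def)
  qed
  then obtain w' where w': "koszul_chain n M (p - 1 + 1) (j - e) w'"
    and u': "koszul_chain n U' (p - 1) (j - e) (\<lambda>T. t T - koszul_d x n w' T)"
    using koszul_vanishD[OF assms(2) t] by blast
  define z' where "z' = (\<lambda>T. z T - y (w' T))"
  have z': "koszul_chain n M p j z'"
    unfolding z'_def using koszul_chain_diff[OF gM z] koszul_chain_y[OF w'] by simp
  have "koszul_d x n z' T = s T + y (t T - koszul_d x n w' T)" if T: "T \<subseteq> {..<n}" "int (card T) = p - 1" for T
    using st[OF T] by (simp add: z'_def koszul_d_diff koszul_d_y y_diff algebra_simps)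
  then have "koszul_chain n U (p - 1) j (koszul_d x n z')"
    using koszul_chain_add[OF gU s, of "\<lambda>T. y (t T - koszul_d x n w' T)"] u' unfolding koszul_chain_U' by (simp add: koszul_chain_def)
  then obtain w where w: "koszul_chain n M (p + 1) j w" and u: "koszul_chain n U p j (\<lambda>T. z' T - koszul_d x n w T)"
    using koszul_vanishD[OF assms(1) z'] by blast
  have "z T - koszul_d x n w T \<in> V (j - p)" if T: "T \<subseteq> {..<n}" "int (card T) = p" for T
    unfolding V_iff
  proof (intro exI conjI)
    show "z T - koszul_d x n w T = (z' T - koszul_d x n w T) + y (w' T)" by (simp add: z'_def)
    show "z' T - koszul_d x n w T \<in> U (j - p)" by (rule kcD[OF u T])
    show "w' T \<in> M (j - p - e)" using kcD[OF w' T(1)] T(2) by (simp add: algebra_simps)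
  qed
  then have "koszul_chain n V p j (\<lambda>T. z T - koszul_d x n w T)" by (simp add: koszul_chain_def)
  then show "\<exists>w. koszul_chain n M (p + 1) j w \<and> koszul_chain n V p j (\<lambda>T. z T - koszul_d x n w T)" using w by blast
qed

text \<open>The connecting map $H_{p+1}(M/V)_{j+e} \to H_p(M/U)_j$ is onto, because its cokernel embeds in
$H_p(M/U)_{j+e}$ by multiplication with \<open>y\<close>, which is zero on homology.\<close>

lemma koszul_vanish_of_nonzerodivisor:
  assumes nzd: "\<And>i a. a \<in> M i \<Longrightarrow> y a \<in> U (i + e) \<Longrightarrow> a \<in> U i"
    and htp: "\<And>z T. T \<subseteq> {..<n} \<Longrightarrow> koszul_d x n (h z) T + h (koszul_d x n z) T = y (z T)"
      "\<And>p j z. koszul_chain n M p j z \<Longrightarrow> koszul_chain n M (p + 1) (j + e) (h z)"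
      "\<And>p j z. koszul_chain n U p j z \<Longrightarrow> koszul_chain n U (p + 1) (j + e) (h z)"
    and v: "koszul_vanish x n M V (p + 1) (j + e)"
  shows "koszul_vanish x n M U p j"
proof (rule koszul_vanishI)
  fix z assume z: "koszul_chain n M p j z" and dz: "koszul_chain n U (p - 1) j (koszul_d x n z)"
  have hdz: "koszul_chain n U p (j + e) (h (koszul_d x n z))" using htp(3)[OF dz] by simp
  have "koszul_chain n V (p + 1 - 1) (j + e) (koszul_d x n (h z))"
    unfolding koszul_chain_def
  proof (intro allI impI)
    fix T assume T: "T \<subseteq> {..<n}" "int (card T) = p + 1 - 1"
    show "koszul_d x n (h z) T \<in> V (j + e - (p + 1 - 1))"
      unfolding V_iff
    proof (intro exI conjI)
      show "koszul_d x n (h z) T = - h (koszul_d x n z) T + y (z T)" using htp(1)[OF T(1), of z]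
        by (simp add: algebra_simps)
      show "- h (koszul_d x n z) T \<in> U (j + e - (p + 1 - 1))"
        using graded_subD(3)[OF gU kcD[OF hdz T(1)]] T(2) by simp
      show "z T \<in> M (j + e - (p + 1 - 1) - e)" using kcD[OF z T(1)] T(2) by simp
    qed
  qed
  then obtain w where w: "koszul_chain n M (p + 1 + 1) (j + e) w" and u: "koszul_chain n V (p + 1) (j + e) (\<lambda>T. h z T - koszul_d x n w T)"
    using koszul_vanishD[OF v htp(2)[OF z]] by blast
  obtain s t where s: "koszul_chain n U (p + 1) (j + e) s" and t: "koszul_chain n M (p + 1) (j + e - e) t"
    and st: "\<And>T. T \<subseteq> {..<n} \<Longrightarrow> int (card T) = p + 1 \<Longrightarrow> h z T - koszul_d x n w T = s T + y (t T)"
    using koszul_chain_pick[OF u, where P = U and Q = M and f = y and e = e] V_iff by metis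
  have "z T - koszul_d x n t T \<in> U (j - p)" if T: "T \<subseteq> {..<n}" "int (card T) = p" for T
  proof (rule nzd)
    show "z T - koszul_d x n t T \<in> M (j - p)"
      using graded_subD(2)[OF gM kcD[OF z T]] kcD[OF koszul_chain_koszul_d[OF gM t]] T by simp
    have "koszul_d x n (h z) T = koszul_d x n (\<lambda>T. koszul_d x n w T + (s T + y (t T))) T"
    proof (rule koszul_d_cong[OF T(1)])
      fix T' assume "T' \<subseteq> {..<n}" "card T' = Suc (card T)"
      then have "h z T' - koszul_d x n w T' = s T' + y (t T')" using st[of T'] T(2) by simp
      then show "h z T' = koszul_d x n w T' + (s T' + y (t T'))" by (simp add: diff_eq_eq add.commute)
    qed
    also have "\<dots> = koszul_d x n s T + y (koszul_d x n t T)"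
      by (simp only: koszul_d_add koszul_d_koszul_d[OF T(1)] koszul_d_y add_0)
    finally have "y (z T) = h (koszul_d x n z) T + (koszul_d x n s T + y (koszul_d x n t T))"
      using htp(1)[OF T(1), of z] by (simp only: add.commute)
    then have "y (z T - koszul_d x n t T) = h (koszul_d x n z) T + koszul_d x n s T"
      by (simp add: y_diff)
    also have "\<dots> \<in> U (j + e - p)"
      using graded_subD(4)[OF gU kcD[OF hdz T]] kcD[OF koszul_chain_koszul_d[OF gU s]] T by simp
    finally show "y (z T - koszul_d x n t T) \<in> U (j - p + e)" by (simp add: algebra_simps)
  qed
  then have "koszul_chain n U p j (\<lambda>T. z T - koszul_d x n t T)" by (simp add: koszul_chain_def)
  then show "\<exists>w. koszul_chain n M (p + 1) j w \<and> koszul_chain n U p j (\<lambda>T. z T - koszul_d x n w T)" using t by auto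
qed

end

section \<open>Polynomials: restriction to sets of monomials\<close>

text \<open>Unqualified names for the operations on both exponents and polynomials.\<close>

abbreviation mkeys :: "('a \<Rightarrow>\<^sub>0 'b::zero) \<Rightarrow> 'a set" where "mkeys \<equiv> Poly_Mapping.keys"
abbreviation lkp :: "('a \<Rightarrow>\<^sub>0 'b::zero) \<Rightarrow> 'a \<Rightarrow> 'b" where "lkp \<equiv> Poly_Mapping.lookup"
abbreviation sgl :: "'a \<Rightarrow> 'b \<Rightarrow> 'a \<Rightarrow>\<^sub>0 'b::zero" where "sgl \<equiv> Poly_Mapping.single"

text \<open>Homogeneous components and the substitution of zero for variables both arise from a
polynomial by restriction to a set of monomials, so that their properties are proved together.\<close>

definition restr :: "(('v \<Rightarrow>\<^sub>0 nat) \<Rightarrow> bool) \<Rightarrow> ('v, 'k::field) mpoly \<Rightarrow> ('v, 'k) mpoly" where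
  "restr P f = Poly_Mapping.mapp (\<lambda>m c. if P m then c else 0) f"

lemma lookup_restr: "lkp (restr P f) m = (if P m then lkp f m else 0)"
  by (auto simp: restr_def lookup_mapp in_keys_iff when_def)

lemma keys_restr: "mkeys (restr P f) = {m \<in> mkeys f. P m}"
  by (auto simp: in_keys_iff lookup_restr split: if_splits)

lemma restr_add: "restr P (f + g) = restr P f + restr P g"
  by (rule poly_mapping_eqI) (auto simp: lookup_restr lookup_add)

lemma restr_diff: "restr P (f - g) = restr P f - restr P g"
  by (rule poly_mapping_eqI) (auto simp: lookup_restr lookup_minus)

lemma restr_zero [simp]: "restr P 0 = 0"
  by (rule poly_mapping_eqI) (auto simp: lookup_restr)

lemma restr_sum: "restr P (sum f I) = (\<Sum>i\<in>I. restr P (f i))"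
  by (induction I rule: infinite_finite_induct) (auto simp: restr_add)

lemma restr_self: "(\<And>m. m \<in> mkeys f \<Longrightarrow> P m) \<Longrightarrow> restr P f = f"
  by (rule poly_mapping_eqI) (auto simp: lookup_restr in_keys_iff)

lemma restr_none: "(\<And>m. m \<in> mkeys f \<Longrightarrow> \<not> P m) \<Longrightarrow> restr P f = 0"
  by (rule poly_mapping_eqI) (auto simp: lookup_restr in_keys_iff)

lemma restr_split: "f = restr P f + restr (\<lambda>m. \<not> P m) f"
  by (rule poly_mapping_eqI) (auto simp: lookup_restr lookup_add)

text \<open>Split \<open>f\<close> into its restrictions to \<open>Q\<close> and to the complement: all monomials of the first
product satisfy \<open>P\<close>, and none of the second one does.\<close>

lemma restr_mult_right:
  assumes "\<And>m m'. m' \<in> mkeys g \<Longrightarrow> P (m + m') \<longleftrightarrow> Q m"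
  shows "restr P (f * g) = restr Q f * g"
proof -
  let ?a = "restr Q f" and ?b = "restr (\<lambda>m. \<not> Q m) f"
  have "restr P (?a * g) = ?a * g"
  proof (rule restr_self)
    fix m assume "m \<in> mkeys (?a * g)"
    then show "P m" using Poly_Mapping.keys_mult[of ?a g] assms by (auto simp: keys_restr)
  qed
  moreover have "restr P (?b * g) = 0"
  proof (rule restr_none)
    fix m assume "m \<in> mkeys (?b * g)"
    then show "\<not> P m" using Poly_Mapping.keys_mult[of ?b g] assms by (auto simp: keys_restr)
  qed
  moreover have "f * g = ?a * g + ?b * g"
    by (subst restr_split[of f Q]) (simp only: distrib_right)
  ultimately show ?thesis by (simp add: restr_add)
qed

lemma restr_mult_face:
  assumes "\<And>m m'. P (m + m') \<longleftrightarrow> P m \<and> P m'"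
  shows "restr P (f * g) = restr P f * restr P g"
proof -
  let ?a = "restr P g" and ?b = "restr (\<lambda>m. \<not> P m) g"
  have "restr P (f * ?a) = restr P f * ?a"
    by (rule restr_mult_right) (auto simp: assms keys_restr)
  moreover have "restr P (f * ?b) = restr (\<lambda>m. False) f * ?b"
    by (rule restr_mult_right) (auto simp: assms keys_restr)
  moreover have "restr (\<lambda>m. False) f = 0" by (rule restr_none) simp
  moreover have "f * g = f * ?a + f * ?b"
    by (subst restr_split[of g P]) (simp only: distrib_left)
  ultimately show ?thesis by (simp add: restr_add)
qed

lemma mpoly_induct [case_names zero add]:
  assumes "P 0" "\<And>f m c. P f \<Longrightarrow> P (f + sgl m c)"
  shows "P f"
proof (induction f rule: update_induct)
  case const
  then show ?case by (simp add: assms(1))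
next
  case (update f a b)
  have "Poly_Mapping.update a b f = f + sgl a b"
    using update(1) by (intro poly_mapping_eqI) (auto simp: lookup_update lookup_add lookup_single in_keys_iff)
  then show ?case using assms(2) update by simp
qed

lemma keys_plus_nat: "mkeys (m + m' :: 'v \<Rightarrow>\<^sub>0 nat) = mkeys m \<union> mkeys m'"
  by (auto simp: in_keys_iff lookup_add)

lemma face_zero_vars: "mkeys (m + m' :: 'v \<Rightarrow>\<^sub>0 nat) \<inter> W = {} \<longleftrightarrow> mkeys m \<inter> W = {} \<and> mkeys m' \<inter> W = {}"
  by (auto simp: keys_plus_nat)

subsection \<open>Homogeneous polynomials\<close>

definition mono_deg :: "('v \<Rightarrow>\<^sub>0 nat) \<Rightarrow> nat" where
  "mono_deg m = (\<Sum>v \<in> mkeys m. lkp m v)"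

lemma mono_deg_add: "mono_deg (m + m') = mono_deg m + mono_deg m'"
proof -
  have eq: "mono_deg a = (\<Sum>v \<in> mkeys m \<union> mkeys m'. lkp a v)" if "mkeys a \<subseteq> mkeys m \<union> mkeys m'" for a
    unfolding mono_deg_def using that by (intro sum.mono_neutral_left) (auto simp: in_keys_iff)
  show ?thesis
    by (subst (1 2 3) eq) (auto simp: keys_plus_nat lookup_add sum.distrib)
qed

lemma mono_deg_zero [simp]: "mono_deg 0 = 0" by (simp add: mono_deg_def)

lemma mono_deg_single [simp]: "mono_deg (sgl v n) = n" by (cases n) (auto simp: mono_deg_def)

lemma mono_deg_eq_0: "mono_deg m = 0 \<longleftrightarrow> m = 0"
proof
  assume "mono_deg m = 0"
  then have "\<forall>v \<in> mkeys m. lkp m v = 0" by (simp add: mono_deg_def)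
  then show "m = 0" by (intro poly_mapping_eqI) (auto simp: in_keys_iff)
qed simp

lemma homogeneous_mono_deg: "homogeneous d p \<longleftrightarrow> (\<forall>m \<in> mkeys p. int (mono_deg m) = d)"
  by (simp add: homogeneous_def mono_deg_def)

definition polys :: "'v set \<Rightarrow> ('v, 'k::field) mpoly set" where
  "polys A = {f. \<forall>m \<in> mkeys f. mkeys m \<subseteq> A}"

lemma carrier_poly_ring: "carrier (poly_ring A) = polys A"
  by (simp add: poly_ring_def polys_def)

definition forms :: "'v set \<Rightarrow> int \<Rightarrow> ('v, 'k::field) mpoly set" where
  "forms A j = {f. \<forall>m \<in> mkeys f. mkeys m \<subseteq> A \<and> int (mono_deg m) = j}"

definition form_part :: "'v set \<Rightarrow> int \<Rightarrow> ('v, 'k::field) mpoly \<Rightarrow> ('v, 'k) mpoly" where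
  "form_part A j f = restr (\<lambda>m. mkeys m \<subseteq> A \<and> int (mono_deg m) = j) f"

lemma forms_iff: "f \<in> forms A j \<longleftrightarrow> f \<in> polys A \<and> homogeneous j f"
  by (auto simp: forms_def polys_def homogeneous_mono_deg)

lemma forms_polys: "f \<in> forms A j \<Longrightarrow> f \<in> polys A"
  by (simp add: forms_iff)

lemma forms_zero [simp]: "0 \<in> forms A j" by (simp add: forms_def)

lemma forms_diff: "f \<in> forms A j \<Longrightarrow> g \<in> forms A j \<Longrightarrow> f - g \<in> forms A j"
  using Poly_Mapping.keys_diff[of f g] by (fastforce simp: forms_def)

lemma forms_add: "f \<in> forms A j \<Longrightarrow> g \<in> forms A j \<Longrightarrow> f + g \<in> forms A j"
  using Poly_Mapping.keys_add[of f g] by (fastforce simp: forms_def)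

lemma forms_uminus: "f \<in> forms A j \<Longrightarrow> - f \<in> forms A j"
  by (simp add: forms_def)

lemma forms_mult: "f \<in> forms A i \<Longrightarrow> g \<in> forms A j \<Longrightarrow> f * g \<in> forms A (i + j)"
  using Poly_Mapping.keys_mult[of f g] by (fastforce simp: forms_def keys_plus_nat mono_deg_add)

lemma forms_sum: "(\<And>i. i \<in> I \<Longrightarrow> f i \<in> forms A j) \<Longrightarrow> sum f I \<in> forms A j"
  by (induction I rule: infinite_finite_induct) (auto simp: forms_add)

lemma forms_neg: "j < 0 \<Longrightarrow> f \<in> forms A j \<Longrightarrow> f = 0"
proof -
  assume "j < 0" "f \<in> forms A j"
  then have "mkeys f = {}" by (auto simp: forms_def)
  then show "f = 0" by simp
qed

lemma forms_mono: "A \<subseteq> B \<Longrightarrow> forms A j \<subseteq> forms B j"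
  by (auto simp: forms_def)

lemma Var_forms: "v \<in> A \<Longrightarrow> (Var v :: ('v, 'k::field) mpoly) \<in> forms A 1"
  by (auto simp: forms_def Var_def)

lemma polys_zero [simp]: "0 \<in> polys A" by (simp add: polys_def)

lemma polys_one [simp]: "1 \<in> polys A" by (simp add: polys_def)

lemma polys_add: "f \<in> polys A \<Longrightarrow> g \<in> polys A \<Longrightarrow> f + g \<in> polys A"
  using Poly_Mapping.keys_add[of f g] by (fastforce simp: polys_def)

lemma polys_diff: "f \<in> polys A \<Longrightarrow> g \<in> polys A \<Longrightarrow> f - g \<in> polys A"
  using Poly_Mapping.keys_diff[of f g] by (fastforce simp: polys_def)

lemma polys_mult: "f \<in> polys A \<Longrightarrow> g \<in> polys A \<Longrightarrow> f * g \<in> polys A"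
  using Poly_Mapping.keys_mult[of f g] by (fastforce simp: polys_def keys_plus_nat)

lemma polys_sum: "(\<And>i. i \<in> I \<Longrightarrow> f i \<in> polys A) \<Longrightarrow> sum f I \<in> polys A"
  by (induction I rule: infinite_finite_induct) (auto simp: polys_add)

lemma polys_const [simp]: "sgl 0 c \<in> polys A" by (auto simp: polys_def)

lemma form_part_forms [simp]: "form_part A j f \<in> forms A j"
  by (auto simp: form_part_def forms_def keys_restr)

lemma form_part_add: "form_part A j (f + g) = form_part A j f + form_part A j g"
  by (simp add: form_part_def restr_add)

lemma form_part_diff: "form_part A j (f - g) = form_part A j f - form_part A j g"
  by (simp add: form_part_def restr_diff)

lemma form_part_sum: "form_part A j (sum f I) = (\<Sum>i\<in>I. form_part A j (f i))"
  by (simp add: form_part_def restr_sum)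

lemma form_part_zero [simp]: "form_part A j 0 = 0"
  by (simp add: form_part_def)

lemma form_part_self: "f \<in> forms A j \<Longrightarrow> form_part A j f = f"
  unfolding form_part_def by (rule restr_self) (auto simp: forms_def)

lemma form_part_mult: "g \<in> forms A e \<Longrightarrow> form_part A j (f * g) = form_part A (j - e) f * g"
  unfolding form_part_def by (rule restr_mult_right) (auto simp: forms_def keys_plus_nat mono_deg_add)

subsection \<open>Divisibility by a variable\<close>

lemma inj_add_single: "inj (\<lambda>m. m + sgl v (1::nat))"
  by (auto simp: inj_def)

text \<open>The quotient by the variable \<open>v\<close> of the part of \<open>f\<close> that it divides.\<close>

definition div_var :: "'v \<Rightarrow> ('v, 'k::field) mpoly \<Rightarrow> ('v, 'k) mpoly" where
  "div_var v f = Poly_Mapping.map_key (\<lambda>m. m + sgl v 1) f"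

lemma lookup_div_var: "lkp (div_var v f) m = lkp f (m + sgl v 1)"
  unfolding div_var_def map_key.rep_eq[OF inj_add_single] by simp

lemma div_var_add: "div_var v (f + g) = div_var v f + div_var v g"
  by (rule poly_mapping_eqI) (simp add: lookup_div_var lookup_add)

lemma div_var_zero [simp]: "div_var v 0 = 0"
  by (rule poly_mapping_eqI) (simp add: lookup_div_var)

lemma div_var_Var_mult: "div_var v (Var v * f) = f"
proof (induction f rule: mpoly_induct)
  case zero
  then show ?case by simp
next
  case (add f m c)
  have "div_var v (Var v * sgl m c) = sgl m c"
    by (rule poly_mapping_eqI)
       (auto simp: Var_def mult_single lookup_div_var lookup_single add.commute when_def)
  then show ?case by (simp add: distrib_left div_var_add add)
qed

lemma Var_mult_cancel: "Var v * f = Var v * g \<Longrightarrow> f = g"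
  by (metis div_var_Var_mult)

lemma div_var_decompose: "f = Var v * div_var v f + restr (\<lambda>m. v \<notin> mkeys m) f"
proof (induction f rule: mpoly_induct)
  case zero
  then show ?case by simp
next
  case (add f m c)
  have "sgl m c = Var v * div_var v (sgl m c) + restr (\<lambda>m. v \<notin> mkeys m) (sgl m c)"
  proof (cases "v \<in> mkeys m")
    case True
    have m: "m = sgl v 1 + (m - sgl v 1)"
      using True by (intro poly_mapping_eqI) (auto simp: lookup_add lookup_minus lookup_single in_keys_iff when_def)
    have 1: "sgl m c = Var v * sgl (m - sgl v 1) c"
      by (subst m) (simp only: Var_def mult_single mult_1)
    have "div_var v (sgl m c) = sgl (m - sgl v 1) c" by (subst 1) (rule div_var_Var_mult)
    moreover have "restr (\<lambda>m. v \<notin> mkeys m) (sgl m c) = 0"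
      by (rule restr_none) (use True in \<open>auto split: if_splits\<close>)
    ultimately show ?thesis using 1 by simp
  next
    case False
    have "m \<noteq> m' + sgl v 1" for m' using False by (auto simp: keys_plus_nat)
    then have "div_var v (sgl m c) = 0"
      by (intro poly_mapping_eqI) (auto simp: lookup_div_var lookup_single when_def)
    moreover have "restr (\<lambda>m. v \<notin> mkeys m) (sgl m c) = sgl m c"
      by (rule restr_self) (use False in \<open>auto split: if_splits\<close>)
    ultimately show ?thesis by simp
  qed
  then show ?case using add by (simp add: distrib_left div_var_add restr_add algebra_simps)
qed

lemma div_var_forms: "f \<in> forms A j \<Longrightarrow> div_var v f \<in> forms A (j - 1)"
  unfolding forms_def
proof safe
  fix m w assume *: "\<forall>m\<in>mkeys f. mkeys m \<subseteq> A \<and> int (mono_deg m) = j" and "m \<in> mkeys (div_var v f)"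
  then have "m + sgl v 1 \<in> mkeys f" by (simp add: in_keys_iff lookup_div_var)
  with * have "mkeys (m + sgl v 1) \<subseteq> A \<and> int (mono_deg (m + sgl v 1)) = j" by blast
  then show "int (mono_deg m) = j - 1" "w \<in> mkeys m \<Longrightarrow> w \<in> A" by (auto simp: keys_plus_nat mono_deg_add)
qed

lemma keys_Var_mult: "mkeys (Var v * f) = (\<lambda>m. sgl v 1 + m) ` mkeys f"
proof
  show "mkeys (Var v * f) \<subseteq> (\<lambda>m. sgl v 1 + m) ` mkeys f"
    using Poly_Mapping.keys_mult[of "Var v" f] by (auto simp: Var_def split: if_splits)
  show "(\<lambda>m. sgl v 1 + m) ` mkeys f \<subseteq> mkeys (Var v * f)"
  proof safe
    fix m assume "m \<in> mkeys f"
    then show "sgl v 1 + m \<in> mkeys (Var v * f)"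
      by (metis add.commute div_var_Var_mult in_keys_iff lookup_div_var)
  qed
qed

lemma div_var_mult:
  assumes "\<And>m. m \<in> mkeys g \<Longrightarrow> v \<notin> mkeys m"
  shows "div_var v (f * g) = div_var v f * g"
proof -
  have "restr (\<lambda>m. v \<notin> mkeys m) (f * g) = restr (\<lambda>m. v \<notin> mkeys m) f * g"
    by (rule restr_mult_right) (use assms in \<open>auto simp: keys_plus_nat\<close>)
  moreover have "f * g = Var v * div_var v (f * g) + restr (\<lambda>m. v \<notin> mkeys m) (f * g)"
    by (rule div_var_decompose)
  moreover have "f * g = Var v * div_var v f * g + restr (\<lambda>m. v \<notin> mkeys m) f * g"
    by (subst div_var_decompose[of f v]) (simp only: distrib_right)
  ultimately have "Var v * div_var v (f * g) = Var v * (div_var v f * g)" by (simp add: mult.assoc)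
  then show ?thesis by (rule Var_mult_cancel)
qed

lemma lookup_mult_zero: "lkp (f * g :: ('v, 'k::field) mpoly) 0 = lkp f 0 * lkp g 0"
proof -
  have c: "restr (\<lambda>m. m = 0) f = sgl 0 (lkp f 0)" for f :: "('v, 'k) mpoly"
    by (rule poly_mapping_eqI) (auto simp: lookup_restr lookup_single when_def)
  have z: "m + m' = 0 \<longleftrightarrow> m = 0 \<and> m' = 0" for m m' :: "'v \<Rightarrow>\<^sub>0 nat"
    using mono_deg_eq_0[of "m + m'"] by (auto simp: mono_deg_add mono_deg_eq_0)
  have "restr (\<lambda>m. m = 0) (f * g) = restr (\<lambda>m. m = 0) f * restr (\<lambda>m. m = 0) g"
    by (rule restr_mult_face) (rule z)
  then have "sgl (0 :: 'v \<Rightarrow>\<^sub>0 nat) (lkp (f * g) 0) = sgl 0 (lkp f 0 * lkp g 0)"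
    by (simp add: c mult_single)
  then show ?thesis by (metis lookup_single_eq)
qed

section \<open>Ideals of the full polynomial ring\<close>

definition is_ideal :: "'a::comm_ring_1 set \<Rightarrow> bool" where
  "is_ideal I \<longleftrightarrow> 0 \<in> I \<and> (\<forall>a\<in>I. \<forall>b\<in>I. a + b \<in> I) \<and> (\<forall>c. \<forall>a\<in>I. c * a \<in> I)"

lemma is_idealD:
  assumes "is_ideal I"
  shows "0 \<in> I" "a \<in> I \<Longrightarrow> b \<in> I \<Longrightarrow> a + b \<in> I" "a \<in> I \<Longrightarrow> c * a \<in> I" "a \<in> I \<Longrightarrow> a * c \<in> I"
    "a \<in> I \<Longrightarrow> - a \<in> I" "a \<in> I \<Longrightarrow> b \<in> I \<Longrightarrow> a - b \<in> I"
proof -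
  show 1: "0 \<in> I" "\<And>a b. a \<in> I \<Longrightarrow> b \<in> I \<Longrightarrow> a + b \<in> I" and 2: "\<And>a c. a \<in> I \<Longrightarrow> c * a \<in> I"
    using assms by (auto simp: is_ideal_def)
  show "a \<in> I \<Longrightarrow> a * c \<in> I" using 2[of a c] by (simp add: mult.commute)
  show 3: "a \<in> I \<Longrightarrow> - a \<in> I" for a using 2[of a "-1"] by simp
  show "a \<in> I \<Longrightarrow> b \<in> I \<Longrightarrow> a - b \<in> I" using 1(2)[of a "- b"] 3 by simp
qed

lemma is_ideal_sum: "is_ideal I \<Longrightarrow> (\<And>i. i \<in> S \<Longrightarrow> f i \<in> I) \<Longrightarrow> sum f S \<in> I"
  by (induction S rule: infinite_finite_induct) (auto simp: is_idealD)

text \<open>Ideals are taken in the ring of polynomials in all variables of the type, where no carrier has to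
be mentioned. The ideals of $K[A]$ are recovered as intersections in \<open>poly_ring_genideal\<close>.\<close>

inductive_set idl :: "'a::comm_ring_1 set \<Rightarrow> 'a set" for G where
  zero: "0 \<in> idl G"
| step: "g \<in> G \<Longrightarrow> f \<in> idl G \<Longrightarrow> c * g + f \<in> idl G"

lemma is_ideal_idl: "is_ideal (idl G)"
  unfolding is_ideal_def
proof (intro conjI ballI allI)
  show "0 \<in> idl G" by (rule idl.zero)
  fix a assume a: "a \<in> idl G"
  show "a + b \<in> idl G" if "b \<in> idl G" for b
    using a by induction (auto simp: that add.assoc intro: idl.step)
  show "c * a \<in> idl G" for c
    using a by induction (auto simp: distrib_left idl.zero simp flip: mult.assoc intro: idl.step)
qed

lemma idl_incl: "g \<in> G \<Longrightarrow> g \<in> idl G"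
  using idl.step[of g G 0 1] idl.zero[of G] by simp

lemma idl_least: "is_ideal I \<Longrightarrow> G \<subseteq> I \<Longrightarrow> idl G \<subseteq> I"
proof
  fix f assume "is_ideal I" "G \<subseteq> I" and f: "f \<in> idl G"
  then show "f \<in> I" by (induction rule: idl.induct[OF f]) (auto intro!: is_idealD(1-3))
qed

lemma idl_mono: "G \<subseteq> H \<Longrightarrow> idl G \<subseteq> idl H"
  by (rule idl_least[OF is_ideal_idl]) (auto intro: idl_incl)

lemma idl_subset_idl: "(\<And>g. g \<in> G \<Longrightarrow> g \<in> idl H) \<Longrightarrow> idl G \<subseteq> idl H"
  by (rule idl_least[OF is_ideal_idl]) auto

lemma idl_Un:
  assumes "f \<in> idl (G \<union> H)"
  obtains a b where "a \<in> idl G" "b \<in> idl H" "f = a + b"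
proof -
  have "\<exists>a b. a \<in> idl G \<and> b \<in> idl H \<and> f = a + b"
    using assms
  proof induction
    case zero
    then show ?case using idl.zero by force
  next
    case (step g f c)
    then obtain a b where ab: "a \<in> idl G" "b \<in> idl H" "f = a + b" by blast
    show ?case
    proof (cases "g \<in> G")
      case True
      then show ?thesis using ab idl.step[of g G a c] by (metis add.assoc)
    next
      case False
      then have "g \<in> H" using step by blast
      then show ?thesis using ab idl.step[of g H b c] by (metis add.left_commute)
    qed
  qed
  then show ?thesis using that by blast
qed

lemma idl_insert:
  assumes "f \<in> idl (insert g G)"
  obtains c b where "b \<in> idl G" "f = c * g + b"
proof -
  have "f \<in> idl ({g} \<union> G)" using assms by simp
  then obtain a b where ab: "a \<in> idl {g}" "b \<in> idl G" "f = a + b" by (rule idl_Un)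
  have "\<exists>c. a = c * g" using ab(1)
  proof induction
    case zero
    then show ?case by (intro exI[of _ 0]) simp
  next
    case (step h f c)
    then show ?case by (metis distrib_right singletonD)
  qed
  then show ?thesis using that ab by blast
qed

text \<open>Closedness under the components of $K[A]$ makes the graded pieces \<open>I \<inter> forms A j\<close> determine $I \cap K[A]$.\<close>

definition graded_ideal :: "'v set \<Rightarrow> ('v, 'k::field) mpoly set \<Rightarrow> bool" where
  "graded_ideal A I \<longleftrightarrow> is_ideal I \<and> (\<forall>f\<in>I. \<forall>j. form_part A j f \<in> I)"

lemma graded_ideal_idl:
  assumes "\<And>g. g \<in> G \<Longrightarrow> \<exists>e. g \<in> forms A e"
  shows "graded_ideal A (idl G)"
  unfolding graded_ideal_def
proof (intro conjI ballI allI)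
  show "is_ideal (idl G)" by (rule is_ideal_idl)
  fix f j assume "f \<in> idl G"
  then show "form_part A j f \<in> idl G"
  proof induction
    case zero
    then show ?case by (simp add: idl.zero)
  next
    case (step g f c)
    obtain e where "g \<in> forms A e" using assms step by blast
    then show ?case using step by (auto simp: form_part_add form_part_mult intro: idl.step)
  qed
qed

text \<open>Division by \<open>v\<close> is linear over the polynomials in which \<open>v\<close> does not occur, so it maps the ideal to itself.\<close>

lemma idl_new_variable:
  assumes "\<And>g m. g \<in> G \<Longrightarrow> m \<in> mkeys g \<Longrightarrow> v \<notin> mkeys m" and "Var v * f \<in> idl G"
  shows "f \<in> idl G"
proof -
  have "div_var v h \<in> idl G" if "h \<in> idl G" for h
    using that
  proof induction
    case zero
    then show ?case by (simp add: idl.zero)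
  next
    case (step g f c)
    then show ?case using assms(1) by (auto simp: div_var_add div_var_mult intro: idl.step)
  qed
  from this[OF assms(2)] show ?thesis by (simp add: div_var_Var_mult)
qed

definition zero_vars :: "'v set \<Rightarrow> ('v, 'k::field) mpoly \<Rightarrow> ('v, 'k) mpoly" where
  "zero_vars W f = restr (\<lambda>m. mkeys m \<inter> W = {}) f"

lemma zero_vars_add: "zero_vars W (f + g) = zero_vars W f + zero_vars W g" by (simp add: zero_vars_def restr_add)
lemma zero_vars_diff: "zero_vars W (f - g) = zero_vars W f - zero_vars W g" by (simp add: zero_vars_def restr_diff)
lemma zero_vars_zero [simp]: "zero_vars W 0 = 0" by (simp add: zero_vars_def)
lemma zero_vars_mult: "zero_vars W (f * g) = zero_vars W f * zero_vars W g"
  unfolding zero_vars_def by (rule restr_mult_face) (rule face_zero_vars)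
lemma zero_vars_Var: "zero_vars W (Var v :: ('v, 'k::field) mpoly) = (if v \<in> W then 0 else Var v)"
  by (auto simp: zero_vars_def Var_def intro!: restr_self restr_none)

lemma zero_vars_idl:
  assumes "\<And>g. g \<in> G \<Longrightarrow> zero_vars W g \<in> idl H" and "f \<in> idl G"
  shows "zero_vars W f \<in> idl H"
  using assms(2)
proof induction
  case zero
  then show ?case by (simp add: idl.zero)
next
  case (step g f c)
  then show ?case using assms(1) is_ideal_idl[of H] by (simp add: zero_vars_add zero_vars_mult is_idealD)
qed

lemma monomials_idl:
  assumes "\<And>m. m \<in> mkeys f \<Longrightarrow> mkeys m \<inter> W \<noteq> {}"
  shows "(f :: ('v, 'k::field) mpoly) \<in> idl (Var ` W)"
proof -
  have s: "sgl m c \<in> idl (Var ` W)" if m: "m \<in> mkeys f" for m and c :: 'k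
  proof -
    obtain v where v: "v \<in> mkeys m" "v \<in> W" using assms[OF m] by blast
    have "sgl m c = Var v * div_var v (sgl m c) + restr (\<lambda>m. v \<notin> mkeys m) (sgl m c)" by (rule div_var_decompose)
    also have "restr (\<lambda>m. v \<notin> mkeys m) (sgl m c) = 0"
      by (rule restr_none) (use v in \<open>auto split: if_splits\<close>)
    finally show ?thesis using v by (metis add_0_right idl_incl imageI is_idealD(4) is_ideal_idl)
  qed
  have "f = (\<Sum>m\<in>mkeys f. sgl m (lkp f m))"
    by (rule poly_mapping_eqI) (auto simp: lookup_sum lookup_single when_def in_keys_iff)
  also have "\<dots> \<in> idl (Var ` W)" by (rule is_ideal_sum[OF is_ideal_idl]) (rule s)
  finally show ?thesis .
qed

lemma diff_zero_vars_idl: "f - zero_vars W f \<in> idl (Var ` W)"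
proof -
  have "f - zero_vars W f = restr (\<lambda>m. \<not> (mkeys m \<inter> W = {})) f"
    using restr_split[of f "\<lambda>m. mkeys m \<inter> W = {}"] by (metis add_diff_cancel_left' zero_vars_def)
  then show ?thesis by (auto intro!: monomials_idl simp: keys_restr)
qed

section \<open>Koszul homology of quotients of a polynomial ring\<close>

definition mult_var :: "(nat \<Rightarrow> 'v) \<Rightarrow> nat \<Rightarrow> ('v, 'k::field) mpoly \<Rightarrow> ('v, 'k) mpoly" where
  "mult_var e v f = Var (e v) * f"

lemma commuting_mult_var: "commuting_operators (mult_var e)"
  by unfold_locales (auto simp: mult_var_def algebra_simps)

text \<open>A numbering \<open>e\<close> of the finite variable set turns the variables into a sequence of
operators; \<open>ty\<close> only fixes the field.\<close>

locale poly_koszul =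
  fixes A :: "'v set" and e :: "nat \<Rightarrow> 'v" and N :: nat and ty :: "'k::field itself"
  assumes bij: "bij_betw e {..<N} A"
begin

sublocale K: commuting_operators "mult_var e :: nat \<Rightarrow> ('v, 'k) mpoly \<Rightarrow> _" N
  by (rule commuting_mult_var)

lemma e_A: "v < N \<Longrightarrow> e v \<in> A"
  using bij by (auto simp: bij_betw_def)

lemma e_eq: "v < N \<Longrightarrow> w < N \<Longrightarrow> e v = e w \<longleftrightarrow> v = w"
  using bij by (auto simp: bij_betw_def inj_on_def)

lemma finite_A: "finite A"
  using bij bij_betw_finite by blast

lemma graded_forms: "n \<le> N \<Longrightarrow> graded_sub (mult_var e) n (forms A :: int \<Rightarrow> ('v, 'k) mpoly set)"
  unfolding graded_sub_def mult_var_def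
proof (intro allI conjI ballI impI)
  fix j v and a :: "('v, 'k) mpoly" assume "n \<le> N" "v < n" "a \<in> forms A j"
  then show "Var (e v) * a \<in> forms A (j + 1)" using forms_mult[OF Var_forms[OF e_A]] by (metis add.commute less_le_trans)
qed (auto simp: forms_diff)

lemma graded_ideal_sub:
  assumes "is_ideal I" shows "graded_sub (mult_var e) N (\<lambda>j. I \<inter> forms A j :: ('v, 'k) mpoly set)"
  using graded_forms[of N] is_idealD[OF assms] unfolding graded_sub_def mult_var_def by auto

lemma in_variables:
  assumes "f \<in> forms A j" "\<And>m. m \<in> mkeys f \<Longrightarrow> \<exists>v<n. e v \<in> mkeys m"
  shows "\<exists>w. (\<forall>v<n. w v \<in> forms A (j - 1)) \<and> (f :: ('v, 'k) mpoly) = (\<Sum>v<n. Var (e v) * w v)"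
  using assms
proof (induction n arbitrary: f)
  case 0
  then have "mkeys f = {}" by (auto simp del: keys_eq_empty)
  then show ?case by simp
next
  case (Suc n)
  let ?g = "restr (\<lambda>m. e n \<notin> mkeys m) f"
  have "?g \<in> forms A j" using Suc.prems(1) by (auto simp: forms_def keys_restr)
  moreover have "\<exists>v<n. e v \<in> mkeys m" if "m \<in> mkeys ?g" for m
    using that Suc.prems(2)[of m] by (auto simp: keys_restr less_Suc_eq)
  ultimately obtain w where w: "\<forall>v<n. w v \<in> forms A (j - 1)" "?g = (\<Sum>v<n. Var (e v) * w v)"
    using Suc.IH by blast
  show ?case
  proof (intro exI[of _ "w(n := div_var (e n) f)"] conjI allI impI)
    show "f = (\<Sum>v<Suc n. Var (e v) * (w(n := div_var (e n) f)) v)"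
      using div_var_decompose[of f "e n"] w(2) by (simp add: add.commute)
  qed (use w(1) div_var_forms[OF Suc.prems(1)] in \<open>auto simp: less_Suc_eq\<close>)
qed

text \<open>The variables form a regular sequence. In the induction step on \<open>n\<close> the coefficient part \<open>z1\<close> of $e_n$ is a cycle
and hence a boundary; in the lowest case $p = 1$ this uses that $x_n$ is a nonzerodivisor modulo
$(x_0, \dots, x_{n-1})$, a statement about monomials. Subtracting this boundary leaves a cycle that
does not involve $e_n$.\<close>

lemma koszul_acyclic:
  assumes "n \<le> N" "1 \<le> p"
  shows "koszul_vanish (mult_var e) n (forms A) (\<lambda>_. {0 :: ('v, 'k) mpoly}) p j"
  using assms
proof (induction n arbitrary: p j)
  case (0 p j)
  show ?case
  proof (rule K.koszul_vanishI)
    fix z :: "nat set \<Rightarrow> ('v, 'k) mpoly"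
    show "\<exists>w. koszul_chain 0 (forms A) (p + 1) j w \<and> koszul_chain 0 (\<lambda>_. {0}) p j (\<lambda>T. z T - koszul_d (mult_var e) 0 w T)"
      using 0 by (intro exI[of _ "\<lambda>_. 0"]) (auto simp: koszul_chain_def)
  qed
next
  case (Suc n p j)
  let ?x = "mult_var e :: nat \<Rightarrow> ('v, 'k) mpoly \<Rightarrow> _"
  have nN: "n \<le> N" using Suc.prems by simp
  note gn = graded_forms[OF nN]
  show ?case
  proof (rule K.koszul_vanishI)
    fix z :: "nat set \<Rightarrow> ('v, 'k) mpoly"
    assume z: "koszul_chain (Suc n) (forms A) p j z" and dz: "koszul_chain (Suc n) (\<lambda>_. {0}) (p - 1) j (koszul_d ?x (Suc n) z)"
    define z1 where "z1 = (\<lambda>T. z (insert n T))"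
    have cins: "int (card (insert n T)) = int (card T) + 1" "insert n T \<subseteq> {..<Suc n}" "insert n T - {n} = T"
      "n \<notin> T" "T \<subseteq> {..<Suc n}" if "T \<subseteq> {..<n}" for T
    proof -
      show "n \<notin> T" "T \<subseteq> {..<Suc n}" "insert n T \<subseteq> {..<Suc n}" "insert n T - {n} = T"
        using that by auto
      then show "int (card (insert n T)) = int (card T) + 1"
        using finite_subset_lessThan[OF that] by simp
    qed
    have z0: "koszul_chain n (forms A) p j z"
      using kcD[OF z] cins unfolding koszul_chain_def by blast
    have z1: "koszul_chain n (forms A) (p - 1) (j - 1) z1"
      unfolding koszul_chain_def z1_def
    proof (intro allI impI)
      fix T assume T: "T \<subseteq> {..<n}" "int (card T) = p - 1"
      have "z (insert n T) \<in> forms A (j - p)"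
        using T cins[OF T(1)] by (intro kcD[OF z]) auto
      then show "z (insert n T) \<in> forms A (j - 1 - (p - 1))" by (simp add: algebra_simps)
    qed
    have dz1: "koszul_chain n (\<lambda>_. {0}) (p - 1 - 1) (j - 1) (koszul_d ?x n z1)"
      unfolding koszul_chain_def
    proof (intro allI impI)
      fix T assume T: "T \<subseteq> {..<n}" "int (card T) = p - 1 - 1"
      have "koszul_d ?x (Suc n) z (insert n T) \<in> {0}"
        using T cins[OF T(1)] by (intro kcD[OF dz]) auto
      then show "koszul_d ?x n z1 T \<in> {0}" using cins[OF T(1)] by (simp add: z1_def)
    qed
    have dz0: "koszul_d ?x n z T + mult_var e n (z1 T) = 0" if T: "T \<subseteq> {..<n}" "int (card T) = p - 1" for T
      using kcD[OF dz, of T] T cins[OF T(1)] by (simp add: z1_def)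
    have "\<exists>w1. koszul_chain n (forms A) p (j - 1) w1 \<and> (\<forall>T\<subseteq>{..<n}. int (card T) = p - 1 \<longrightarrow> z1 T = koszul_d ?x n w1 T)"
    proof (cases "p = 1")
      case False
      then have p1: "1 \<le> p - 1" using Suc.prems by simp
      obtain w where "koszul_chain n (forms A) (p - 1 + 1) (j - 1) w" "koszul_chain n (\<lambda>_. {0}) (p - 1) (j - 1) (\<lambda>T. z1 T - koszul_d ?x n w T)"
        using K.koszul_vanishD[OF Suc.IH[OF nN p1] z1 dz1] .
      then show ?thesis by (intro exI[of _ w]) (auto simp: koszul_chain_def)
    next
      case True
      have z1H: "z1 {} \<in> forms A (j - 1)" using kcD[OF z1, of "{}"] True by simp
      have eq: "Var (e n) * z1 {} = - (\<Sum>v<n. Var (e v) * z {v})"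
        using dz0[of "{}"] True by (simp add: koszul_d_empty mult_var_def eq_neg_iff_add_eq_0 add.commute)
      have "\<exists>v<n. e v \<in> mkeys m" if "m \<in> mkeys (z1 {})" for m
      proof -
        have "sgl (e n) 1 + m \<in> mkeys (Var (e n) * z1 {})" using that by (simp add: keys_Var_mult)
        then have "sgl (e n) 1 + m \<in> mkeys (\<Sum>v<n. Var (e v) * z {v})" by (simp add: eq)
        then obtain v where v: "v < n" "sgl (e n) 1 + m \<in> mkeys (Var (e v) * z {v})"
          using Poly_Mapping.keys_sum[of "\<lambda>v. Var (e v) * z {v}" "{..<n}"] by auto
        then obtain m' where "sgl (e n) 1 + m = sgl (e v) 1 + m'" by (auto simp: keys_Var_mult)
        moreover have "e v \<in> mkeys (sgl (e v) 1 + m')" by (simp add: keys_plus_nat)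
        ultimately have "e v \<in> mkeys (sgl (e n) 1 + m)" by simp
        moreover have "e v \<noteq> e n" using e_eq[of v n] v Suc.prems by simp
        ultimately show ?thesis using v by (auto simp: keys_plus_nat)
      qed
      from in_variables[OF z1H this] obtain w where
        w: "\<forall>v<n. w v \<in> forms A (j - 1 - 1)" "z1 {} = (\<Sum>v<n. Var (e v) * w v)" by blast
      define w1 where "w1 = (\<lambda>T. w (the_elem T))"
      have "koszul_chain n (forms A) p (j - 1) w1"
        unfolding koszul_chain_def
      proof (intro allI impI)
        fix T assume T: "T \<subseteq> {..<n}" "int (card T) = p"
        then obtain v where "T = {v}" using True by (metis card_1_singletonE of_nat_eq_1_iff)
        then show "w1 T \<in> forms A (j - 1 - p)" using w T True by (simp add: w1_def)
      qed
      moreover have "z1 T = koszul_d ?x n w1 T" if "T \<subseteq> {..<n}" "int (card T) = p - 1" for T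
        using that True w(2) finite_subset_lessThan[OF that(1)] by (simp add: koszul_d_empty w1_def mult_var_def)
      ultimately show ?thesis by blast
    qed
    then obtain w1 where w1: "koszul_chain n (forms A) p (j - 1) w1"
      and w1z: "\<And>T. T \<subseteq> {..<n} \<Longrightarrow> int (card T) = p - 1 \<Longrightarrow> z1 T = koszul_d ?x n w1 T" by blast
    define y where "y = (\<lambda>T. z T + mult_var e n (w1 T))"
    have "koszul_chain n (forms A) p j (\<lambda>T. mult_var e n (w1 T))"
      unfolding koszul_chain_def
    proof (intro allI impI)
      fix T assume T: "T \<subseteq> {..<n}" "int (card T) = p"
      have "w1 T \<in> forms A (j - 1 - p)" using kcD[OF w1 T] .
      then have "mult_var e n (w1 T) \<in> forms A (j - 1 - p + 1)"
        using Suc.prems by (intro graded_subD(5)[OF graded_forms[of "Suc n"]]) auto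
      then show "mult_var e n (w1 T) \<in> forms A (j - p)" by (simp add: algebra_simps)
    qed
    then have y: "koszul_chain n (forms A) p j y"
      unfolding y_def by (rule koszul_chain_add[OF gn z0])
    have dy: "koszul_chain n (\<lambda>_. {0}) (p - 1) j (koszul_d ?x n y)"
      unfolding koszul_chain_def y_def using dz0 w1z by (auto simp: K.koszul_d_add K.koszul_d_x)
    obtain w0 where w0: "koszul_chain n (forms A) (p + 1) j w0" and yw: "koszul_chain n (\<lambda>_. {0}) p j (\<lambda>T. y T - koszul_d ?x n w0 T)"
      using K.koszul_vanishD[OF Suc.IH[OF nN Suc.prems(2)] y dy] .
    define w where "w = (\<lambda>T. if n \<in> T then - w1 (T - {n}) else w0 T)"
    have "koszul_chain (Suc n) (forms A) (p + 1) j w"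
      unfolding koszul_chain_def
    proof (intro allI impI)
      fix T assume T: "T \<subseteq> {..<Suc n}" "int (card T) = p + 1"
      show "w T \<in> forms A (j - (p + 1))"
      proof (cases "n \<in> T")
        case True
        have "w1 (T - {n}) \<in> forms A (j - 1 - p)"
        proof (rule kcD[OF w1])
          show "T - {n} \<subseteq> {..<n}" using T by (auto simp: less_Suc_eq)
          show "int (card (T - {n})) = p"
            using card_remove[OF True finite_subset_lessThan[OF T(1)]] T(2) by simp
        qed
        then show ?thesis using True forms_uminus by (simp add: w_def algebra_simps)
      next
        case False
        then have "T \<subseteq> {..<n}" using T by (auto simp: less_Suc_eq)
        then show ?thesis using kcD[OF w0 _ T(2)] False by (simp add: w_def)
      qed
    qed
    moreover have "z T = koszul_d ?x (Suc n) w T" if T: "T \<subseteq> {..<Suc n}" "int (card T) = p" for T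
    proof (cases "n \<in> T")
      case True
      have Tn: "T - {n} \<subseteq> {..<n}" using T by (auto simp: less_Suc_eq)
      have c: "int (card (T - {n})) = p - 1"
        using card_remove[OF True finite_subset_lessThan[OF T(1)]] T(2) by simp
      have "koszul_d ?x n (\<lambda>T'. w (insert n T')) (T - {n}) = koszul_d ?x n (\<lambda>T'. - w1 T') (T - {n})"
      proof (rule koszul_d_cong[OF Tn])
        fix T' assume "T' \<subseteq> {..<n}"
        from cins(3)[OF this] show "w (insert n T') = - w1 T'" by (simp add: w_def)
      qed
      also have "\<dots> = - z T" using w1z[OF Tn c] True by (simp add: K.koszul_d_minus z1_def insert_absorb)
      finally show ?thesis using True by simp
    next
      case False
      then have Tn: "T \<subseteq> {..<n}" using T by (auto simp: less_Suc_eq)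
      have "koszul_d ?x n w T = koszul_d ?x n w0 T"
        by (rule koszul_d_cong[OF Tn]) (use cins in \<open>auto simp: w_def\<close>)
      moreover have "w (insert n T) = - w1 T" using cins[OF Tn] by (simp add: w_def)
      moreover have "y T = koszul_d ?x n w0 T" using kcD[OF yw Tn T(2)] by simp
      ultimately show ?thesis using False by (simp add: y_def K.x_minus algebra_simps)
    qed
    ultimately show "\<exists>w. koszul_chain (Suc n) (forms A) (p + 1) j w \<and>
        koszul_chain (Suc n) (\<lambda>_. {0}) p j (\<lambda>T. z T - koszul_d ?x (Suc n) w T)"
      by (intro exI[of _ w]) (auto simp: koszul_chain_def)
  qed
qed

text \<open>$\mathrm{Tor}_p^{K[A]}(K[A]/I, K)_j = 0$.\<close>

abbreviation tor_vanish :: "('v, 'k) mpoly set \<Rightarrow> int \<Rightarrow> int \<Rightarrow> bool" where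
  "tor_vanish I p j \<equiv> koszul_vanish (mult_var e) N (forms A) (\<lambda>i. I \<inter> forms A i) p j"

text \<open>The regularity of $K[A]/I$ is at most \<open>r\<close>, with $\mathrm{Tor}$ computed as Koszul homology.\<close>

definition reg_le :: "('v, 'k) mpoly set \<Rightarrow> int \<Rightarrow> bool" where
  "reg_le I r \<longleftrightarrow> (\<forall>p j. r < j - p \<longrightarrow> tor_vanish I p j)"

lemma reg_le_mono: "reg_le I r \<Longrightarrow> r \<le> s \<Longrightarrow> reg_le I s"
  by (simp add: reg_le_def)

lemma idl_empty: "idl {} = {0}"
  by (auto intro: idl.zero elim: idl.cases)

lemma no_constant_term:
  assumes "f \<in> forms A j" "lkp f 0 = 0"
  shows "\<exists>w. (\<forall>v<N. w v \<in> forms A (j - 1)) \<and> (f :: ('v, 'k) mpoly) = (\<Sum>v<N. Var (e v) * w v)"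
proof (rule in_variables[OF assms(1)])
  fix m assume m: "m \<in> mkeys f"
  then have "m \<noteq> 0" "mkeys m \<subseteq> A" using assms by (auto simp: forms_def in_keys_iff)
  then have "mkeys m \<noteq> {}" using mono_deg_eq_0[of m] by (auto simp: mono_deg_def)
  then obtain v where "v \<in> mkeys m" by blast
  then show "\<exists>v<N. e v \<in> mkeys m" using \<open>mkeys m \<subseteq> A\<close> bij by (auto simp: bij_betw_def)
qed

lemma koszul_vanish_degree_zero: "p = 0 \<Longrightarrow> 0 < j \<Longrightarrow> koszul_vanish (mult_var e) N (forms A) (\<lambda>_. {0 :: ('v, 'k) mpoly}) p j"
proof (rule K.koszul_vanishI)
  fix z :: "nat set \<Rightarrow> ('v, 'k) mpoly" assume p: "p = 0" "0 < j" and z: "koszul_chain N (forms A) p j z"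
  have z0: "z {} \<in> forms A j" using kcD[OF z, of "{}"] p by simp
  have "0 \<notin> mkeys (z {})" using z0 p(2) by (auto simp: forms_def)
  then have "lkp (z {}) 0 = 0" by (simp add: in_keys_iff)
  from no_constant_term[OF z0 this] obtain w where
    w: "\<forall>v<N. w v \<in> forms A (j - 1)" "z {} = (\<Sum>v<N. Var (e v) * w v)" by blast
  have "koszul_chain N (forms A) (p + 1) j (\<lambda>T. w (the_elem T))"
    unfolding koszul_chain_def
  proof (intro allI impI)
    fix T assume T: "T \<subseteq> {..<N}" "int (card T) = p + 1"
    then obtain v where "T = {v}" using p by (metis add_0 card_1_singletonE of_nat_eq_1_iff)
    then show "w (the_elem T) \<in> forms A (j - (p + 1))" using w T p by simp
  qed
  moreover have "koszul_chain N (\<lambda>_. {0}) p j (\<lambda>T. z T - koszul_d (mult_var e) N (\<lambda>T. w (the_elem T)) T)"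
    using p w(2) finite_subset_lessThan by (auto simp: koszul_chain_def koszul_d_empty mult_var_def)
  ultimately show "\<exists>w. koszul_chain N (forms A) (p + 1) j w \<and> koszul_chain N (\<lambda>_. {0}) p j (\<lambda>T. z T - koszul_d (mult_var e) N w T)" by blast
qed

lemma reg_le_zero: "reg_le (idl {}) 0"
  unfolding reg_le_def
proof (intro allI impI)
  fix p j :: int assume "0 < j - p"
  moreover have "(\<lambda>i. idl {} \<inter> forms A i) = (\<lambda>_. {0 :: ('v, 'k) mpoly})" by (auto simp: idl_empty)
  moreover have "koszul_vanish (mult_var e) N (forms A) (\<lambda>_. {0 :: ('v, 'k) mpoly}) p j" if "p < 0"
  proof (rule K.koszul_vanishI)
    fix z :: "nat set \<Rightarrow> ('v, 'k) mpoly"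
    show "\<exists>w. koszul_chain N (forms A) (p + 1) j w \<and> koszul_chain N (\<lambda>_. {0}) p j (\<lambda>T. z T - koszul_d (mult_var e) N w T)"
      using that by (intro exI[of _ "\<lambda>_. 0"]) (auto simp: koszul_chain_def)
  qed
  ultimately show "tor_vanish (idl {}) p j"
    using koszul_acyclic[of N p j] koszul_vanish_degree_zero[of p j] by (cases "p = 0"; cases "p < 0") auto
qed

abbreviation homgen :: "('v, 'k) mpoly set \<Rightarrow> bool" where
  "homgen G \<equiv> \<forall>g\<in>G. \<exists>d. g \<in> forms A d"

text \<open>The sum of the ideals needs the bound $r - 1$, because its homology enters with the homological degree
raised by one.\<close>

lemma reg_le_inter:
  assumes G: "homgen G" "homgen H"
    and r: "reg_le (idl G) r" "reg_le (idl H) r" "reg_le (idl (G \<union> H)) (r - 1)"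
  shows "reg_le (idl G \<inter> idl H) r"
  unfolding reg_le_def
proof (intro allI impI)
  fix p j assume pj: "r < j - p"
  have gG: "graded_ideal A (idl G)" and gH: "graded_ideal A (idl H)"
    using G by (auto intro: graded_ideal_idl)
  have "koszul_vanish (mult_var e) N (forms A) (\<lambda>i. (idl G \<inter> forms A i) \<inter> (idl H \<inter> forms A i)) p j"
  proof (rule K.koszul_vanish_inter[where U = "\<lambda>i. idl (G \<union> H) \<inter> forms A i"])
    fix i a assume a: "a \<in> idl (G \<union> H) \<inter> forms A i"
    then obtain b c where "b \<in> idl G" "c \<in> idl H" "a = b + c" by (auto elim: idl_Un)
    moreover from this have "a = form_part A i b + form_part A i c"
      using form_part_self[of a A i] a by (simp add: form_part_add)
    ultimately show "\<exists>b c. a = b + c \<and> b \<in> idl G \<inter> forms A i \<and> c \<in> idl H \<inter> forms A i"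
      using gG gH unfolding graded_ideal_def by (metis IntI form_part_forms)
  next
    show "tor_vanish (idl (G \<union> H)) (p + 1) j" "tor_vanish (idl G) p j" "tor_vanish (idl H) p j"
      using r pj by (auto simp: reg_le_def)
  qed (auto intro: graded_forms graded_ideal_sub is_ideal_idl idl_mono[THEN subsetD])
  moreover have "(\<lambda>i. (idl G \<inter> forms A i) \<inter> (idl H \<inter> forms A i)) = (\<lambda>i. (idl G \<inter> idl H) \<inter> forms A i)" by auto
  ultimately show "tor_vanish (idl G \<inter> idl H) p j" by simp
qed

lemma colon_setup_ideal:
  assumes G: "homgen G" and y: "y \<in> forms A d"
  shows "colon_setup (mult_var e) N (forms A) (\<lambda>i. idl G \<inter> forms A i) (\<lambda>i. {a. y * a \<in> idl G} \<inter> forms A i)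
    (\<lambda>i. idl (insert y G) \<inter> forms A i) (\<lambda>a. y * a) d"
proof unfold_locales
  have "is_ideal {a. y * a \<in> idl G}"
    using is_idealD[OF is_ideal_idl[of G]] by (auto simp: is_ideal_def distrib_left mult.left_commute)
  then show "graded_sub (mult_var e) N (\<lambda>i. {a. y * a \<in> idl G} \<inter> forms A i)" by (rule graded_ideal_sub)
  show "graded_sub (mult_var e) N (forms A :: int \<Rightarrow> ('v, 'k) mpoly set)" by (rule graded_forms) simp
  show "graded_sub (mult_var e) N (\<lambda>i. idl G \<inter> forms A i)" "graded_sub (mult_var e) N (\<lambda>i. idl (insert y G) \<inter> forms A i)"
    by (auto intro: graded_ideal_sub is_ideal_idl)
  show yM: "y * a \<in> forms A (i + d)" if "a \<in> forms A i" for a i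
    using forms_mult[OF y that] by (simp add: add.commute)
  show "a \<in> {a. y * a \<in> idl G} \<inter> forms A i \<longleftrightarrow> a \<in> forms A i \<and> y * a \<in> idl G \<inter> forms A (i + d)" for a i
    using yM by auto
  show "a \<in> idl (insert y G) \<inter> forms A i \<longleftrightarrow>
      (\<exists>b c. a = b + y * c \<and> b \<in> idl G \<inter> forms A i \<and> c \<in> forms A (i - d))" for a i
  proof
    assume a: "a \<in> idl (insert y G) \<inter> forms A i"
    then obtain c b where cb: "b \<in> idl G" "a = c * y + b" by (auto elim: idl_insert)
    have "a = form_part A i (c * y + b)" using form_part_self[of a A i] a cb by simp
    then have "a = form_part A i b + y * form_part A (i - d) c"
      by (simp add: form_part_add form_part_mult[OF y] mult.commute add.commute)
    moreover have "form_part A i b \<in> idl G"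
      using graded_ideal_idl[of G A] G cb by (auto simp: graded_ideal_def)
    ultimately show "\<exists>b c. a = b + y * c \<and> b \<in> idl G \<inter> forms A i \<and> c \<in> forms A (i - d)"
      using form_part_forms by blast
  next
    assume "\<exists>b c. a = b + y * c \<and> b \<in> idl G \<inter> forms A i \<and> c \<in> forms A (i - d)"
    then obtain b c where "a = b + y * c" "b \<in> idl G" "b \<in> forms A i" "c \<in> forms A (i - d)" by blast
    moreover from this have "y * c \<in> forms A i" using yM[of c "i - d"] by simp
    moreover have "idl G \<subseteq> idl (insert y G)" by (rule idl_mono) auto
    ultimately show "a \<in> idl (insert y G) \<inter> forms A i"
      using is_idealD[OF is_ideal_idl[of "insert y G"]] idl_incl[of y "insert y G"] by (auto intro: forms_add)
  qed
qed (auto simp: algebra_simps mult_var_def)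

lemma reg_le_colon:
  assumes "homgen G" "v \<in> A" "reg_le (idl (insert (Var v) G)) r" "reg_le {a. Var v * a \<in> idl G} (r - 1)"
  shows "reg_le (idl G) r"
proof -
  interpret colon_setup "mult_var e" N "forms A" "\<lambda>i. idl G \<inter> forms A i" "\<lambda>i. {a. Var v * a \<in> idl G} \<inter> forms A i"
    "\<lambda>i. idl (insert (Var v) G) \<inter> forms A i" "\<lambda>a. Var v * a" 1
    by (rule colon_setup_ideal) (use assms(1,2) Var_forms in auto)
  show ?thesis using assms(3,4) koszul_vanish_of_colon by (auto simp: reg_le_def)
qed

lemma reg_le_quotient:
  assumes "homgen G" "v \<in> A" "reg_le (idl G) r" "reg_le {a. Var v * a \<in> idl G} r"
  shows "reg_le (idl (insert (Var v) G)) r"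
proof -
  interpret colon_setup "mult_var e" N "forms A" "\<lambda>i. idl G \<inter> forms A i" "\<lambda>i. {a. Var v * a \<in> idl G} \<inter> forms A i"
    "\<lambda>i. idl (insert (Var v) G) \<inter> forms A i" "\<lambda>a. Var v * a" 1
    by (rule colon_setup_ideal) (use assms(1,2) Var_forms in auto)
  show ?thesis using assms(3,4) koszul_vanish_of_quotient by (auto simp: reg_le_def)
qed

text \<open>An element $y = c x_u + c' x_{u'}$ is homotopic to zero by the corresponding combination of exterior products with $e_u$ and $e_{u'}$.\<close>

lemma koszul_vanish_of_nonzerodivisor_ideal:
  assumes G: "homgen G" and y: "y \<in> forms A d" "y = c * Var (e u) + c' * Var (e u')" "u < N" "u' < N"
      "c \<in> forms A (d - 1)" "c' \<in> forms A (d - 1)"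
    and nzd: "\<And>a. y * a \<in> idl G \<Longrightarrow> a \<in> idl G"
    and v: "tor_vanish (idl (insert y G)) (p + 1) (j + d)"
  shows "tor_vanish (idl G) p j"
proof -
  interpret colon_setup "mult_var e" N "forms A" "\<lambda>i. idl G \<inter> forms A i" "\<lambda>i. {a. y * a \<in> idl G} \<inter> forms A i"
    "\<lambda>i. idl (insert y G) \<inter> forms A i" "\<lambda>a. y * a" d
    by (rule colon_setup_ideal) (use G y in auto)
  define h where "h = (\<lambda>z T. c * K.wedge u N z T + c' * K.wedge u' N z T)"
  have cm: "c * koszul_d (mult_var e) N z T = koszul_d (mult_var e) N (\<lambda>T. c * z T) T" for c :: "('v, 'k) mpoly" and z T
    by (rule koszul_d_hom) (auto simp: algebra_simps mult_var_def)
  show ?thesis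
  proof (rule koszul_vanish_of_nonzerodivisor[where h = h, OF _ _ _ _ v])
    fix z :: "nat set \<Rightarrow> ('v, 'k) mpoly" and T assume T: "T \<subseteq> {..<N}"
    have "koszul_d (mult_var e) N (h z) T + h (koszul_d (mult_var e) N z) T =
        c * (koszul_d (mult_var e) N (K.wedge u N z) T + K.wedge u N (koszul_d (mult_var e) N z) T) +
        c' * (koszul_d (mult_var e) N (K.wedge u' N z) T + K.wedge u' N (koszul_d (mult_var e) N z) T)"
      unfolding h_def by (simp add: K.koszul_d_add cm distrib_left)
    then show "koszul_d (mult_var e) N (h z) T + h (koszul_d (mult_var e) N z) T = y * z T"
      using K.koszul_homotopy[OF y(3) T] K.koszul_homotopy[OF y(4) T]
      by (simp add: mult_var_def y(2) distrib_right mult.assoc)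
  next
    have *: "koszul_chain N M (p + 1) (j + d) (h z)"
      if gM: "graded_sub (mult_var e) N M" and z: "koszul_chain N M p j z"
        and m: "\<And>i a c. a \<in> M i \<Longrightarrow> c \<in> forms A (d - 1) \<Longrightarrow> c * a \<in> M (i + (d - 1))" for p j z M
      unfolding koszul_chain_def
    proof (intro allI impI)
      fix T assume T: "T \<subseteq> {..<N}" "int (card T) = p + 1"
      have k: "K.wedge u N z T \<in> M (j + 1 - (p + 1))" for u
        by (rule kcD[OF K.koszul_chain_wedge[OF gM z] T])
      have "h z T \<in> M (j + 1 - (p + 1) + (d - 1))"
        unfolding h_def using m[OF k y(5)] m[OF k y(6)] by (intro graded_subD(4)[OF gM])
      then show "h z T \<in> M (j + d - (p + 1))" by (simp add: algebra_simps)
    qed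
    have m: "c * a \<in> forms A (i + (d - 1))" if "a \<in> forms A i" "c \<in> forms A (d - 1)" for a c :: "('v, 'k) mpoly" and i
      using forms_mult[OF that(2,1)] by (simp add: add.commute)
    show "koszul_chain N (forms A) (p + 1) (j + d) (h z)" if "koszul_chain N (forms A) p j z" for p j z
      using *[OF gM that m] .
    show "koszul_chain N (\<lambda>i. idl G \<inter> forms A i) (p + 1) (j + d) (h z)" if "koszul_chain N (\<lambda>i. idl G \<inter> forms A i) p j z" for p j z
      using m is_idealD[OF is_ideal_idl[of G]] by (intro *[OF gU that]) auto
  qed (use nzd in auto)
qed

lemma reg_le_nonzerodivisor:
  assumes "homgen G" "v \<in> A" "reg_le (idl (insert (Var v) G)) r" "\<And>a. Var v * a \<in> idl G \<Longrightarrow> a \<in> idl G"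
  shows "reg_le (idl G) r"
  unfolding reg_le_def
proof (intro allI impI)
  fix p j assume pj: "r < j - p"
  obtain u where u: "u < N" "e u = v" using assms(2) bij by (auto simp: bij_betw_def)
  show "tor_vanish (idl G) p j"
  proof (rule koszul_vanish_of_nonzerodivisor_ideal[where d = 1 and y = "Var v" and u = u and u' = u and c = 1 and c' = 0])
    show "1 \<in> forms A (1 - 1)" by (simp add: forms_def)
  qed (use assms pj u Var_forms in \<open>auto simp: reg_le_def\<close>)
qed

end

section \<open>Binomial edge ideals of disjoint unions of complete graphs\<close>

definition edge_binom :: "'w \<Rightarrow> 'w \<Rightarrow> ('w edge_var, 'k::field) mpoly" where
  "edge_binom a b = Var (X a) * Var (Y b) - Var (X b) * Var (Y a)"

definition edge_binoms :: "('w \<times> 'w) set \<Rightarrow> ('w edge_var, 'k::field) mpoly set" where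
  "edge_binoms E = {edge_binom a b | a b. (a, b) \<in> E}"

text \<open>All ideals of the reduction are of this kind: a set of variables that have been
killed, and the binomials of the remaining edges. A graph is a relation on its vertices.\<close>

definition graph_gens :: "'w edge_var set \<Rightarrow> ('w \<times> 'w) set \<Rightarrow> ('w edge_var, 'k::field) mpoly set" where
  "graph_gens L E = Var ` L \<union> edge_binoms E"

definition clique_edges :: "'w set \<Rightarrow> ('w \<Rightarrow> 'c) \<Rightarrow> ('w \<times> 'w) set" where
  "clique_edges W cl = {(a, b). a \<in> W \<and> b \<in> W \<and> a \<noteq> b \<and> cl a = cl b}"

lemma in_edge_vars [simp]: "X i \<in> edge_vars W \<longleftrightarrow> i \<in> W" "Y i \<in> edge_vars W \<longleftrightarrow> i \<in> W"
  by (auto simp: edge_vars_def)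

lemma edge_binom_forms: "a \<in> V \<Longrightarrow> b \<in> V \<Longrightarrow> (edge_binom a b :: ('w edge_var, 'k::field) mpoly) \<in> forms (edge_vars V) 2"
proof -
  assume "a \<in> V" "b \<in> V"
  then have v: "Var (X a) \<in> forms (edge_vars V) 1" "Var (Y a) \<in> forms (edge_vars V) 1"
    "Var (X b) \<in> forms (edge_vars V) 1" "Var (Y b) \<in> forms (edge_vars V) 1"
    by (auto intro: Var_forms)
  show ?thesis unfolding edge_binom_def
    using forms_diff[OF forms_mult[OF v(1,4)] forms_mult[OF v(3,2)]] by simp
qed

lemma edge_binom_keys: "m \<in> mkeys (edge_binom a b) \<Longrightarrow> mkeys m \<subseteq> {X a, X b, Y a, Y b}"
  using edge_binom_forms[of a "{a, b}" b] by (auto simp: forms_def edge_vars_def)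

lemma edge_binom_swap: "edge_binom b a = - edge_binom a b"
  by (simp add: edge_binom_def)

lemma zero_vars_edge_binom: "zero_vars W (edge_binom a b) = zero_vars W (Var (X a)) * zero_vars W (Var (Y b)) - zero_vars W (Var (X b)) * zero_vars W (Var (Y a))"
  by (simp add: edge_binom_def zero_vars_diff zero_vars_mult)

text \<open>For a disjoint union of complete graphs with components given by \<open>cl\<close>, let $x_i \mapsto s_c z_i$ and
$y_i \mapsto t_c z_i$ for every vertex $i$ of \<open>W\<close> in the component $c$. Two monomials are related iff they have
the same image; the exponents of the $t_c$ are determined by the others.\<close>

definition same_class :: "'w set \<Rightarrow> ('w \<Rightarrow> 'c) \<Rightarrow> ('w edge_var \<Rightarrow>\<^sub>0 nat) \<Rightarrow> ('w edge_var \<Rightarrow>\<^sub>0 nat) \<Rightarrow> bool" where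
  "same_class W cl m m' \<longleftrightarrow> (\<forall>v. v \<notin> edge_vars W \<longrightarrow> lkp m v = lkp m' v) \<and>
     (\<forall>i\<in>W. lkp m (X i) + lkp m (Y i) = lkp m' (X i) + lkp m' (Y i)) \<and>
     (\<forall>c. (\<Sum>i\<in>{i\<in>W. cl i = c}. lkp m (X i)) = (\<Sum>i\<in>{i\<in>W. cl i = c}. lkp m' (X i)))"

lemma same_class_refl [simp]: "same_class W cl m m"
  by (simp add: same_class_def)

lemma same_class_sym: "same_class W cl m m' \<Longrightarrow> same_class W cl m' m"
  by (simp add: same_class_def)

lemma same_class_trans: "same_class W cl m m' \<Longrightarrow> same_class W cl m' m'' \<Longrightarrow> same_class W cl m m''"
  by (simp add: same_class_def)

lemma same_class_cong: "same_class W cl m m' \<Longrightarrow> same_class W cl m m0 \<longleftrightarrow> same_class W cl m' m0"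
  by (blast intro: same_class_sym same_class_trans)

lemma same_class_add: "same_class W cl (k + m) (k + m') \<longleftrightarrow> same_class W cl m m'"
  unfolding same_class_def by (simp add: lookup_add sum.distrib)

lemma key_split: "v \<in> mkeys (m :: 'v \<Rightarrow>\<^sub>0 nat) \<Longrightarrow> \<exists>k. m = sgl v 1 + k"
  by (intro exI[of _ "m - sgl v 1"] poly_mapping_eqI)
     (auto simp: lookup_add lookup_minus lookup_single in_keys_iff when_def)

lemma same_class_swap:
  assumes "finite W" "i \<in> W" "j \<in> W" "cl i = cl j"
  shows "same_class W cl (sgl (X i) 1 + (sgl (Y j) 1 + r)) (sgl (X j) 1 + (sgl (Y i) 1 + r))"
proof -
  have s: "(\<Sum>k\<in>{k\<in>W. cl k = c}. lkp (sgl (X i) 1) (X k)) = (if cl i = c then 1 else (0::nat))" if "i \<in> W" for i c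
  proof -
    have "(\<Sum>k\<in>{k\<in>W. cl k = c}. lkp (sgl (X i) 1) (X k)) = (\<Sum>k\<in>{k\<in>W. cl k = c}. if k = i then 1 else (0::nat))"
      by (intro sum.cong) (auto simp: lookup_single when_def)
    then show ?thesis using assms(1) that by simp
  qed
  have "same_class W cl (sgl (X i) 1 + sgl (Y j) 1) (sgl (X j) 1 + sgl (Y i) 1)"
    unfolding same_class_def using assms s[of i] s[of j]
    by (auto simp: lookup_add sum.distrib lookup_single when_def)
  then have "same_class W cl (r + (sgl (X i) 1 + sgl (Y j) 1)) (r + (sgl (X j) 1 + sgl (Y i) 1))"
    by (simp only: same_class_add)
  then show ?thesis by (simp add: ac_simps)
qed

lemma sgl_mult_edge_binom: "sgl m c * edge_binom a b =
    sgl (sgl (X a) 1 + (sgl (Y b) 1 + m)) c - sgl (sgl (X b) 1 + (sgl (Y a) 1 + m)) c"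
  by (simp add: edge_binom_def Var_def right_diff_distrib mult_single ac_simps)

text \<open>Cancel common variables. If none is left and $x_i$ divides the first monomial, then $y_i$ divides
the second one, which also contains some $x_j$ from the same component, and then $y_j$
divides the first monomial. Replacing $x_i y_j$ by $x_j y_i$ there creates the common variable $x_j$.\<close>

lemma binomial_congruence:
  assumes "finite W" "same_class W cl m m'"
  shows "sgl m 1 - sgl m' 1 \<in> idl (edge_binoms (clique_edges W cl) :: ('w edge_var, 'k::field) mpoly set)"
  using assms(2)
proof (induction "mono_deg m" arbitrary: m m' rule: less_induct)
  case less
  let ?I = "idl (edge_binoms (clique_edges W cl) :: ('w edge_var, 'k) mpoly set)"
  note I = is_idealD[OF is_ideal_idl[of "edge_binoms (clique_edges W cl) :: ('w edge_var, 'k) mpoly set"]]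
  have shared: "sgl (sgl v 1 + k) 1 - sgl (sgl v 1 + k') 1 \<in> ?I"
    if "mono_deg k < mono_deg m" "same_class W cl k k'" for v k k'
  proof -
    have "sgl (sgl v 1 + k) (1::'k) - sgl (sgl v 1 + k') 1 = Var v * (sgl k 1 - sgl k' 1)"
      by (simp add: Var_def right_diff_distrib mult_single)
    then show ?thesis using I(3)[OF less(1)[OF that]] by simp
  qed
  have key: "sgl a 1 - sgl b 1 \<in> ?I"
    if ab: "same_class W cl a b" "mono_deg a = mono_deg m" "mkeys a \<inter> mkeys b = {}" "i \<in> W" "X i \<in> mkeys a" for a b i
  proof -
    have "Y i \<in> mkeys b"
    proof -
      have "lkp a (X i) + lkp a (Y i) = lkp b (X i) + lkp b (Y i)" using ab by (auto simp: same_class_def)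
      moreover have "lkp b (X i) = 0" "lkp a (X i) > 0" using ab by (auto simp: in_keys_iff)
      ultimately show ?thesis by (auto simp: in_keys_iff)
    qed
    have "(\<Sum>k\<in>{k\<in>W. cl k = cl i}. lkp a (X k)) > 0"
      using ab assms(1) by (intro sum_pos2[of _ i]) (auto simp: in_keys_iff)
    then have "(\<Sum>k\<in>{k\<in>W. cl k = cl i}. lkp b (X k)) > 0"
      using ab(1) by (simp add: same_class_def)
    then have "(\<Sum>k\<in>{k\<in>W. cl k = cl i}. lkp b (X k)) \<noteq> 0" by simp
    then obtain j where j: "j \<in> W" "cl j = cl i" "lkp b (X j) > 0"
      by (rule sum.not_neutral_contains_not_neutral) auto
    have Yj: "Y j \<in> mkeys a"
    proof -
      have "lkp a (X j) + lkp a (Y j) = lkp b (X j) + lkp b (Y j)" using ab j by (auto simp: same_class_def)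
      moreover have "lkp a (X j) = 0" using ab j by (auto simp: in_keys_iff)
      ultimately show ?thesis using j by (auto simp: in_keys_iff)
    qed
    have "i \<noteq> j" using ab j by (auto simp: in_keys_iff)
    obtain k where k: "a = sgl (X i) 1 + k" using key_split[OF ab(5)] by blast
    have "Y j \<in> mkeys k" using Yj unfolding k by (simp add: keys_plus_nat)
    from key_split[OF this] obtain r where r: "k = sgl (Y j) 1 + r" by blast
    obtain k' where k': "b = sgl (X j) 1 + k'" using key_split[of "X j" b] j(3) by (auto simp: in_keys_iff)
    let ?c = "sgl (X j) 1 + (sgl (Y i) 1 + r)"
    have ac: "same_class W cl a ?c"
      unfolding k r by (rule same_class_swap) (use assms(1) j ab in auto)
    have "(i, j) \<in> clique_edges W cl" using ab j \<open>i \<noteq> j\<close> by (auto simp: clique_edges_def)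
    then have "sgl r 1 * edge_binom i j \<in> ?I"
      by (intro I(3) idl_incl) (auto simp: edge_binoms_def)
    then have 1: "sgl a 1 - sgl ?c 1 \<in> ?I" unfolding k r by (simp add: sgl_mult_edge_binom)
    have "same_class W cl ?c b" using same_class_cong[OF ac] ab(1) by simp
    then have "same_class W cl (sgl (Y i) 1 + r) k'" unfolding k' by (simp only: same_class_add)
    moreover have "mono_deg (sgl (Y i) 1 + r) < mono_deg m" using ab(2) unfolding k r by (simp add: mono_deg_add)
    ultimately have 2: "sgl ?c 1 - sgl b 1 \<in> ?I"
      using shared[of "sgl (Y i) 1 + r" k' "X j"] k' by simp
    show ?thesis using I(2)[OF 1 2] by simp
  qed
  show ?case
  proof (cases "mkeys m \<inter> mkeys m' = {}")
    case False
    then obtain v where v: "v \<in> mkeys m" "v \<in> mkeys m'" by blast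
    obtain k where k1: "m = sgl v 1 + k" using key_split[OF v(1)] by blast
    obtain k' where k2: "m' = sgl v 1 + k'" using key_split[OF v(2)] by blast
    note k = k1 k2
    have "mono_deg k < mono_deg m" using k by (simp add: mono_deg_add)
    moreover have "same_class W cl k k'" using less(2) unfolding k by (simp only: same_class_add)
    ultimately show ?thesis using shared[of k k' v] k by simp
  next
    case disj: True
    have deg: "mono_deg m' = mono_deg m"
    proof -
      let ?S = "(mkeys m \<union> mkeys m') - edge_vars W"
      have deg: "mono_deg a = (\<Sum>v\<in>?S. lkp a v) + (\<Sum>i\<in>W. lkp a (X i) + lkp a (Y i))"
        if a: "mkeys a \<subseteq> mkeys m \<union> mkeys m'" for a :: "'w edge_var \<Rightarrow>\<^sub>0 nat"
      proof -
        have fin: "finite (edge_vars W)" using assms(1) by (simp add: edge_vars_def)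
        have "mono_deg a = (\<Sum>v\<in>?S \<union> edge_vars W. lkp a v)"
          unfolding mono_deg_def using fin a by (intro sum.mono_neutral_left) (auto simp: in_keys_iff)
        also have "\<dots> = (\<Sum>v\<in>?S. lkp a v) + (\<Sum>v\<in>edge_vars W. lkp a v)"
          using fin by (intro sum.union_disjoint) auto
        also have "(\<Sum>v\<in>edge_vars W. lkp a v) = (\<Sum>i\<in>W. lkp a (X i)) + (\<Sum>i\<in>W. lkp a (Y i))"
          unfolding edge_vars_def using assms(1)
          by (subst sum.union_disjoint) (auto simp: sum.reindex inj_on_def)
        finally show ?thesis by (simp add: sum.distrib)
      qed
      have "(\<Sum>v\<in>?S. lkp m v) = (\<Sum>v\<in>?S. lkp m' v)"
        by (rule sum.cong) (use less(2) in \<open>simp_all add: same_class_def\<close>)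
      moreover have "(\<Sum>i\<in>W. lkp m (X i) + lkp m (Y i)) = (\<Sum>i\<in>W. lkp m' (X i) + lkp m' (Y i))"
        by (rule sum.cong) (use less(2) in \<open>simp_all add: same_class_def\<close>)
      ultimately show ?thesis by (simp add: deg)
    qed
    show ?thesis
    proof (cases "m = m'")
      case True
      then show ?thesis by (simp add: idl.zero)
    next
      case False
      then obtain v where v: "lkp m v \<noteq> lkp m' v" by (metis poly_mapping_eqI)
      then have "v \<in> edge_vars W" using less(2) by (auto simp: same_class_def)
      then obtain i where i: "i \<in> W" "v = X i \<or> v = Y i" by (auto simp: edge_vars_def)
      have s: "lkp m (X i) + lkp m (Y i) = lkp m' (X i) + lkp m' (Y i)" using less(2) i by (auto simp: same_class_def)
      have d: "lkp m (X i) = 0 \<or> lkp m' (X i) = 0" using disj by (auto simp: in_keys_iff)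
      have "lkp m (X i) \<noteq> 0 \<or> lkp m' (X i) \<noteq> 0"
        using v i(2) s by (cases "lkp m (X i) = 0"; cases "lkp m' (X i) = 0") auto
      then consider "X i \<in> mkeys m" | "X i \<in> mkeys m'"
        by (auto simp: in_keys_iff)
      then show ?thesis
      proof cases
        case 1
        then show ?thesis using key[OF less(2) refl disj i(1)] by blast
      next
        case 2
        have "sgl m' 1 - sgl m 1 \<in> ?I"
          by (rule key[OF same_class_sym[OF less(2)] deg _ i(1) 2]) (use disj in auto)
        from I(5)[OF this] show ?thesis by simp
      qed
    qed
  qed
qed

text \<open>The coefficient, in the image of \<open>f\<close> under the toric parametrization, of the image of \<open>m0\<close>.\<close>

definition class_sum :: "'w set \<Rightarrow> ('w \<Rightarrow> 'c) \<Rightarrow> ('w edge_var, 'k::field) mpoly \<Rightarrow> ('w edge_var \<Rightarrow>\<^sub>0 nat) \<Rightarrow> 'k" where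
  "class_sum W cl f m0 = (\<Sum>m\<in>mkeys f. if same_class W cl m m0 then lkp f m else 0)"

lemma class_sum_superset:
  "finite S \<Longrightarrow> mkeys f \<subseteq> S \<Longrightarrow> class_sum W cl f m0 = (\<Sum>m\<in>S. if same_class W cl m m0 then lkp f m else 0)"
  unfolding class_sum_def by (intro sum.mono_neutral_left) (auto simp: in_keys_iff)

lemma class_sum_add: "class_sum W cl (f + g) m0 = class_sum W cl f m0 + class_sum W cl g m0"
proof -
  have "mkeys (f + g) \<subseteq> mkeys f \<union> mkeys g" by (rule Poly_Mapping.keys_add)
  then show ?thesis
    by (subst (1 2 3) class_sum_superset[of "mkeys f \<union> mkeys g"])
       (auto simp: lookup_add sum.distrib[symmetric] intro!: sum.cong)
qed

lemma class_sum_zero [simp]: "class_sum W cl 0 m0 = 0" by (simp add: class_sum_def)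

lemma class_sum_diff: "class_sum W cl (f - g) m0 = class_sum W cl f m0 - class_sum W cl g m0"
  using class_sum_add[of W cl "f - g" g m0] by simp

lemma class_sum_single: "class_sum W cl (sgl m c) m0 = (if same_class W cl m m0 then c else 0)"
  by (simp add: class_sum_def)

lemma class_sum_Var_mult: "class_sum W cl (Var v * f) (sgl v 1 + m0) = class_sum W cl f m0"
  by (induction f rule: mpoly_induct)
     (simp_all add: distrib_left class_sum_add Var_def mult_single class_sum_single same_class_add del: One_nat_def)

lemma class_sum_mult_edge_binom:
  assumes "finite W" "(a, b) \<in> clique_edges W cl"
  shows "class_sum W cl (f * edge_binom a b) m0 = 0"
proof (induction f rule: mpoly_induct)
  case zero
  then show ?case by simp
next
  case (add f m c)
  have "same_class W cl (sgl (X a) 1 + (sgl (Y b) 1 + m)) (sgl (X b) 1 + (sgl (Y a) 1 + m))"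
    using assms by (intro same_class_swap) (auto simp: clique_edges_def)
  then have "same_class W cl (sgl (X a) 1 + (sgl (Y b) 1 + m)) m0 \<longleftrightarrow> same_class W cl (sgl (X b) 1 + (sgl (Y a) 1 + m)) m0"
    by (rule same_class_cong)
  then show ?case using add by (simp add: distrib_right class_sum_add sgl_mult_edge_binom class_sum_diff class_sum_single del: One_nat_def)
qed

lemma class_sum_isolated:
  assumes "m \<in> mkeys g" "\<And>m'. m' \<in> mkeys g \<Longrightarrow> same_class W cl m' m \<Longrightarrow> m' = m"
  shows "class_sum W cl g m = lkp g m"
proof -
  have "class_sum W cl g m = lkp g m + (\<Sum>m'\<in>mkeys g - {m}. if same_class W cl m' m then lkp g m' else 0)"
    unfolding class_sum_def sum.remove[OF finite_keys assms(1)] by simp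
  also have "(\<Sum>m'\<in>mkeys g - {m}. if same_class W cl m' m then lkp g m' else 0) = 0"
    by (rule sum.neutral) (use assms(2) in auto)
  finally show ?thesis by simp
qed

lemma keys_cancel:
  fixes g :: "'a \<Rightarrow>\<^sub>0 'b::ab_group_add"
  assumes "m' \<in> mkeys g" "m' \<noteq> m"
  shows "mkeys (g - (sgl m (lkp g m) - sgl m' (lkp g m))) \<subseteq> mkeys g - {m}"
proof -
  let ?h = "g - (sgl m (lkp g m) - sgl m' (lkp g m))"
  have "lkp ?h m = 0" using assms(2) by (simp add: lookup_minus lookup_single when_def)
  then have 1: "m \<notin> mkeys ?h" by (simp only: in_keys_iff not_not)
  have 2: "k \<in> mkeys g" if "k \<in> mkeys ?h" "k \<noteq> m" "k \<noteq> m'" for k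
  proof -
    have "lkp ?h k = lkp g k" using that(2,3) by (simp add: lookup_minus lookup_single when_def)
    then show ?thesis using that(1) by (simp only: in_keys_iff not_False_eq_True)
  qed
  show ?thesis
  proof
    fix k assume k: "k \<in> mkeys ?h"
    with 1 have "k \<noteq> m" by metis
    moreover from this have "k \<in> mkeys g" using assms(1) 2[OF k] by (cases "k = m'") simp_all
    ultimately show "k \<in> mkeys g - {m}" by simp
  qed
qed

text \<open>The ideal is the kernel of the toric parametrization, extended by zero on the variables in \<open>L\<close>. For a
polynomial in the kernel, every monomial has a partner in its class with which it can be
cancelled modulo the ideal.\<close>

lemma clique_ideal_iff:
  fixes f :: "('w edge_var, 'k::field) mpoly" and cl :: "'w \<Rightarrow> 'c"
  assumes W: "finite W" and L: "L \<inter> edge_vars W = {}"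
  shows "f \<in> idl (graph_gens L (clique_edges W cl)) \<longleftrightarrow> (\<forall>m0. class_sum W cl (zero_vars L f) m0 = 0)"
proof
  assume "f \<in> idl (graph_gens L (clique_edges W cl))"
  then show "\<forall>m0. class_sum W cl (zero_vars L f) m0 = 0"
  proof induction
    case zero
    then show ?case by simp
  next
    case (step g f c)
    have "class_sum W cl (zero_vars L (c * g)) m0 = 0" for m0
    proof (cases "g \<in> Var ` L")
      case True
      then show ?thesis by (auto simp: zero_vars_mult zero_vars_Var)
    next
      case False
      then obtain a b where ab: "g = edge_binom a b" "(a, b) \<in> clique_edges W cl"
        using step(1) by (auto simp: graph_gens_def edge_binoms_def)
      have W: "a \<in> W" "b \<in> W" using ab(2) by (simp_all add: clique_edges_def)
      have n: "v \<notin> L" if "v \<in> edge_vars W" for v using L that by blast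
      have "X a \<notin> L" "X b \<notin> L" "Y a \<notin> L" "Y b \<notin> L"
        by (rule n, simp add: W)+
      then have "zero_vars L (edge_binom a b :: ('w edge_var, 'k) mpoly) = edge_binom a b"
        unfolding zero_vars_edge_binom zero_vars_Var by (simp add: edge_binom_def)
      then have "zero_vars L g = g" unfolding ab(1) .
      then show ?thesis using class_sum_mult_edge_binom[OF assms(1) ab(2)] by (simp add: zero_vars_mult ab(1))
    qed
    then show ?case using step by (simp add: zero_vars_add class_sum_add)
  qed
next
  assume *: "\<forall>m0. class_sum W cl (zero_vars L f) m0 = 0"
  have gen: "g \<in> idl (edge_binoms (clique_edges W cl))" if "\<forall>m0. class_sum W cl g m0 = 0" for g :: "('w edge_var, 'k) mpoly"
    using that
  proof (induction "card (mkeys g)" arbitrary: g rule: less_induct)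
    case less
    note I = is_idealD[OF is_ideal_idl[of "edge_binoms (clique_edges W cl) :: ('w edge_var, 'k) mpoly set"]]
    show ?case
    proof (cases "g = 0")
      case True
      then show ?thesis by (simp add: idl.zero)
    next
      case False
      then have "mkeys g \<noteq> {}" by simp
      then obtain m where m: "m \<in> mkeys g" by blast
      let ?c = "lkp g m"
      have "\<exists>m'\<in>mkeys g. m' \<noteq> m \<and> same_class W cl m' m"
      proof (rule ccontr)
        assume "\<not> ?thesis"
        then have "class_sum W cl g m = lkp g m" using m by (intro class_sum_isolated) blast+
        then have "lkp g m = 0" using spec[OF less(2), of m] by (rule trans[OF sym])
        then show False using m by (simp only: in_keys_iff simp_thms)
      qed
      then obtain m' where m': "m' \<in> mkeys g" "m' \<noteq> m" "same_class W cl m' m" by blast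
      let ?d = "sgl m ?c - sgl m' ?c"
      \<comment> \<open>subtracting \<open>?d\<close> removes the monomial \<open>m\<close> and adds no new one\<close>
    have "mkeys (g - ?d) \<subseteq> mkeys g - {m}"
        by (rule keys_cancel[OF m'(1,2)])
      then have "card (mkeys (g - ?d)) < card (mkeys g)"
        using m by (intro psubset_card_mono finite_keys) blast
      moreover have "class_sum W cl (g - ?d) m0 = 0" for m0
      proof -
        have "same_class W cl m m0 \<longleftrightarrow> same_class W cl m' m0" using same_class_cong[OF m'(3)] by simp
        then show ?thesis using less(2) by (simp add: class_sum_diff class_sum_single)
      qed
      ultimately have 1: "g - ?d \<in> idl (edge_binoms (clique_edges W cl))" using less(1) by blast
      have "?d = sgl 0 ?c * (sgl m 1 - sgl m' 1)" by (simp add: right_diff_distrib mult_single)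
      then have "?d \<in> idl (edge_binoms (clique_edges W cl))"
        using I(3)[OF binomial_congruence[OF W same_class_sym[OF m'(3)]]] by simp
      from I(2)[OF 1 this] show ?thesis by simp
    qed
  qed
  have 1: "zero_vars L f \<in> idl (graph_gens L (clique_edges W cl))"
    by (rule subsetD[OF idl_mono gen[OF *]]) (simp add: graph_gens_def)
  have 2: "f - zero_vars L f \<in> idl (graph_gens L (clique_edges W cl))"
    by (rule subsetD[OF idl_mono diff_zero_vars_idl]) (simp add: graph_gens_def)
  show "f \<in> idl (graph_gens L (clique_edges W cl))"
    using is_idealD(2)[OF is_ideal_idl 1 2] by simp
qed

text \<open>Multiplication by a variable maps distinct classes of monomials to distinct classes.\<close>

lemma clique_variable_nonzerodivisor:
  assumes W: "finite W" and L: "L \<inter> edge_vars W = {}" and u: "u \<notin> L"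
    and f: "Var u * f \<in> idl (graph_gens L (clique_edges W cl))"
  shows "f \<in> idl (graph_gens L (clique_edges W cl))"
  unfolding clique_ideal_iff[OF W L]
proof
  fix m0
  have "zero_vars L (Var u * f) = Var u * zero_vars L f" using u by (simp add: zero_vars_mult zero_vars_Var)
  then show "class_sum W cl (zero_vars L f) m0 = 0"
    using f class_sum_Var_mult[of W cl u "zero_vars L f" m0] unfolding clique_ideal_iff[OF W L] by metis
qed

section \<open>The upper bound for the regularity\<close>

lemma graph_gens_mono: "L \<subseteq> L' \<Longrightarrow> E \<subseteq> E' \<Longrightarrow> graph_gens L E \<subseteq> graph_gens L' E'"
  by (auto simp: graph_gens_def edge_binoms_def)

lemma Var_in_graph_gens: "v \<in> L \<Longrightarrow> Var v \<in> idl (graph_gens L E)"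
  by (rule idl_incl) (simp add: graph_gens_def)

lemma edge_binom_in_graph_gens: "(a, b) \<in> E \<Longrightarrow> edge_binom a b \<in> idl (graph_gens L E)"
  by (rule idl_incl) (auto simp: graph_gens_def edge_binoms_def)

lemma graph_gens_subset_idl:
  assumes "\<And>v. v \<in> L \<Longrightarrow> Var v \<in> I" "\<And>a b. (a, b) \<in> E \<Longrightarrow> edge_binom a b \<in> I" "is_ideal I"
  shows "idl (graph_gens L E) \<subseteq> I"
  by (rule idl_least[OF assms(3)]) (use assms(1,2) in \<open>auto simp: graph_gens_def edge_binoms_def\<close>)

lemma edge_binom_in_ideal:
  assumes "is_ideal I" "Var (X a) \<in> I \<or> Var (Y b) \<in> I" "Var (X b) \<in> I \<or> Var (Y a) \<in> I"
  shows "edge_binom a b \<in> I"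
proof -
  have "Var (X a) * Var (Y b) \<in> I" using assms(2) by (auto intro: is_idealD(3,4)[OF assms(1)])
  moreover have "Var (X b) * Var (Y a) \<in> I" using assms(3) by (auto intro: is_idealD(3,4)[OF assms(1)])
  ultimately show ?thesis unfolding edge_binom_def by (rule is_idealD(6)[OF assms(1)])
qed

locale graph_koszul = poly_koszul "edge_vars V" e N ty
  for V :: "'w set" and e :: "nat \<Rightarrow> 'w edge_var" and N :: nat and ty :: "'k::field itself" +
  assumes finV: "finite V"
begin

lemma homgen_graph_gens: "L \<subseteq> edge_vars V \<Longrightarrow> E \<subseteq> V \<times> V \<Longrightarrow> homgen (graph_gens L E)"
proof
  fix g :: "('w edge_var, 'k) mpoly"
  assume L: "L \<subseteq> edge_vars V" and E: "E \<subseteq> V \<times> V" and "g \<in> graph_gens L E"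
  then consider u where "g = Var u" "u \<in> L" | a b where "g = edge_binom a b" "(a, b) \<in> E"
    by (auto simp: graph_gens_def edge_binoms_def)
  then show "\<exists>d. g \<in> forms (edge_vars V) d"
  proof cases
    case 1
    then show ?thesis using L Var_forms[of u "edge_vars V"] by auto
  next
    case 2
    then have "a \<in> V" "b \<in> V" using E by auto
    from edge_binom_forms[OF this] 2(1) show ?thesis by auto
  qed
qed

text \<open>Each variable is a nonzerodivisor modulo the others, and in the resulting exact sequence the degree shift
of the first term makes up for the raised homological degree.\<close>

lemma reg_le_variables:
  assumes "L \<subseteq> edge_vars V"
  shows "reg_le (idl (Var ` L)) 0"
proof -
  have "finite L" using assms finite_A finite_subset by blast
  then show ?thesis using assms
  proof induction
    case empty
    then show ?case by (simp add: reg_le_zero)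
  next
    case (insert v L)
    have IH: "reg_le (idl (Var ` L)) 0" using insert by simp
    have eq: "{a. Var v * a \<in> idl (Var ` L)} = (idl (Var ` L) :: ('w edge_var, 'k) mpoly set)"
    proof (intro equalityI subsetI)
      fix a :: "('w edge_var, 'k) mpoly" assume "a \<in> {a. Var v * a \<in> idl (Var ` L)}"
      then have a: "Var v * a \<in> idl (Var ` L)" by simp
      show "a \<in> idl (Var ` L)"
      proof (rule idl_new_variable[OF _ a])
        fix g :: "('w edge_var, 'k) mpoly" and m assume "g \<in> Var ` L" "m \<in> mkeys g"
        then show "v \<notin> mkeys m" using insert(2) by (auto simp: Var_def split: if_splits)
      qed
    qed (auto intro: is_idealD(3)[OF is_ideal_idl])
    show ?case unfolding image_insert
    proof (rule reg_le_quotient)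
      show "reg_le {a. Var v * a \<in> idl (Var ` L)} 0" unfolding eq by (rule IH)
      show "homgen (Var ` L)"
      proof
        fix g :: "('w edge_var, 'k) mpoly" assume "g \<in> Var ` L"
        then obtain u where "g = Var u" "u \<in> edge_vars V" using insert(4) by auto
        then show "\<exists>d. g \<in> forms (edge_vars V) d" using Var_forms[of u "edge_vars V"] by auto
      qed
    qed (use insert IH in auto)
  qed
qed

text \<open>Let $I$ be the ideal. As $x_w$ is a nonzerodivisor modulo $I$, it suffices to bound the regularity
for $I + (x_w)$. In the sequence for multiplication by $y_w$, the ideal $I + (x_w, y_w)$ belongs to the graph
without $w$, and $(I + (x_w)) : y_w$ contains $x_i$ for all vertices $i$ of the component $C$ of $w$, by
$y_w x_i = f_{iw} + y_i x_w$; modulo these variables the binomials of $C$ vanish.\<close>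

lemma reg_le_clique_step:
  assumes W: "W \<subseteq> V" and L: "L \<subseteq> edge_vars V" "L \<inter> edge_vars W = {}" and w: "w \<in> W"
    and C: "C = {i \<in> W. cl i = cl w}"
    and r1: "reg_le (idl (graph_gens (L \<union> {X w, Y w}) (clique_edges (W - {w}) cl))) r"
    and r2: "reg_le (idl (graph_gens (L \<union> X ` C) (clique_edges (W - C) cl))) (r - 1)"
  shows "reg_le (idl (graph_gens L (clique_edges W cl))) r"
proof -
  let ?G = "graph_gens L (clique_edges W cl) :: ('w edge_var, 'k) mpoly set"
  let ?G1 = "insert (Var (X w)) ?G"
  let ?G2 = "insert (Var (Y w)) ?G1"
  have fW: "finite W" using W finV finite_subset by blast
  have wV: "w \<in> V" using w W by blast
  have E: "clique_edges W cl \<subseteq> V \<times> V" using W by (auto simp: clique_edges_def)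
  have hG: "homgen ?G" by (rule homgen_graph_gens[OF L(1) E])
  have hG1: "homgen ?G1" using hG Var_forms[of "X w" "edge_vars V"] wV by auto
  note I1 = is_ideal_idl[of ?G1] and I2 = is_ideal_idl[of ?G2]
  have wL: "X w \<notin> L" "Y w \<notin> L" using L(2) w by auto
  have g1: "g \<in> idl ?G1" if "g \<in> idl ?G" for g using that idl_mono[of ?G ?G1] by blast
  have g2: "g \<in> idl ?G2" if "g \<in> idl ?G1" for g using that idl_mono[of ?G1 ?G2] by blast
  have e2: "idl ?G2 = idl (graph_gens (L \<union> {X w, Y w}) (clique_edges (W - {w}) cl))" (is "_ = idl ?H")
  proof
    note IH = is_ideal_idl[of ?H]
    have xy: "Var (X w) \<in> idl ?H" "Var (Y w) \<in> idl ?H" by (auto intro: Var_in_graph_gens)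
    have "edge_binom a b \<in> idl ?H" if "(a, b) \<in> clique_edges W cl" for a b
    proof (cases "a = w \<or> b = w")
      case True
      then show ?thesis using xy by (intro edge_binom_in_ideal[OF IH]) auto
    next
      case False
      then show ?thesis using that by (intro edge_binom_in_graph_gens) (auto simp: clique_edges_def)
    qed
    then have "idl ?G \<subseteq> idl ?H" by (intro graph_gens_subset_idl[OF _ _ IH]) (auto intro: Var_in_graph_gens)
    then show "idl ?G2 \<subseteq> idl ?H"
      using xy idl_incl[of _ ?G] by (intro idl_subset_idl) blast
    show "idl ?H \<subseteq> idl ?G2"
    proof (rule graph_gens_subset_idl[OF _ _ I2])
      fix v assume "v \<in> L \<union> {X w, Y w}"
      then show "Var v \<in> idl ?G2"
        using g1[OF Var_in_graph_gens, THEN g2] idl_incl[of "Var (X w)" ?G2] idl_incl[of "Var (Y w)" ?G2] by auto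
    next
      fix a b assume "(a, b) \<in> clique_edges (W - {w}) cl"
      then have "(a, b) \<in> clique_edges W cl" by (auto simp: clique_edges_def)
      then show "edge_binom a b \<in> idl ?G2" by (intro g2 g1 edge_binom_in_graph_gens)
    qed
  qed
  let ?Q = "graph_gens (L \<union> X ` C) (clique_edges (W - C) cl) :: ('w edge_var, 'k) mpoly set"
  have e1: "{a. Var (Y w) * a \<in> idl ?G1} = idl ?Q"
  proof
    note IQ = is_ideal_idl[of ?Q]
    have xw: "Var (X w) \<in> idl ?Q" by (rule Var_in_graph_gens) (use w C in auto)
    have "edge_binom a b \<in> idl ?Q" if ab: "(a, b) \<in> clique_edges W cl" for a b
    proof (cases "cl a = cl w")
      case True
      then have "Var (X a) \<in> idl ?Q" "Var (X b) \<in> idl ?Q"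
        using ab C by (auto simp: clique_edges_def intro!: Var_in_graph_gens)
      then show ?thesis by (intro edge_binom_in_ideal[OF IQ]) auto
    next
      case False
      then show ?thesis using ab C by (intro edge_binom_in_graph_gens) (auto simp: clique_edges_def)
    qed
    then have "idl ?G \<subseteq> idl ?Q" by (intro graph_gens_subset_idl[OF _ _ IQ]) (auto intro: Var_in_graph_gens)
    then have sub: "idl ?G1 \<subseteq> idl ?Q"
      using xw idl_incl[of _ ?G] by (intro idl_subset_idl) blast
    show "{a. Var (Y w) * a \<in> idl ?G1} \<subseteq> idl ?Q"
    proof
      fix a assume "a \<in> {a. Var (Y w) * a \<in> idl ?G1}"
      then have a: "Var (Y w) * a \<in> idl ?Q" using sub by blast
      show "a \<in> idl ?Q"
      proof (rule clique_variable_nonzerodivisor[OF _ _ _ a])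
        show "finite (W - C)" using fW by simp
        show "(L \<union> X ` C) \<inter> edge_vars (W - C) = {}" using L(2) by (auto simp: edge_vars_def)
        show "Y w \<notin> L \<union> X ` C" using wL by auto
      qed
    qed
    have "is_ideal {a. Var (Y w) * a \<in> idl ?G1}"
      using is_idealD[OF I1] by (auto simp: is_ideal_def distrib_left mult.left_commute)
    then show "idl ?Q \<subseteq> {a. Var (Y w) * a \<in> idl ?G1}"
    proof (rule graph_gens_subset_idl[rotated 2])
      fix v assume "v \<in> L \<union> X ` C"
      then consider "v \<in> L" | "v = X w" | i where "v = X i" "i \<in> C" "i \<noteq> w" by auto
      then show "Var v \<in> {a. Var (Y w) * a \<in> idl ?G1}"
      proof cases
        case 1
        then show ?thesis using is_idealD(3)[OF I1 g1[OF Var_in_graph_gens]] by simp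
      next
        case 2
        then show ?thesis using is_idealD(3)[OF I1 idl_incl[of "Var (X w)" ?G1]] by simp
      next
        case 3
        then have "(i, w) \<in> clique_edges W cl" using w C by (auto simp: clique_edges_def)
        then have b: "edge_binom i w \<in> idl ?G1" by (intro g1 edge_binom_in_graph_gens)
        have x: "Var (Y i) * Var (X w) \<in> idl ?G1" by (intro is_idealD(3)[OF I1] idl_incl) simp
        have eq: "Var (Y w) * Var (X i) = edge_binom i w + Var (Y i) * Var (X w)"
          by (simp add: edge_binom_def algebra_simps)
        show ?thesis unfolding 3(1) mem_Collect_eq eq by (rule is_idealD(2)[OF I1 b x])
      qed
    next
      fix a b assume "(a, b) \<in> clique_edges (W - C) cl"
      then have "(a, b) \<in> clique_edges W cl" by (auto simp: clique_edges_def)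
      then have "edge_binom a b \<in> idl ?G1" by (intro g1 edge_binom_in_graph_gens)
      then show "edge_binom a b \<in> {a. Var (Y w) * a \<in> idl ?G1}" using is_idealD(3)[OF I1] by simp
    qed
  qed
  have "reg_le (idl ?G1) r"
  proof (rule reg_le_colon[OF hG1])
    show "Y w \<in> edge_vars V" using wV by simp
    show "reg_le (idl ?G2) r" unfolding e2 by (rule r1)
    show "reg_le {a. Var (Y w) * a \<in> idl ?G1} (r - 1)" unfolding e1 by (rule r2)
  qed
  then show ?thesis
  proof (rule reg_le_nonzerodivisor[OF hG, rotated])
    show "X w \<in> edge_vars V" using wV by simp
    show "a \<in> idl ?G" if "Var (X w) * a \<in> idl ?G" for a
      by (rule clique_variable_nonzerodivisor[OF fW L(2) wL(1) that])
  qed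
qed

lemma reg_le_cliques:
  assumes "W \<subseteq> V" "L \<subseteq> edge_vars V" "L \<inter> edge_vars W = {}" "int (card W) \<le> r + 1" "0 \<le> r"
  shows "reg_le (idl (graph_gens L (clique_edges W cl))) r"
  using assms
proof (induction "card W" arbitrary: W L r rule: less_induct)
  case less
  have fW: "finite W" using less(2) finV finite_subset by blast
  show ?case
  proof (cases "clique_edges W cl = {}")
    case True
    then show ?thesis using reg_le_mono[OF reg_le_variables[OF less(3)]] less(6)
      by (simp add: graph_gens_def edge_binoms_def)
  next
    case False
    then obtain w w' where ww: "(w, w') \<in> clique_edges W cl" by auto
    define C where "C = {i \<in> W. cl i = cl w}"
    have "{w, w'} \<subseteq> C" "w \<noteq> w'" "C \<subseteq> W" using ww by (auto simp: clique_edges_def C_def)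
    then have c2: "2 \<le> card C" using card_mono[of C "{w, w'}"] fW finite_subset[of C W] by auto
    have cW: "card (W - C) = card W - card C" "card C \<le> card W"
      using \<open>C \<subseteq> W\<close> fW by (auto intro: card_Diff_subset card_mono finite_subset)
    have wW: "w \<in> W" using ww by (simp add: clique_edges_def)
    then have "0 < card W" using fW card_gt_0_iff by blast
    then have c1: "card (W - {w}) = card W - 1" "card W - 1 < card W" using wW fW by simp_all
    show ?thesis
    proof (rule reg_le_clique_step[OF less(2,3,4) wW C_def])
      show "reg_le (idl (graph_gens (L \<union> {X w, Y w}) (clique_edges (W - {w}) cl))) r"
        using less(2-) c1 wW by (intro less(1)) (auto simp: edge_vars_def)
      show "reg_le (idl (graph_gens (L \<union> X ` C) (clique_edges (W - C) cl))) (r - 1)"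
        using less(2-) c2 cW \<open>C \<subseteq> W\<close> by (intro less(1)) (auto simp: edge_vars_def)
    qed
  qed
qed

text \<open>Removing the vertex \<open>a\<close> turns the bound $|W| - 2$ into the general one, $|W - a| - 1$; removing the whole component
gains at least three vertices.\<close>

lemma reg_le_cliques_triangle:
  assumes W: "W \<subseteq> V" and L: "L \<subseteq> edge_vars V" "L \<inter> edge_vars W = {}" and r: "int (card W) \<le> r + 2"
    and t: "(a, b) \<in> clique_edges W cl" "(a, c) \<in> clique_edges W cl" "b \<noteq> c"
  shows "reg_le (idl (graph_gens L (clique_edges W cl))) r"
proof -
  have fW: "finite W" using W finV finite_subset by blast
  define C where "C = {i \<in> W. cl i = cl a}"
  have C: "{a, b, c} \<subseteq> C" "C \<subseteq> W" "card {a, b, c} = 3" using t by (auto simp: clique_edges_def C_def)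
  then have c3: "3 \<le> card C" using card_mono[of C "{a, b, c}"] fW finite_subset[of C W] by auto
  have cW: "card (W - C) = card W - card C" "card C \<le> card W"
    using \<open>C \<subseteq> W\<close> fW by (auto intro: card_Diff_subset card_mono finite_subset)
  have aW: "a \<in> W" using t by (simp add: clique_edges_def)
  show ?thesis
  proof (rule reg_le_clique_step[OF W L aW C_def])
    show "reg_le (idl (graph_gens (L \<union> {X a, Y a}) (clique_edges (W - {a}) cl))) r"
      using W L r c3 cW aW fW by (intro reg_le_cliques) (auto simp: edge_vars_def)
    show "reg_le (idl (graph_gens (L \<union> X ` C) (clique_edges (W - C) cl))) (r - 1)"
      using W L r c3 cW C by (intro reg_le_cliques) (auto simp: edge_vars_def)
  qed
qed

end

text \<open>The edges of the graph called $G_v$ above.\<close>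

definition complete_nbhd :: "('w \<times> 'w) set \<Rightarrow> 'w \<Rightarrow> ('w \<times> 'w) set" where
  "complete_nbhd E v = E \<union> {(a, b). a \<noteq> b \<and> (v, a) \<in> E \<and> (v, b) \<in> E}"

definition del_vertex :: "('w \<times> 'w) set \<Rightarrow> 'w \<Rightarrow> ('w \<times> 'w) set" where
  "del_vertex E v = {(a, b) \<in> E. a \<noteq> v \<and> b \<noteq> v}"

lemma mult_idl_Var:
  assumes "h \<in> idl (Var ` W)" "is_ideal I" "\<And>w. w \<in> W \<Longrightarrow> Var w * q \<in> I"
  shows "h * q \<in> I"
  using assms(1)
proof induction
  case zero
  then show ?case by (simp add: is_idealD(1)[OF assms(2)])
next
  case (step g f c)
  then obtain w where "g = Var w" "w \<in> W" by auto
  then have "c * (g * q) \<in> I" using assms(3) by (simp add: is_idealD(3)[OF assms(2)])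
  from is_idealD(2)[OF assms(2) this step(3)] show ?case by (simp add: algebra_simps)
qed

lemma edge_vars_insert: "edge_vars (insert v T) = edge_vars T \<union> {X v, Y v}"
  by (auto simp: edge_vars_def)

lemma zero_vars_edge_binom_self:
  assumes "X a \<notin> W" "Y a \<notin> W" "X b \<notin> W" "Y b \<notin> W"
  shows "zero_vars W (edge_binom a b) = edge_binom a b"
  unfolding zero_vars_edge_binom zero_vars_Var using assms by (simp add: edge_binom_def)

context
  fixes T :: "'w set" and E :: "('w \<times> 'w) set" and v :: 'w and ty :: "'k::field itself"
  assumes E: "sym E" "irrefl E" "\<And>a b. (a, b) \<in> E \<Longrightarrow> a \<notin> T \<and> b \<notin> T" and vT: "v \<notin> T"
begin

abbreviation gens0 :: "('w edge_var, 'k) mpoly set" where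
  "gens0 \<equiv> graph_gens (edge_vars T) E"
abbreviation gens_cone :: "('w edge_var, 'k) mpoly set" where
  "gens_cone \<equiv> graph_gens (edge_vars T) (complete_nbhd E v)"
abbreviation gens_del :: "('w edge_var, 'k) mpoly set" where
  "gens_del \<equiv> graph_gens (edge_vars (insert v T)) (del_vertex E v)"
abbreviation gens_cone_del :: "('w edge_var, 'k) mpoly set" where
  "gens_cone_del \<equiv> graph_gens (edge_vars (insert v T)) (del_vertex (complete_nbhd E v) v)"

lemma edge_binom_v: "Var (X v) \<in> I \<Longrightarrow> Var (Y v) \<in> I \<Longrightarrow> is_ideal I \<Longrightarrow> a = v \<or> b = v \<Longrightarrow> edge_binom a b \<in> I"
  by (rule edge_binom_in_ideal) auto

text \<open>The Pluecker-type relation $x_v f_{ab} = x_a f_{vb} - x_b f_{va}$.\<close>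

lemma vertex_times_cone:
  assumes "(v, a) \<in> E" "(v, b) \<in> E" "w \<in> {X v, Y v}"
  shows "(Var w * edge_binom a b :: ('w edge_var, 'k) mpoly) \<in> idl gens0"
proof -
  note I = is_idealD[OF is_ideal_idl[of gens0]]
  have va: "edge_binom v a \<in> idl gens0" and vb: "edge_binom v b \<in> idl gens0" using assms by (auto intro: edge_binom_in_graph_gens)
  have eq: "(Var (X v) * edge_binom a b :: ('w edge_var, 'k) mpoly) = Var (X a) * edge_binom v b - Var (X b) * edge_binom v a"
    "(Var (Y v) * edge_binom a b :: ('w edge_var, 'k) mpoly) = Var (Y a) * edge_binom v b - Var (Y b) * edge_binom v a"
    by (simp_all add: edge_binom_def algebra_simps)
  have "Var (X v) * edge_binom a b \<in> idl gens0" "Var (Y v) * edge_binom a b \<in> idl gens0"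
    unfolding eq by (rule I(6)[OF I(3)[OF vb] I(3)[OF va]])+
  then show ?thesis using assms(3) by auto
qed

text \<open>For \<open>f\<close> in the intersection, $f = j + q$ with $j \in J_G$ and $q$ a combination of binomials $f_{ab}$ for
neighbours $a, b$ of $v$. The part of $q$ whose coefficients involve $x_v$ or $y_v$ lies in $J_G$ by the
preceding relation. Setting $x_v = y_v = 0$ maps both $f$ and $j$ into $J_{G-v}$, hence also the
remaining part of $q$.\<close>

lemma Ohtani_intersection: "idl gens0 = idl gens_cone \<inter> idl gens_del"
proof
  have "(edge_binom a b :: ('w edge_var, 'k) mpoly) \<in> idl gens_del" if "(a, b) \<in> E" for a b
  proof (cases "a = v \<or> b = v")
    case True
    then show ?thesis by (intro edge_binom_v is_ideal_idl Var_in_graph_gens) (auto simp: edge_vars_def)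
  next
    case False
    then show ?thesis using that by (intro edge_binom_in_graph_gens) (auto simp: del_vertex_def)
  qed
  then have "idl gens0 \<subseteq> idl gens_del"
    by (intro graph_gens_subset_idl is_ideal_idl) (auto intro!: Var_in_graph_gens simp: edge_vars_def)
  moreover have "idl gens0 \<subseteq> idl gens_cone" by (intro idl_mono graph_gens_mono) (auto simp: complete_nbhd_def)
  ultimately show "idl gens0 \<subseteq> idl gens_cone \<inter> idl gens_del" by blast
next
  show "idl gens_cone \<inter> idl gens_del \<subseteq> idl gens0"
  proof
    fix f assume f: "f \<in> idl gens_cone \<inter> idl gens_del"
    note I = is_idealD[OF is_ideal_idl[of gens0]]
    let ?C = "{(a, b). a \<noteq> b \<and> (v, a) \<in> E \<and> (v, b) \<in> E}"
    let ?W = "{X v, Y v}"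
    have gens_cone: "gens_cone = gens0 \<union> edge_binoms ?C" unfolding graph_gens_def edge_binoms_def complete_nbhd_def by blast
    have "f \<in> idl (gens0 \<union> edge_binoms ?C)" using f unfolding gens_cone[symmetric] by simp
    then obtain j q where j: "j \<in> idl gens0" and q: "q \<in> idl (edge_binoms ?C)" and fjq: "f = j + q"
      by (rule idl_Un)
    have q1: "q - zero_vars ?W q \<in> idl gens0"
      using q
    proof induction
      case zero
      then show ?case by (simp add: I(1))
    next
      case (step g q c)
      then obtain a b where ab: "g = edge_binom a b" "(v, a) \<in> E" "(v, b) \<in> E" by (auto simp: edge_binoms_def)
      then have "a \<noteq> v" "b \<noteq> v" using E(2) by (auto simp: irrefl_def)
      then have "zero_vars ?W g = g"
        unfolding ab(1) by (intro zero_vars_edge_binom_self) auto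
      then have eq: "(c * g + q) - zero_vars ?W (c * g + q) = (c - zero_vars ?W c) * g + (q - zero_vars ?W q)"
        by (simp add: zero_vars_add zero_vars_mult algebra_simps)
      have "(c - zero_vars ?W c) * g \<in> idl gens0"
        by (rule mult_idl_Var[OF diff_zero_vars_idl is_ideal_idl])
           (use vertex_times_cone[OF ab(2,3)] in \<open>simp add: ab(1)\<close>)
      then show ?case unfolding eq using step(3) by (rule I(2))
    qed
    have avJ: "(zero_vars ?W (edge_binom a b) :: ('w edge_var, 'k) mpoly) \<in> idl (graph_gens (edge_vars T) (del_vertex E v))" if "(a, b) \<in> E" for a b
    proof (cases "a = v \<or> b = v")
      case True
      then have "(zero_vars ?W (edge_binom a b) :: ('w edge_var, 'k) mpoly) = 0" by (auto simp: zero_vars_edge_binom zero_vars_Var)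
      then show ?thesis by (simp add: idl.zero)
    next
      case False
      then have eq: "(zero_vars ?W (edge_binom a b) :: ('w edge_var, 'k) mpoly) = edge_binom a b"
        by (intro zero_vars_edge_binom_self) auto
      show ?thesis unfolding eq using that False by (intro edge_binom_in_graph_gens) (simp add: del_vertex_def)
    qed
    have avT: "(zero_vars ?W (Var w) :: ('w edge_var, 'k) mpoly) \<in> idl (graph_gens (edge_vars T) (del_vertex E v))" if "w \<in> edge_vars (insert v T)" for w
      using that by (auto simp: zero_vars_Var idl.zero edge_vars_insert intro!: Var_in_graph_gens)
    have a1: "zero_vars ?W j \<in> idl (graph_gens (edge_vars T) (del_vertex E v))"
      by (rule zero_vars_idl[OF _ j]) (use avJ avT in \<open>auto simp: graph_gens_def edge_binoms_def edge_vars_insert\<close>)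
    have f2: "f \<in> idl gens_del" using f by simp
    have a2: "zero_vars ?W f \<in> idl (graph_gens (edge_vars T) (del_vertex E v))"
      by (rule zero_vars_idl[OF _ f2]) (use avJ avT in \<open>auto simp: graph_gens_def edge_binoms_def del_vertex_def\<close>)
    have "zero_vars ?W q = zero_vars ?W f - zero_vars ?W j" by (simp add: fjq zero_vars_add)
    then have "zero_vars ?W q \<in> idl (graph_gens (edge_vars T) (del_vertex E v))"
      using is_idealD(6)[OF is_ideal_idl a2 a1] by simp
    moreover have "idl (graph_gens (edge_vars T) (del_vertex E v)) \<subseteq> idl gens0"
      by (intro idl_mono graph_gens_mono) (auto simp: del_vertex_def)
    ultimately have "zero_vars ?W q \<in> idl gens0" by (rule subsetD[rotated])
    from I(2)[OF j I(2)[OF q1 this]] show "f \<in> idl gens0" by (simp add: fjq)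
  qed
qed

lemma Ohtani_sum: "idl (gens_cone \<union> gens_del) = idl gens_cone_del"
proof
  have 1: "(edge_binom a b :: ('w edge_var, 'k) mpoly) \<in> idl gens_cone_del" if "(a, b) \<in> complete_nbhd E v" for a b
  proof (cases "a = v \<or> b = v")
    case True
    then show ?thesis by (intro edge_binom_v is_ideal_idl Var_in_graph_gens) (auto simp: edge_vars_def)
  next
    case False
    then show ?thesis using that by (intro edge_binom_in_graph_gens) (auto simp: del_vertex_def)
  qed
  show "idl (gens_cone \<union> gens_del) \<subseteq> idl gens_cone_del"
  proof (rule idl_subset_idl)
    fix g assume "g \<in> gens_cone \<union> gens_del"
    then consider w where "g = Var w" "w \<in> edge_vars (insert v T)" | a b where "g = edge_binom a b" "(a, b) \<in> complete_nbhd E v"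
      by (auto simp: graph_gens_def edge_binoms_def edge_vars_insert del_vertex_def complete_nbhd_def)
    then show "g \<in> idl gens_cone_del" by cases (auto intro: 1 Var_in_graph_gens)
  qed
  show "idl gens_cone_del \<subseteq> idl (gens_cone \<union> gens_del)"
    by (rule idl_mono) (auto simp: graph_gens_def edge_binoms_def del_vertex_def)
qed

end

context graph_koszul
begin

lemma reg_le_Ohtani:
  assumes TV: "insert v T \<subseteq> V" and vT: "v \<notin> T"
    and E: "sym E" "irrefl E" "E \<subseteq> (V - T) \<times> (V - T)"
    and r: "reg_le (idl (graph_gens (edge_vars T) (complete_nbhd E v))) r"
      "reg_le (idl (graph_gens (edge_vars (insert v T)) (del_vertex E v))) r"
      "reg_le (idl (graph_gens (edge_vars (insert v T)) (del_vertex (complete_nbhd E v) v))) (r - 1)"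
  shows "reg_le (idl (graph_gens (edge_vars T) E)) r"
proof -
  have ET: "a \<notin> T \<and> b \<notin> T" if "(a, b) \<in> E" for a b using that E(3) by blast
  have c: "complete_nbhd E v \<subseteq> V \<times> V" "del_vertex E v \<subseteq> V \<times> V"
    using E(3) by (auto simp: complete_nbhd_def del_vertex_def)
  have l: "edge_vars T \<subseteq> edge_vars V" "edge_vars (insert v T) \<subseteq> edge_vars V"
    using TV by (auto simp: edge_vars_def)
  have "reg_le (idl (graph_gens (edge_vars T) (complete_nbhd E v)) \<inter> idl (graph_gens (edge_vars (insert v T)) (del_vertex E v))) r"
  proof (rule reg_le_inter)
    show "reg_le (idl (graph_gens (edge_vars T) (complete_nbhd E v) \<union> graph_gens (edge_vars (insert v T)) (del_vertex E v))) (r - 1)"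
      by (simp only: Ohtani_sum[OF E(1,2) ET vT] r(3))
  qed (use r homgen_graph_gens[OF l(1) c(1)] homgen_graph_gens[OF l(2) c(2)] in auto)
  then show ?thesis by (simp only: Ohtani_intersection[OF E(1,2) ET vT])
qed

definition triangle :: "('w \<times> 'w) set \<Rightarrow> bool" where
  "triangle E \<longleftrightarrow> (\<exists>a b c. (a, b) \<in> E \<and> (a, c) \<in> E \<and> (b, c) \<in> E)"

text \<open>Both bounds are proved by one induction on the number of pairs that are not edges. For a vertex $v$
with two non-adjacent neighbours, completing the neighbourhood adds an edge, and deleting $v$ removes the
pair $(v, v)$. A triangle survives in $G_v - v$: if $v$ belongs to it, then a third neighbour of $v$
replaces $v$. If there is no such vertex $v$, then adjacency is transitive and the components are complete.\<close>

lemma reg_le_graph: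
  assumes "T \<subseteq> V" "sym E" "irrefl E" "E \<subseteq> (V - T) \<times> (V - T)"
    and "int (card (V - T)) \<le> r + 1 \<and> 0 \<le> r \<or> triangle E \<and> int (card (V - T)) \<le> r + 2"
  shows "reg_le (idl (graph_gens (edge_vars T) E)) r"
  using assms
proof (induction "card ((V - T) \<times> (V - T) - E)" arbitrary: T E r rule: less_induct)
  case (less T E r)
  have fin: "finite ((V - T) \<times> (V - T) - E)" using finV by simp
  show ?case
  proof (cases "\<exists>v a b. (v, a) \<in> E \<and> (v, b) \<in> E \<and> a \<noteq> b \<and> (a, b) \<notin> E")
    case True
    then obtain v a b where v: "(v, a) \<in> E" "(v, b) \<in> E" "a \<noteq> b" "(a, b) \<notin> E" by blast
    have vV: "v \<in> V" "v \<notin> T" "a \<in> V - T" "b \<in> V - T" using v less(5) by auto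
    have va: "v \<noteq> a" "v \<noteq> b" using v less(4) by (auto simp: irrefl_def)
    let ?c = "complete_nbhd E v" and ?T = "insert v T"
    have TV: "?T \<subseteq> V" using vV less(2) by simp
    have symc: "sym ?c" "irrefl ?c" using less(3,4) by (auto simp: sym_def irrefl_def complete_nbhd_def)
    have symd: "sym (del_vertex F v)" "irrefl (del_vertex F v)" "del_vertex F v \<subseteq> (V - ?T) \<times> (V - ?T)"
      if "sym F" "irrefl F" "F \<subseteq> (V - T) \<times> (V - T)" for F
      using that by (auto simp: sym_def irrefl_def del_vertex_def)
    have subc: "?c \<subseteq> (V - T) \<times> (V - T)" using less(5) by (auto simp: complete_nbhd_def)
    have cT: "int (card (V - ?T)) = int (card (V - T)) - 1"
    proof -
      have "V - ?T = (V - T) - {v}" by auto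
      then show ?thesis using card_remove[of v "V - T"] vV finV by simp
    qed
    have lt: "card ((V - ?T) \<times> (V - ?T) - F) < card ((V - T) \<times> (V - T) - E)"
      if "del_vertex E v \<subseteq> F" for F
    proof (rule psubset_card_mono[OF fin])
      have "(V - ?T) \<times> (V - ?T) - F \<subseteq> (V - T) \<times> (V - T) - E"
        using that by (auto simp: del_vertex_def)
      moreover have "(v, v) \<in> (V - T) \<times> (V - T) - E" using vV less(4) by (auto simp: irrefl_def)
      ultimately show "(V - ?T) \<times> (V - ?T) - F \<subset> (V - T) \<times> (V - T) - E" by auto
    qed
    show ?thesis
    proof (rule reg_le_Ohtani[OF TV vV(2) less(3,4,5)])
      show "reg_le (idl (graph_gens (edge_vars T) ?c)) r"
      proof (rule less(1)[OF _ less(2) symc subc])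
        have "(V - T) \<times> (V - T) - ?c \<subset> (V - T) \<times> (V - T) - E"
          using v vV by (auto simp: complete_nbhd_def)
        then show "card ((V - T) \<times> (V - T) - ?c) < card ((V - T) \<times> (V - T) - E)"
          by (rule psubset_card_mono[OF fin])
        show "int (card (V - T)) \<le> r + 1 \<and> 0 \<le> r \<or> triangle ?c \<and> int (card (V - T)) \<le> r + 2"
          using less(6) unfolding triangle_def complete_nbhd_def by blast
      qed
      have n3: "{v, a, b} \<subseteq> V - T" "card {v, a, b} = 3" using v(3) vV va by auto
      then have "3 \<le> card (V - T)" using card_mono[of "V - T" "{v, a, b}"] finV by simp
      then have r1: "1 \<le> r" using less(6) by auto
      show "reg_le (idl (graph_gens (edge_vars ?T) (del_vertex E v))) r"
        using less(6) cT r1 by (intro less(1)[OF lt TV symd[OF less(3,4,5)]]) auto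
      show "reg_le (idl (graph_gens (edge_vars ?T) (del_vertex ?c v))) (r - 1)"
      proof (rule less(1)[OF lt TV symd[OF symc subc]])
        show "del_vertex E v \<subseteq> del_vertex ?c v" by (auto simp: del_vertex_def complete_nbhd_def)
        have "triangle (del_vertex ?c v)" if tri: "triangle E"
        proof -
          obtain x y z where t: "(x, y) \<in> E" "(x, z) \<in> E" "(y, z) \<in> E" using tri by (auto simp: triangle_def)
          have sy: "(q, p) \<in> E" if "(p, q) \<in> E" for p q using that less(3) by (auto simp: sym_def)
          have ne: "p \<noteq> q" if "(p, q) \<in> E" for p q using that less(4) by (auto simp: irrefl_def)
          have key: ?thesis if pq: "(v, p) \<in> E" "(v, q) \<in> E" "(p, q) \<in> E" for p q
          proof -
            obtain s where s: "(v, s) \<in> E" "s \<noteq> p" "s \<noteq> q"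
              using v pq sy by metis
            have "(p, q) \<in> del_vertex ?c v" "(p, s) \<in> del_vertex ?c v" "(q, s) \<in> del_vertex ?c v"
              using pq s ne[OF pq(1)] ne[OF pq(2)] ne[OF s(1)] by (auto simp: del_vertex_def complete_nbhd_def)
            then show ?thesis unfolding triangle_def by blast
          qed
          consider "v = x" | "v = y" | "v = z" | "v \<noteq> x" "v \<noteq> y" "v \<noteq> z" by blast
          then show ?thesis
          proof cases
            case 1 then show ?thesis using key[of y z] t by simp
          next
            case 2 then show ?thesis using key[of x z] t sy by simp
          next
            case 3 then show ?thesis using key[of x y] t sy by simp
          next
            case 4
            then have "(x, y) \<in> del_vertex ?c v" "(x, z) \<in> del_vertex ?c v" "(y, z) \<in> del_vertex ?c v"
              using t by (auto simp: del_vertex_def complete_nbhd_def)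
            then show ?thesis unfolding triangle_def by blast
          qed
        qed
        then show "int (card (V - ?T)) \<le> r - 1 + 1 \<and> 0 \<le> r - 1 \<or>
            triangle (del_vertex ?c v) \<and> int (card (V - ?T)) \<le> r - 1 + 2"
          using less(6) cT r1 by auto
      qed
    qed
  next
    case False
    define cl where "cl = (\<lambda>i. {j. j = i \<or> (i, j) \<in> E})"
    have sy: "(q, p) \<in> E" if "(p, q) \<in> E" for p q using that less(3) by (auto simp: sym_def)
    have tr: "(a, b) \<in> E" if "(v, a) \<in> E" "(v, b) \<in> E" "a \<noteq> b" for v a b using that False by blast
    have ne: "p \<noteq> q" if "(p, q) \<in> E" for p q using that less(4) by (auto simp: irrefl_def)
    have cleq: "cl p = cl q \<longleftrightarrow> p = q \<or> (p, q) \<in> E" for p q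
    proof
      assume "cl p = cl q"
      then have "q \<in> cl p" by (simp add: cl_def)
      then show "p = q \<or> (p, q) \<in> E" by (auto simp: cl_def)
    next
      have 1: "cl p \<subseteq> cl q" if "(p, q) \<in> E" for p q
      proof
        fix j assume "j \<in> cl p"
        then have "j = p \<or> (p, j) \<in> E" by (auto simp: cl_def)
        then show "j \<in> cl q" using sy[OF that] tr[OF that, of j] by (auto simp: cl_def)
      qed
      assume "p = q \<or> (p, q) \<in> E"
      then show "cl p = cl q" using 1 sy by blast
    qed
    have Ecl: "E = clique_edges (V - T) cl"
      using less(5) ne by (auto simp: clique_edges_def cleq)
    have W: "V - T \<subseteq> V" "edge_vars T \<subseteq> edge_vars V" "edge_vars T \<inter> edge_vars (V - T) = {}"
      using less(2) by (auto simp: edge_vars_def)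
    show ?thesis
    proof (cases "int (card (V - T)) \<le> r + 1 \<and> 0 \<le> r")
      case True
      then have rr: "int (card (V - T)) \<le> r + 1" "0 \<le> r" by auto
      show ?thesis unfolding Ecl by (rule reg_le_cliques[OF W rr])
    next
      case no: False
      then have "triangle E" and c: "int (card (V - T)) \<le> r + 2" using less(6) by auto
      then obtain x y z where t: "(x, y) \<in> E" "(x, z) \<in> E" "(y, z) \<in> E" by (auto simp: triangle_def)
      show ?thesis unfolding Ecl
        by (rule reg_le_cliques_triangle[OF W c]) (use t ne[OF t(3)] Ecl in auto)
    qed
  qed
qed

end

section \<open>The lower bound: induced paths\<close>

definition path_gens :: "(nat \<Rightarrow> 'w) \<Rightarrow> nat \<Rightarrow> ('w edge_var, 'k::field) mpoly set" where
  "path_gens p k = {edge_binom (p i) (p (Suc i)) | i. i < k}"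

lemma path_gens_Suc: "path_gens p (Suc k) = insert (edge_binom (p k) (p (Suc k))) (path_gens p k)"
  unfolding path_gens_def using less_Suc_eq by auto

lemma zero_vars_single_decompose: "f = Var v * div_var v f + zero_vars {v} f"
  using div_var_decompose[of f v] by (simp add: zero_vars_def)

lemma path_gens_new:
  assumes "inj_on p {..Suc k}" "g \<in> path_gens p k" "m \<in> mkeys g"
  shows "X (p (Suc k)) \<notin> mkeys m" "Y (p (Suc k)) \<notin> mkeys m"
proof -
  obtain i where i: "i < k" "g = edge_binom (p i) (p (Suc i))" using assms(2) unfolding path_gens_def by blast
  have "mkeys m \<subseteq> {X (p i), X (p (Suc i)), Y (p i), Y (p (Suc i))}"
    using assms(3) unfolding i(2) by (rule edge_binom_keys)
  moreover have "p (Suc k) \<noteq> p i" "p (Suc k) \<noteq> p (Suc i)"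
    using inj_onD[OF assms(1)] i(1) by fastforce+
  ultimately show "X (p (Suc k)) \<notin> mkeys m" "Y (p (Suc k)) \<notin> mkeys m" by auto
qed

lemma zero_vars_path_gens:
  assumes "inj_on p {..Suc k}" "f \<in> idl (path_gens p k)"
  shows "zero_vars {X (p (Suc k))} f \<in> idl (path_gens p k)"
proof (rule zero_vars_idl[OF _ assms(2)])
  fix g :: "('a edge_var, 'b) mpoly" assume g: "g \<in> path_gens p k"
  have "zero_vars {X (p (Suc k))} g = g"
    unfolding zero_vars_def by (rule restr_self) (use path_gens_new[OF assms(1) g] in auto)
  then show "zero_vars {X (p (Suc k))} g \<in> idl (path_gens p k)" using idl_incl[OF g] by simp
qed

lemma zero_vars_last_edge:
  assumes "inj_on p {..Suc k}"
  shows "zero_vars {X (p (Suc k))} (edge_binom (p k) (p (Suc k))) = Var (Y (p (Suc k))) * Var (X (p k))"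
proof -
  have "p k \<noteq> p (Suc k)" using inj_onD[OF assms, of k "Suc k"] by auto
  then show ?thesis by (simp add: zero_vars_edge_binom zero_vars_Var)
qed

text \<open>By induction on the length. If $x_{k+1} r = s f_k + i$ with $f_k = x_k y_{k+1} - x_{k+1} y_k$, then setting $x_{k+1} = 0$
shows that $y_{k+1} x_k s_0$ lies in the ideal of the shorter path, where $s_0$ is the part of $s$ without
$x_{k+1}$. Here $y_{k+1}$ does not occur in that ideal and $x_k$ is a nonzerodivisor by induction, so $s_0$ belongs
to it, and $x_{k+1}$ can be cancelled from the rest.\<close>

lemma path_end_nonzerodivisor:
  assumes "inj_on p {..k}" "Var (X (p k)) * r \<in> idl (path_gens p k)"
  shows "r \<in> idl (path_gens p k)"
  using assms
proof (induction k arbitrary: r)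
  case 0
  from 0(2) show ?case by (rule idl_new_variable[rotated]) (simp add: path_gens_def)
next
  case (Suc k r)
  let ?x = "X (p (Suc k))" and ?y = "Y (p (Suc k))"
  let ?f = "edge_binom (p k) (p (Suc k)) :: ('a edge_var, 'b) mpoly" and ?I = "idl (path_gens p k)"
  note I = is_idealD[OF is_ideal_idl[of "path_gens p k :: ('a edge_var, 'b) mpoly set"]]
  have inj: "inj_on p {..k}" using Suc.prems(1) by (rule inj_on_subset) auto
  obtain s i where i: "i \<in> ?I" and s: "Var ?x * r = s * ?f + i"
    using Suc.prems(2) unfolding path_gens_Suc by (rule idl_insert)
  define s0 where "s0 = zero_vars {?x} s"
  define s1 where "s1 = div_var ?x s"
  have s01: "s = Var ?x * s1 + s0" unfolding s0_def s1_def by (rule zero_vars_single_decompose)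
  have "zero_vars {?x} (Var ?x * r) = 0" by (simp add: zero_vars_mult zero_vars_Var)
  then have "Var ?y * (Var (X (p k)) * s0) = - zero_vars {?x} i"
    unfolding s zero_vars_add zero_vars_mult zero_vars_last_edge[OF Suc.prems(1)] s0_def[symmetric]
    by (simp add: eq_neg_iff_add_eq_0 ac_simps)
  then have "Var ?y * (Var (X (p k)) * s0) \<in> ?I" using I(5)[OF zero_vars_path_gens[OF Suc.prems(1) i]] by simp
  then have "Var (X (p k)) * s0 \<in> ?I"
    by (rule idl_new_variable[rotated]) (rule path_gens_new(2)[OF Suc.prems(1)])
  then have s0: "s0 \<in> ?I" by (rule Suc.IH[OF inj])
  have "Var ?x * (r - s1 * ?f) = i + s0 * ?f"
    using s unfolding s01 by (simp add: algebra_simps)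
  also have "\<dots> \<in> ?I" using I(2)[OF i I(4)[OF s0]] .
  finally have "r - s1 * ?f \<in> ?I"
    by (rule idl_new_variable[rotated]) (rule path_gens_new(1)[OF Suc.prems(1)])
  then have "r - s1 * ?f \<in> idl (path_gens p (Suc k))"
    using idl_mono[of "path_gens p k" "path_gens p (Suc k)"] unfolding path_gens_Suc by blast
  moreover have "s1 * ?f \<in> idl (path_gens p (Suc k))"
    unfolding path_gens_Suc by (intro is_idealD(3)[OF is_ideal_idl] idl_incl) simp
  ultimately have "(r - s1 * ?f) + s1 * ?f \<in> idl (path_gens p (Suc k))"
    by (rule is_idealD(2)[OF is_ideal_idl])
  then show ?case by simp
qed

text \<open>Setting $x_{k+1} = 0$ in $f_k a$ leaves $y_{k+1} x_k a_0$, so the part $a_0$ of $a$ without $x_{k+1}$ lies in the ideal.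
The other part is divisible by $x_{k+1}$ and has a smaller degree in it after division.\<close>

lemma path_edge_nonzerodivisor:
  assumes "inj_on p {..Suc k}" "edge_binom (p k) (p (Suc k)) * a \<in> idl (path_gens p k)"
  shows "a \<in> idl (path_gens p k)"
proof -
  let ?x = "X (p (Suc k))" and ?y = "Y (p (Suc k))"
  let ?f = "edge_binom (p k) (p (Suc k)) :: ('a edge_var, 'b) mpoly" and ?I = "idl (path_gens p k)"
  note I = is_idealD[OF is_ideal_idl[of "path_gens p k :: ('a edge_var, 'b) mpoly set"]]
  have inj: "inj_on p {..k}" using assms(1) by (rule inj_on_subset) auto
  have *: "a \<in> ?I" if "\<forall>m\<in>mkeys a. lkp m ?x < n" "?f * a \<in> ?I" for n a
    using that
  proof (induction n arbitrary: a)
    case 0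
    then have "mkeys a = {}" by (auto simp del: keys_eq_empty)
    then show ?case by (simp add: I(1))
  next
    case (Suc n a)
    define a0 where "a0 = zero_vars {?x} a"
    define a1 where "a1 = div_var ?x a"
    have a01: "a = Var ?x * a1 + a0" unfolding a0_def a1_def by (rule zero_vars_single_decompose)
    have "zero_vars {?x} (?f * a) \<in> ?I" by (rule zero_vars_path_gens[OF assms(1) Suc.prems(2)])
    then have "Var ?y * (Var (X (p k)) * a0) \<in> ?I"
      unfolding zero_vars_mult zero_vars_last_edge[OF assms(1)] a0_def by (simp add: ac_simps)
    then have "Var (X (p k)) * a0 \<in> ?I"
      by (rule idl_new_variable[rotated]) (rule path_gens_new(2)[OF assms(1)])
    then have a0: "a0 \<in> ?I" by (rule path_end_nonzerodivisor[OF inj])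
    have "Var ?x * (?f * a1) = ?f * a - ?f * a0" unfolding a01 by (simp add: algebra_simps)
    also have "\<dots> \<in> ?I" by (rule I(6)[OF Suc.prems(2) I(3)[OF a0]])
    finally have fa1: "?f * a1 \<in> ?I"
      by (rule idl_new_variable[rotated]) (rule path_gens_new(1)[OF assms(1)])
    have "\<forall>m\<in>mkeys a1. lkp m ?x < n"
    proof
      fix m assume "m \<in> mkeys a1"
      then have "m + sgl ?x 1 \<in> mkeys a" by (simp add: a1_def in_keys_iff lookup_div_var)
      then have "lkp (m + sgl ?x 1) ?x < Suc n" using Suc.prems(1) by metis
      then show "lkp m ?x < n" by (simp add: lookup_add)
    qed
    then have "a1 \<in> ?I" using fa1 by (rule Suc.IH)
    then show ?case unfolding a01 by (intro I(2)[OF I(3) a0])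
  qed
  have "\<forall>m\<in>mkeys a. lkp m ?x < Suc (Max ((\<lambda>m. lkp m ?x) ` mkeys a))"
    by (simp add: less_Suc_eq_le)
  then show ?thesis using assms(2) by (rule *)
qed

context graph_koszul
begin

lemma koszul_vanish_base: "\<not> tor_vanish (idl {}) 0 0"
proof
  assume *: "tor_vanish (idl {}) 0 0"
  define z where "z = (\<lambda>T::nat set. (1 :: ('w edge_var, 'k) mpoly))"
  have z: "koszul_chain N (forms (edge_vars V)) 0 0 z" by (auto simp: koszul_chain_def z_def forms_def)
  have dz: "koszul_chain N (\<lambda>i. idl {} \<inter> forms (edge_vars V) i) (0 - 1) 0 (koszul_d (mult_var e) N z)" by (auto simp: koszul_chain_def)
  obtain w where w: "koszul_chain N (forms (edge_vars V)) (0 + 1) 0 w"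
    and u: "koszul_chain N (\<lambda>i. idl {} \<inter> forms (edge_vars V) i) 0 0 (\<lambda>T. z T - koszul_d (mult_var e) N w T)"
    using K.koszul_vanishD[OF * z dz] .
  have "w {v} = 0" if "v < N" for v
    using kcD[OF w, of "{v}"] that forms_neg[of "-1"] by simp
  then have "koszul_d (mult_var e) N w {} = 0" by (simp add: koszul_d_empty mult_var_def)
  moreover have "z {} - koszul_d (mult_var e) N w {} = 0"
    using kcD[OF u, of "{}"] by (simp add: idl_empty)
  ultimately show False by (simp add: z_def)
qed

text \<open>Adding one edge at a time shifts the nonvanishing homology by $(1, 2)$, beginning with $H_0(S)_0 = K$.\<close>

lemma koszul_vanish_path:
  assumes "inj_on p {..k}" "p ` {..k} \<subseteq> V"
  shows "\<not> tor_vanish (idl (path_gens p k)) (int k) (2 * int k)"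
  using assms
proof (induction k)
  case 0
  then show ?case using koszul_vanish_base by (simp add: path_gens_def)
next
  case (Suc k)
  let ?f = "edge_binom (p k) (p (Suc k)) :: ('w edge_var, 'k) mpoly"
  have inj: "inj_on p {..k}" using Suc.prems(1) by (rule inj_on_subset) auto
  have V: "p ` {..k} \<subseteq> V" "p k \<in> V" "p (Suc k) \<in> V" using Suc.prems(2) by auto
  show ?case
  proof
    assume *: "tor_vanish (idl (path_gens p (Suc k))) (int (Suc k)) (2 * int (Suc k))"
    obtain u where u: "u < N" "e u = X (p k)"
      using bij V by (auto simp: bij_betw_def) (metis imageE in_edge_vars(1) lessThan_iff)
    obtain u' where u': "u' < N" "e u' = X (p (Suc k))"
      using bij V by (auto simp: bij_betw_def) (metis imageE in_edge_vars(1) lessThan_iff)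
    have "tor_vanish (idl (path_gens p k)) (int k) (2 * int k)"
    proof (rule koszul_vanish_of_nonzerodivisor_ideal)
      show "homgen (path_gens p k :: ('w edge_var, 'k) mpoly set)"
      proof
        fix g :: "('w edge_var, 'k) mpoly" assume "g \<in> path_gens p k"
        then obtain i where i: "i < k" "g = edge_binom (p i) (p (Suc i))" by (auto simp: path_gens_def)
        then have "p i \<in> V" "p (Suc i) \<in> V" using V(1) by auto
        then show "\<exists>d. g \<in> forms (edge_vars V) d" using edge_binom_forms[of "p i" V "p (Suc i)"] i(2) by auto
      qed
      show "?f \<in> forms (edge_vars V) 2" by (rule edge_binom_forms[OF V(2,3)])
      show "?f = Var (Y (p (Suc k))) * Var (e u) + (- Var (Y (p k))) * Var (e u')"
        by (simp add: edge_binom_def u u' ac_simps)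
      show "Var (Y (p (Suc k))) \<in> forms (edge_vars V) (2 - 1)" "- Var (Y (p k)) \<in> forms (edge_vars V) (2 - 1)"
        using Var_forms[of "Y (p (Suc k))" "edge_vars V"] forms_uminus[OF Var_forms[of "Y (p k)" "edge_vars V"]] V by auto
      show "a \<in> idl (path_gens p k)" if "?f * a \<in> idl (path_gens p k)" for a
        by (rule path_edge_nonzerodivisor[OF Suc.prems(1) that])
      show "tor_vanish (idl (insert ?f (path_gens p k))) (int k + 1) (2 * int k + 2)"
        using * by (simp add: path_gens_Suc add.commute)
    qed (rule u, rule u')
    then show False using Suc.IH[OF inj V(1)] by simp
  qed
qed

end

text \<open>Extending chains by zero and then setting the variables outside \<open>A'\<close> to zero is the identity on the
Koszul complex of $K[A']$. The variables of \<open>A'\<close> come first in the numbering, so that this complex is an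
initial stage of the recursion for the larger one.\<close>

lemma koszul_vanish_restrict:
  fixes I I' :: "('v, 'k::field) mpoly set"
  assumes A: "poly_koszul A e N" and N': "N' \<le> N" and A': "e ` {..<N'} = A'"
    and II: "\<And>f. f \<in> I \<Longrightarrow> zero_vars (UNIV - A') f \<in> I'" "I' \<subseteq> I" and I: "is_ideal I"
    and v: "koszul_vanish (mult_var e) N (forms A) (\<lambda>i. I \<inter> forms A i) p j"
  shows "koszul_vanish (mult_var e) N' (forms A') (\<lambda>i. I' \<inter> forms A' i) p j"
proof -
  interpret poly_koszul A e N "TYPE('k)" by (rule A)
  let ?x = "mult_var e :: nat \<Rightarrow> ('v, 'k) mpoly \<Rightarrow> _"
  let ?r = "zero_vars (UNIV - A') :: ('v, 'k) mpoly \<Rightarrow> _"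
  have AA: "A' \<subseteq> A" using A' bij N' by (auto simp: bij_betw_def)
  have eN: "e n \<notin> A'" if "N' \<le> n" "n < N" for n
    using that e_eq N' unfolding A'[symmetric] by force
  have rHA: "?r f \<in> forms A' i" if "f \<in> forms A i" for f i
    using that by (auto simp: forms_def zero_vars_def keys_restr)
  have rself: "?r f = f" if "f \<in> forms A' i" for f i
    unfolding zero_vars_def by (rule restr_self) (use that in \<open>auto simp: forms_def\<close>)
  have sub: "T \<subseteq> {..<N}" if "T \<subseteq> {..<N'}" for T using that N' by auto
  have kdr: "?r (koszul_d ?x n w T) = koszul_d ?x N' (\<lambda>T. ?r (w T)) T"
    if n: "N' \<le> n" "n \<le> N" and T: "T \<subseteq> {..<N'}" for n w T
    using n
  proof (induction n rule: dec_induct)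
    case base
    show ?case
      by (rule koszul_d_hom) (auto simp: zero_vars_diff zero_vars_mult zero_vars_Var mult_var_def A'[symmetric])
  next
    case (step n)
    have "n \<notin> T" using T step by auto
    moreover have "?r (mult_var e n f) = 0" for f using eN[of n] step by (simp add: mult_var_def zero_vars_mult zero_vars_Var)
    ultimately show ?case using step by (simp add: zero_vars_add)
  qed
  show ?thesis
  proof (rule K.koszul_vanishI)
    fix z assume z: "koszul_chain N' (forms A') p j z" and dz: "koszul_chain N' (\<lambda>i. I' \<inter> forms A' i) (p - 1) j (koszul_d ?x N' z)"
    define y where "y = (\<lambda>T. if T \<subseteq> {..<N'} then z T else 0)"
    have kdy: "koszul_d ?x n y T = (if T \<subseteq> {..<N'} then koszul_d ?x N' z T else 0)"
      if n: "N' \<le> n" and T: "T \<subseteq> {..<n}" for n T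
      using n T
    proof (induction n arbitrary: T rule: dec_induct)
      case base
      have "koszul_d ?x N' y T = koszul_d ?x N' z T" by (rule koszul_d_cong[OF base]) (simp add: y_def)
      then show ?case using base by simp
    next
      case (step n)
      have y0: "y (insert n T') = 0" for T' using step by (auto simp: y_def)
      show ?case
      proof (cases "n \<in> T")
        case True
        then have "\<not> T \<subseteq> {..<N'}" using step by auto
        then show ?thesis using True by (simp add: y0 K.koszul_d_zero)
      next
        case False
        then have "T \<subseteq> {..<n}" using step.prems by (auto simp: less_Suc_eq)
        then show ?thesis using False step.IH by (simp add: y0)
      qed
    qed
    have y: "koszul_chain N (forms A) p j y"
      using kcD[OF z] forms_mono[OF AA] by (auto simp: koszul_chain_def y_def)
    have dy: "koszul_chain N (\<lambda>i. I \<inter> forms A i) (p - 1) j (koszul_d ?x N y)"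
      unfolding koszul_chain_def
    proof (intro allI impI)
      fix T assume T: "T \<subseteq> {..<N}" "int (card T) = p - 1"
      show "koszul_d ?x N y T \<in> I \<inter> forms A (j - (p - 1))"
      proof (cases "T \<subseteq> {..<N'}")
        case True
        then show ?thesis using kcD[OF dz True T(2)] II(2) forms_mono[OF AA] by (auto simp: kdy[OF N' T(1)])
      next
        case False
        then show ?thesis using is_idealD(1)[OF I] by (simp add: kdy[OF N' T(1)])
      qed
    qed
    obtain w where w: "koszul_chain N (forms A) (p + 1) j w" and u: "koszul_chain N (\<lambda>i. I \<inter> forms A i) p j (\<lambda>T. y T - koszul_d ?x N w T)"
      using K.koszul_vanishD[OF v y dy] .
    have "koszul_chain N' (forms A') (p + 1) j (\<lambda>T. ?r (w T))"
      unfolding koszul_chain_def using kcD[OF w] rHA sub by blast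
    moreover have "koszul_chain N' (\<lambda>i. I' \<inter> forms A' i) p j (\<lambda>T. z T - koszul_d ?x N' (\<lambda>T. ?r (w T)) T)"
      unfolding koszul_chain_def
    proof (intro allI impI)
      fix T assume T: "T \<subseteq> {..<N'}" "int (card T) = p"
      have u': "y T - koszul_d ?x N w T \<in> I \<inter> forms A (j - p)" using kcD[OF u sub[OF T(1)] T(2)] .
      have "?r (y T - koszul_d ?x N w T) = z T - koszul_d ?x N' (\<lambda>T. ?r (w T)) T"
        using T rself[OF kcD[OF z T]] by (simp add: zero_vars_diff kdr[OF N' order_refl T(1)] y_def)
      then show "z T - koszul_d ?x N' (\<lambda>T. ?r (w T)) T \<in> I' \<inter> forms A' (j - p)"
        using u' II(1) rHA by (metis IntD1 IntD2 IntI)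
    qed
    ultimately show "\<exists>w. koszul_chain N' (forms A') (p + 1) j w \<and> koszul_chain N' (\<lambda>i. I' \<inter> forms A' i) p j (\<lambda>T. z T - koszul_d ?x N' w T)"
      by blast
  qed
qed

lemma (in graph_koszul) koszul_vanish_induced_path:
  assumes p: "inj_on p {..k}" "p ` {..k} \<subseteq> V"
    and N': "N' \<le> N" "e ` {..<N'} = edge_vars (p ` {..k})"
    and E: "\<And>i. i < k \<Longrightarrow> (p i, p (Suc i)) \<in> E"
      "\<And>i j. i \<le> k \<Longrightarrow> j \<le> k \<Longrightarrow> (p i, p j) \<in> E \<Longrightarrow> j = Suc i \<or> i = Suc j"
  shows "\<not> tor_vanish (idl (graph_gens {} E)) (int k) (2 * int k)"
proof
  assume *: "tor_vanish (idl (graph_gens {} E)) (int k) (2 * int k)"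
  let ?P = "p ` {..k}"
  have b': "bij_betw e {..<N'} (edge_vars ?P)"
    using bij N' by (auto simp: bij_betw_def intro: inj_on_subset)
  interpret P: graph_koszul ?P e N' "TYPE('k)" by unfold_locales (use b' in auto)
  have "koszul_vanish (mult_var e) N' (forms (edge_vars ?P)) (\<lambda>i. idl (path_gens p k) \<inter> forms (edge_vars ?P) i :: ('w edge_var, 'k) mpoly set) (int k) (2 * int k)"
  proof (rule koszul_vanish_restrict[OF _ N' _ _ is_ideal_idl *])
    show "poly_koszul (edge_vars V) e N" by (rule poly_koszul_axioms)
    show "idl (path_gens p k) \<subseteq> (idl (graph_gens {} E) :: ('w edge_var, 'k) mpoly set)"
      using E(1) by (intro idl_mono) (auto simp: path_gens_def graph_gens_def edge_binoms_def)
    show "zero_vars (UNIV - edge_vars ?P) f \<in> idl (path_gens p k)" if "f \<in> idl (graph_gens {} E)" for f :: "('w edge_var, 'k) mpoly"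
    proof (rule zero_vars_idl[OF _ that])
      fix g :: "('w edge_var, 'k) mpoly" assume "g \<in> graph_gens {} E"
      then obtain a b where ab: "g = edge_binom a b" "(a, b) \<in> E" by (auto simp: graph_gens_def edge_binoms_def)
      show "zero_vars (UNIV - edge_vars ?P) g \<in> idl (path_gens p k)"
      proof (cases "a \<in> ?P \<and> b \<in> ?P")
        case True
        then obtain i j where ij: "a = p i" "b = p j" "i \<le> k" "j \<le> k" by auto
        have "zero_vars (UNIV - edge_vars ?P) g = g"
          unfolding ab(1) by (rule zero_vars_edge_binom_self) (use True in auto)
        moreover have "g \<in> idl (path_gens p k)"
        proof (cases "j = Suc i")
          case True
          then show ?thesis using ij ab by (intro idl_incl) (auto simp: path_gens_def)
        next
          case False
          then have "i = Suc j" using E(2)[of i j] ij ab by auto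
          then have "edge_binom b a \<in> idl (path_gens p k :: ('w edge_var, 'k) mpoly set)"
            using ij by (intro idl_incl) (auto simp: path_gens_def)
          from is_idealD(5)[OF is_ideal_idl this] show ?thesis by (simp add: ab(1) edge_binom_swap[of b a])
        qed
        ultimately show ?thesis by simp
      next
        case False
        then have "zero_vars (UNIV - edge_vars ?P) g = 0"
          unfolding ab(1) zero_vars_edge_binom zero_vars_Var by auto
        then show ?thesis by (simp add: idl.zero)
      qed
    qed
  qed
  then show False using P.koszul_vanish_path[OF p(1) order_refl] by simp
qed

section \<open>Change of modules in Koszul homology\<close>

text \<open>A degree-preserving map of modules with operators, possibly of different types.\<close>

locale koszul_map =
  X: commuting_operators x n + Y: commuting_operators y n
  for x :: "nat \<Rightarrow> 'm::ab_group_add \<Rightarrow> 'm" and y :: "nat \<Rightarrow> 'p::ab_group_add \<Rightarrow> 'p" and n :: nat +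
  fixes f :: "'m \<Rightarrow> 'p" and M' U' :: "int \<Rightarrow> 'm set" and M U :: "int \<Rightarrow> 'p set"
  assumes f_diff: "f (a - b) = f a - f b" and f_x: "v < n \<Longrightarrow> f (x v a) = y v (f a)"
    and gM': "graded_sub x n M'" and gM: "graded_sub y n M" and gU: "graded_sub y n U"
    and f_M: "a \<in> M' j \<Longrightarrow> f a \<in> M j" and U_M: "U j \<subseteq> M j"
begin

lemma f_zero [simp]: "f 0 = 0" using f_diff[of 0 0] by simp

lemma koszul_d_f: "koszul_d y n (\<lambda>T. f (z T)) T = f (koszul_d x n z T)"
  by (rule koszul_d_hom[symmetric]) (auto simp: f_diff f_x)

lemma koszul_chain_f: "koszul_chain n M' p j z \<Longrightarrow> koszul_chain n M p j (\<lambda>T. f (z T))"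
  using f_M by (simp add: koszul_chain_def)

text \<open>The choice of images or preimages for all coefficients of a chain at once.\<close>

lemma koszul_chain_lift:
  assumes "koszul_chain n Q p j z" "\<And>i a. a \<in> Q i \<Longrightarrow> \<exists>b\<in>P i. R i a b"
  obtains s where "koszul_chain n P p j s" "\<And>T. T \<subseteq> {..<n} \<Longrightarrow> int (card T) = p \<Longrightarrow> R (j - p) (z T) (s T)"
proof -
  have "\<exists>g. \<forall>T\<in>{T. T \<subseteq> {..<n} \<and> int (card T) = p}. g T \<in> P (j - p) \<and> R (j - p) (z T) (g T)"
    by (rule bchoice) (use kcD[OF assms(1)] assms(2) in blast)
  then obtain g where "\<And>T. T \<subseteq> {..<n} \<Longrightarrow> int (card T) = p \<Longrightarrow> g T \<in> P (j - p) \<and> R (j - p) (z T) (g T)"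
    by blast
  then show ?thesis by (intro that[of g]) (auto simp: koszul_chain_def)
qed

text \<open>The hypotheses say that \<open>f\<close> induces an isomorphism from $M'/U'$ to $M/U$.\<close>

lemma koszul_vanish_iso:
  assumes U': "\<And>a i. a \<in> U' i \<longleftrightarrow> a \<in> M' i \<and> f a \<in> U i"
    and onto: "\<And>a i. a \<in> M i \<Longrightarrow> \<exists>b\<in>M' i. a - f b \<in> U i"
  shows "koszul_vanish x n M' U' p j \<longleftrightarrow> koszul_vanish y n M U p j"
proof
  have kcU': "koszul_chain n U' q i z \<longleftrightarrow> koszul_chain n M' q i z \<and> koszul_chain n U q i (\<lambda>T. f (z T))" for q i z
    by (auto simp: koszul_chain_def U')
  assume v: "koszul_vanish x n M' U' p j"
  show "koszul_vanish y n M U p j"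
  proof (rule Y.koszul_vanishI)
    fix z assume z: "koszul_chain n M p j z" and dz: "koszul_chain n U (p - 1) j (koszul_d y n z)"
    obtain s where s: "koszul_chain n M' p j s" and zs0: "\<And>T. T \<subseteq> {..<n} \<Longrightarrow> int (card T) = p \<Longrightarrow> z T - f (s T) \<in> U (j - p)"
      by (rule koszul_chain_lift[OF z, where P = M' and R = "\<lambda>i a b. a - f b \<in> U i"]) (use onto in auto)
    have zs: "koszul_chain n U p j (\<lambda>T. z T - f (s T))" using zs0 by (simp add: koszul_chain_def)
    have "koszul_chain n U (p - 1) j (\<lambda>T. koszul_d y n z T - koszul_d y n (\<lambda>T. z T - f (s T)) T)"
      by (rule koszul_chain_diff[OF gU dz Y.koszul_chain_koszul_d[OF gU zs]])
    then have "koszul_chain n U (p - 1) j (\<lambda>T. f (koszul_d x n s T))" by (simp add: Y.koszul_d_diff koszul_d_f)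
    then have "koszul_chain n U' (p - 1) j (koszul_d x n s)" unfolding kcU' using X.koszul_chain_koszul_d[OF gM' s] by simp
    then obtain w where w: "koszul_chain n M' (p + 1) j w" and u: "koszul_chain n U' p j (\<lambda>T. s T - koszul_d x n w T)"
      using X.koszul_vanishD[OF v s] by blast
    have "koszul_chain n U p j (\<lambda>T. (z T - f (s T)) + f (s T - koszul_d x n w T))"
      using koszul_chain_add[OF gU zs] u unfolding kcU' by simp
    then have "koszul_chain n U p j (\<lambda>T. z T - koszul_d y n (\<lambda>T. f (w T)) T)" by (simp add: f_diff koszul_d_f)
    then show "\<exists>w. koszul_chain n M (p + 1) j w \<and> koszul_chain n U p j (\<lambda>T. z T - koszul_d y n w T)" using koszul_chain_f[OF w] by blast
  qed
next
  have kcU': "koszul_chain n U' q i z \<longleftrightarrow> koszul_chain n M' q i z \<and> koszul_chain n U q i (\<lambda>T. f (z T))" for q i z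
    by (auto simp: koszul_chain_def U')
  assume v: "koszul_vanish y n M U p j"
  show "koszul_vanish x n M' U' p j"
  proof (rule X.koszul_vanishI)
    fix z assume z: "koszul_chain n M' p j z" and dz: "koszul_chain n U' (p - 1) j (koszul_d x n z)"
    have "koszul_chain n U (p - 1) j (koszul_d y n (\<lambda>T. f (z T)))"
      using dz unfolding kcU' by (simp add: koszul_chain_def koszul_d_f)
    then obtain w where w: "koszul_chain n M (p + 1) j w" and u: "koszul_chain n U p j (\<lambda>T. f (z T) - koszul_d y n w T)"
      using Y.koszul_vanishD[OF v koszul_chain_f[OF z]] by blast
    obtain s where s: "koszul_chain n M' (p + 1) j s"
      and ws0: "\<And>T. T \<subseteq> {..<n} \<Longrightarrow> int (card T) = p + 1 \<Longrightarrow> w T - f (s T) \<in> U (j - (p + 1))"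
      by (rule koszul_chain_lift[OF w, where P = M' and R = "\<lambda>i a b. a - f b \<in> U i"]) (use onto in auto)
    have ws: "koszul_chain n U (p + 1) j (\<lambda>T. w T - f (s T))" using ws0 by (simp add: koszul_chain_def)
    have "koszul_chain n U p j (\<lambda>T. (f (z T) - koszul_d y n w T) + koszul_d y n (\<lambda>T. w T - f (s T)) T)"
      using koszul_chain_add[OF gU u] Y.koszul_chain_koszul_d[OF gU ws] by simp
    then have "koszul_chain n U p j (\<lambda>T. f (z T - koszul_d x n s T))" by (simp add: Y.koszul_d_diff koszul_d_f f_diff)
    moreover have "koszul_chain n M' p j (\<lambda>T. z T - koszul_d x n s T)"
      using koszul_chain_diff[OF gM' z] X.koszul_chain_koszul_d[OF gM' s] by simp
    ultimately show "\<exists>w. koszul_chain n M' (p + 1) j w \<and> koszul_chain n U' p j (\<lambda>T. z T - koszul_d x n w T)"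
      using s unfolding kcU' by blast
  qed
qed

text \<open>The map \<open>f\<close> identifies $M'/U'$ with \<open>U\<close>, and $M$ has no homology in positive degrees, so the connecting map
$H_{p+1}(M/U) \to H_p(U) = H_p(M'/U')$ of $0 \to U \to M \to M/U \to 0$ is injective.\<close>

lemma koszul_vanish_shift_up:
  assumes U': "\<And>a i. a \<in> U' i \<longleftrightarrow> a \<in> M' i \<and> f a = 0"
    and img: "\<And>a i. a \<in> U i \<Longrightarrow> \<exists>b\<in>M' i. a = f b" "\<And>a i. a \<in> M' i \<Longrightarrow> f a \<in> U i"
    and acyc: "koszul_vanish y n M (\<lambda>_. {0}) (p + 1) j"
    and v: "koszul_vanish x n M' U' p j"
  shows "koszul_vanish y n M U (p + 1) j"
proof (rule Y.koszul_vanishI)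
  fix z assume z: "koszul_chain n M (p + 1) j z" and dz: "koszul_chain n U (p + 1 - 1) j (koszul_d y n z)"
  obtain s where s: "koszul_chain n M' (p + 1 - 1) j s"
    and zs: "\<And>T. T \<subseteq> {..<n} \<Longrightarrow> int (card T) = p + 1 - 1 \<Longrightarrow> koszul_d y n z T = f (s T)"
    by (rule koszul_chain_lift[OF dz, where P = M' and R = "\<lambda>i a b. a = f b"]) (use img(1) in auto)
  have s: "koszul_chain n M' p j s" and zs: "\<And>T. T \<subseteq> {..<n} \<Longrightarrow> int (card T) = p \<Longrightarrow> koszul_d y n z T = f (s T)"
    using s zs by simp_all
  have "koszul_chain n U' (p - 1) j (koszul_d x n s)"
    unfolding koszul_chain_def U'
  proof (intro allI impI conjI)
    fix T assume T: "T \<subseteq> {..<n}" "int (card T) = p - 1"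
    show "koszul_d x n s T \<in> M' (j - (p - 1))" by (rule kcD[OF X.koszul_chain_koszul_d[OF gM' s] T])
    have "f (koszul_d x n s T) = koszul_d y n (koszul_d y n z) T"
      unfolding koszul_d_f[symmetric] by (rule koszul_d_cong[OF T(1)]) (use zs T in auto)
    then show "f (koszul_d x n s T) = 0" by (simp add: Y.koszul_d_koszul_d[OF T(1)])
  qed
  then obtain w where w: "koszul_chain n M' (p + 1) j w" and u: "koszul_chain n U' p j (\<lambda>T. s T - koszul_d x n w T)"
    using X.koszul_vanishD[OF v s] by blast
  let ?z = "\<lambda>T. z T - f (w T)"
  have z': "koszul_chain n M (p + 1) j ?z" by (rule koszul_chain_diff[OF gM z koszul_chain_f[OF w]])
  have "koszul_chain n (\<lambda>_. {0}) (p + 1 - 1) j (koszul_d y n ?z)"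
    unfolding koszul_chain_def
  proof (intro allI impI)
    fix T assume T: "T \<subseteq> {..<n}" "int (card T) = p + 1 - 1"
    have "f (s T - koszul_d x n w T) = 0" using kcD[OF u T(1)] T(2) by (simp add: U')
    then show "koszul_d y n ?z T \<in> {0}" using zs[OF T(1)] T(2) by (simp add: Y.koszul_d_diff koszul_d_f f_diff)
  qed
  then obtain y' where y': "koszul_chain n M (p + 1 + 1) j y'" and e: "koszul_chain n (\<lambda>_. {0}) (p + 1) j (\<lambda>T. ?z T - koszul_d y n y' T)"
    using Y.koszul_vanishD[OF acyc z'] by blast
  have "koszul_chain n U (p + 1) j (\<lambda>T. z T - koszul_d y n y' T)"
    unfolding koszul_chain_def
  proof (intro allI impI)
    fix T assume T: "T \<subseteq> {..<n}" "int (card T) = p + 1"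
    have "z T - koszul_d y n y' T = f (w T)" using kcD[OF e T] by (simp add: algebra_simps)
    then show "z T - koszul_d y n y' T \<in> U (j - (p + 1))" using img(2)[OF kcD[OF w T]] by simp
  qed
  then show "\<exists>w. koszul_chain n M (p + 1 + 1) j w \<and> koszul_chain n U (p + 1) j (\<lambda>T. z T - koszul_d y n w T)" using y' by blast
qed

text \<open>The connecting map is also onto if the cycles of \<open>U\<close> bound in \<open>M\<close>. For $p \ge 1$ this is
acyclicity of $M$; for $p = 0$ it holds if \<open>U\<close> has no constant terms, which is the minimality of the resolution.\<close>

lemma koszul_vanish_shift_down:
  assumes U': "\<And>a i. a \<in> U' i \<longleftrightarrow> a \<in> M' i \<and> f a = 0"
    and img: "\<And>a i. a \<in> U i \<Longrightarrow> \<exists>b\<in>M' i. a = f b" "\<And>a i. a \<in> M' i \<Longrightarrow> f a \<in> U i"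
    and bd: "\<And>z. koszul_chain n U p j z \<Longrightarrow> koszul_chain n (\<lambda>_. {0}) (p - 1) j (koszul_d y n z) \<Longrightarrow>
      \<exists>w. koszul_chain n M (p + 1) j w \<and> koszul_chain n (\<lambda>_. {0}) p j (\<lambda>T. z T - koszul_d y n w T)"
    and v: "koszul_vanish y n M U (p + 1) j"
  shows "koszul_vanish x n M' U' p j"
proof (rule X.koszul_vanishI)
  fix z assume z: "koszul_chain n M' p j z" and dz: "koszul_chain n U' (p - 1) j (koszul_d x n z)"
  have fz: "koszul_chain n U p j (\<lambda>T. f (z T))" using z img(2) by (simp add: koszul_chain_def)
  have "koszul_chain n (\<lambda>_. {0}) (p - 1) j (koszul_d y n (\<lambda>T. f (z T)))"
    using dz by (simp add: koszul_chain_def U' koszul_d_f)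
  then obtain w where w: "koszul_chain n M (p + 1) j w" and e: "koszul_chain n (\<lambda>_. {0}) p j (\<lambda>T. f (z T) - koszul_d y n w T)"
    using bd[OF fz] by blast
  have fzw: "f (z T) = koszul_d y n w T" if "T \<subseteq> {..<n}" "int (card T) = p" for T
    using kcD[OF e that] by simp
  have "koszul_chain n U (p + 1 - 1) j (koszul_d y n w)" using fz fzw by (simp add: koszul_chain_def)
  then obtain y' where y': "koszul_chain n M (p + 1 + 1) j y'" and u: "koszul_chain n U (p + 1) j (\<lambda>T. w T - koszul_d y n y' T)"
    using Y.koszul_vanishD[OF v w] by blast
  obtain s where s: "koszul_chain n M' (p + 1) j s"
    and ws: "\<And>T. T \<subseteq> {..<n} \<Longrightarrow> int (card T) = p + 1 \<Longrightarrow> w T - koszul_d y n y' T = f (s T)"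
    by (rule koszul_chain_lift[OF u, where P = M' and R = "\<lambda>i a b. a = f b"]) (use img(1) in auto)
  have "koszul_chain n U' p j (\<lambda>T. z T - koszul_d x n s T)"
    unfolding koszul_chain_def U'
  proof (intro allI impI conjI)
    fix T assume T: "T \<subseteq> {..<n}" "int (card T) = p"
    show "z T - koszul_d x n s T \<in> M' (j - p)"
      using graded_subD(2)[OF gM' kcD[OF z T]] kcD[OF X.koszul_chain_koszul_d[OF gM' s]] T by simp
    have "f (koszul_d x n s T) = koszul_d y n (\<lambda>T. w T - koszul_d y n y' T) T"
      unfolding koszul_d_f[symmetric] by (rule koszul_d_cong[OF T(1)]) (use ws T in auto)
    then show "f (z T - koszul_d x n s T) = 0"
      by (simp add: f_diff fzw[OF T] Y.koszul_d_diff Y.koszul_d_koszul_d[OF T(1)])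
  qed
  then show "\<exists>w. koszul_chain n M' (p + 1) j w \<and> koszul_chain n U' p j (\<lambda>T. z T - koszul_d x n w T)" using s by blast
qed

end

section \<open>Graded free modules\<close>

definition mult_var_free :: "(nat \<Rightarrow> 'v) \<Rightarrow> nat \<Rightarrow> (nat \<Rightarrow> ('v, 'k::field) mpoly) \<Rightarrow> nat \<Rightarrow> ('v, 'k) mpoly" where
  "mult_var_free e v f = (\<lambda>k. Var (e v) * f k)"

lemma commuting_mult_var_free: "commuting_operators (mult_var_free e)"
  by unfold_locales (auto simp: mult_var_free_def algebra_simps)

text \<open>Elements of the free module of rank \<open>r\<close> are functions that vanish from \<open>r\<close> on; in contrast to vectors
they form a group for all ranks in one type.\<close>

definition free_polys :: "'v set \<Rightarrow> nat \<Rightarrow> (nat \<Rightarrow> ('v, 'k::field) mpoly) set" where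
  "free_polys A r = {f. (\<forall>k<r. f k \<in> polys A) \<and> (\<forall>k\<ge>r. f k = 0)}"

text \<open>The forms of degree \<open>j\<close> in $\bigoplus_k S(-a_k)$.\<close>

definition free_forms :: "'v set \<Rightarrow> int list \<Rightarrow> int \<Rightarrow> (nat \<Rightarrow> ('v, 'k::field) mpoly) set" where
  "free_forms A a j = {f. (\<forall>k<length a. f k \<in> forms A (j - a ! k)) \<and> (\<forall>k\<ge>length a. f k = 0)}"

definition free_part :: "'v set \<Rightarrow> int list \<Rightarrow> int \<Rightarrow> (nat \<Rightarrow> ('v, 'k::field) mpoly) \<Rightarrow> nat \<Rightarrow> ('v, 'k) mpoly" where
  "free_part A a j f = (\<lambda>k. if k < length a then form_part A (j - a ! k) (f k) else 0)"

definition mat_apply :: "nat \<Rightarrow> nat \<Rightarrow> (nat \<Rightarrow> nat \<Rightarrow> ('v, 'k::field) mpoly) \<Rightarrow> (nat \<Rightarrow> ('v, 'k) mpoly) \<Rightarrow> nat \<Rightarrow> ('v, 'k) mpoly" where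
  "mat_apply r r' D f = (\<lambda>k. if k < r then \<Sum>l<r'. D k l * f l else 0)"

definition hom_matrix :: "'v set \<Rightarrow> int list \<Rightarrow> int list \<Rightarrow> (nat \<Rightarrow> nat \<Rightarrow> ('v, 'k::field) mpoly) \<Rightarrow> bool" where
  "hom_matrix A a a' D \<longleftrightarrow> (\<forall>k<length a. \<forall>l<length a'. D k l \<in> forms A (a' ! l - a ! k))"

lemma free_forms_free_polys: "f \<in> free_forms A a j \<Longrightarrow> f \<in> free_polys A (length a)"
  by (auto simp: free_forms_def free_polys_def forms_polys)

lemma free_part_free_forms: "free_part A a j f \<in> free_forms A a j"
  by (auto simp: free_part_def free_forms_def)

lemma free_part_self: "f \<in> free_forms A a j \<Longrightarrow> free_part A a j f = f"
  by (auto simp: free_part_def free_forms_def form_part_self fun_eq_iff)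

lemma mat_apply_free_forms:
  assumes "hom_matrix A a a' D" "f \<in> free_forms A a' j"
  shows "mat_apply (length a) (length a') D f \<in> free_forms A a j"
proof -
  have "D k l * f l \<in> forms A (j - a ! k)" if "k < length a" "l < length a'" for k l
    using forms_mult[of "D k l" A "a' ! l - a ! k" "f l" "j - a' ! l"] assms that by (simp add: hom_matrix_def free_forms_def)
  then show ?thesis by (auto simp: mat_apply_def free_forms_def intro!: forms_sum)
qed

lemma free_part_mat_apply:
  assumes "hom_matrix A a a' D"
  shows "free_part A a j (mat_apply (length a) (length a') D f) = mat_apply (length a) (length a') D (free_part A a' j f)"
proof
  fix k
  have "form_part A (j - a ! k) (D k l * f l) = D k l * form_part A (j - a' ! l) (f l)"
    if "k < length a" "l < length a'" for l
    using form_part_mult[of "D k l" A "a' ! l - a ! k" "j - a ! k" "f l"] assms that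
    by (simp add: hom_matrix_def mult.commute)
  then show "free_part A a j (mat_apply (length a) (length a') D f) k = mat_apply (length a) (length a') D (free_part A a' j f) k"
    by (simp add: free_part_def mat_apply_def form_part_sum)
qed

lemma mat_apply_diff: "mat_apply r r' D (f - g) = mat_apply r r' D f - mat_apply r r' D g"
  by (auto simp: mat_apply_def fun_eq_iff algebra_simps sum_subtractf)

lemma mat_apply_mult_var_free: "mat_apply r r' D (mult_var_free e v f) = mult_var_free e v (mat_apply r r' D f)"
  by (auto simp: mat_apply_def mult_var_free_def fun_eq_iff sum_distrib_left mult.left_commute)

context poly_koszul
begin

sublocale F: commuting_operators "mult_var_free e :: nat \<Rightarrow> (nat \<Rightarrow> ('v, 'k) mpoly) \<Rightarrow> _" N
  by (rule commuting_mult_var_free)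

lemma graded_free_forms: "graded_sub (mult_var_free e) N (free_forms A a :: int \<Rightarrow> (nat \<Rightarrow> ('v, 'k) mpoly) set)"
  unfolding graded_sub_def
proof (intro allI conjI ballI impI)
  fix j v and f :: "nat \<Rightarrow> ('v, 'k) mpoly" assume v: "v < N" and f: "f \<in> free_forms A a j"
  have "Var (e v) * f k \<in> forms A (j + 1 - a ! k)" if "k < length a" for k
    using forms_mult[OF Var_forms[OF e_A[OF v]], of "f k" "j - a ! k"] f that by (simp add: free_forms_def algebra_simps)
  then show "mult_var_free e v f \<in> free_forms A a (j + 1)" using f by (auto simp: free_forms_def mult_var_free_def)
qed (auto simp: free_forms_def forms_diff)

lemma koszul_d_coordinate: "koszul_d (mult_var_free e) n z T k = koszul_d (mult_var e) n (\<lambda>T. z T k) T"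
  by (rule koszul_d_hom[where f = "\<lambda>m. m k"]) (auto simp: mult_var_free_def mult_var_def)

lemma free_acyclic:
  assumes "1 \<le> p"
  shows "koszul_vanish (mult_var_free e) N (free_forms A a) (\<lambda>_. {0 :: nat \<Rightarrow> ('v, 'k) mpoly}) p j"
proof (rule F.koszul_vanishI)
  fix z :: "nat set \<Rightarrow> nat \<Rightarrow> ('v, 'k) mpoly"
  assume z: "koszul_chain N (free_forms A a) p j z" and dz: "koszul_chain N (\<lambda>_. {0}) (p - 1) j (koszul_d (mult_var_free e) N z)"
  have sh: "j - a ! k - p = j - p - a ! k" for k by simp
  have "\<exists>w. koszul_chain N (forms A) (p + 1) (j - a ! k) w \<and> koszul_chain N (\<lambda>_. {0}) p (j - a ! k) (\<lambda>T. z T k - koszul_d (mult_var e) N w T)"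
    if k: "k < length a" for k
  proof -
    have 1: "koszul_chain N (forms A) p (j - a ! k) (\<lambda>T. z T k)"
      using z k unfolding koszul_chain_def free_forms_def sh by blast
    have 2: "koszul_chain N (\<lambda>_. {0}) (p - 1) (j - a ! k) (koszul_d (mult_var e) N (\<lambda>T. z T k))"
      using dz unfolding koszul_chain_def koszul_d_coordinate[symmetric] by (simp add: fun_eq_iff)
    show ?thesis using K.koszul_vanishD[OF koszul_acyclic[OF order_refl assms] 1 2] by blast
  qed
  then have "\<forall>k\<in>{..<length a}. \<exists>w. koszul_chain N (forms A) (p + 1) (j - a ! k) w \<and>
      koszul_chain N (\<lambda>_. {0}) p (j - a ! k) (\<lambda>T. z T k - koszul_d (mult_var e) N w T)" by simp
  from bchoice[OF this] obtain w where ww: "\<forall>k\<in>{..<length a}. koszul_chain N (forms A) (p + 1) (j - a ! k) (w k) \<and>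
      koszul_chain N (\<lambda>_. {0}) p (j - a ! k) (\<lambda>T. z T k - koszul_d (mult_var e) N (w k) T)" by (rule exE)
  have w: "koszul_chain N (forms A) (p + 1) (j - a ! k) (w k)"
    and u: "koszul_chain N (\<lambda>_. {0}) p (j - a ! k) (\<lambda>T. z T k - koszul_d (mult_var e) N (w k) T)" if "k < length a" for k
    using bspec[OF ww, of k] that by simp_all
  define W where "W = (\<lambda>T k. if k < length a then w k T else 0)"
  have "koszul_chain N (free_forms A a) (p + 1) j W"
    unfolding koszul_chain_def free_forms_def W_def
  proof (intro allI impI CollectI conjI)
    fix T k assume T: "T \<subseteq> {..<N}" "int (card T) = p + 1" and k: "k < length a"
    show "(if k < length a then w k T else 0) \<in> forms A (j - (p + 1) - a ! k)"
      using kcD[OF w[OF k] T] k by (simp add: algebra_simps)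
  qed simp
  moreover have "koszul_chain N (\<lambda>_. {0}) p j (\<lambda>T. z T - koszul_d (mult_var_free e) N W T)"
    unfolding koszul_chain_def
  proof (intro allI impI)
    fix T assume T: "T \<subseteq> {..<N}" "int (card T) = p"
    have "z T k - koszul_d (mult_var_free e) N W T k = 0" for k
    proof (cases "k < length a")
      case True
      then show ?thesis using kcD[OF u[OF True] T] by (simp add: koszul_d_coordinate W_def)
    next
      case False
      then have "z T k = 0" using kcD[OF z T] by (simp add: free_forms_def)
      then show ?thesis using False by (simp add: koszul_d_coordinate W_def K.koszul_d_zero)
    qed
    then show "z T - koszul_d (mult_var_free e) N W T \<in> {0}" by (simp add: fun_eq_iff)
  qed
  ultimately show "\<exists>w. koszul_chain N (free_forms A a) (p + 1) j w \<and> koszul_chain N (\<lambda>_. {0}) p j (\<lambda>T. z T - koszul_d (mult_var_free e) N w T)"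
    by blast
qed

text \<open>In positive degrees a form is a combination of the variables, and these are the boundaries in $K_0$.\<close>

lemma free_boundary:
  assumes f: "f \<in> free_forms A a j" "\<And>k. lkp (f k) 0 = 0"
  shows "\<exists>w. koszul_chain N (free_forms A a) 1 j w \<and> (f :: nat \<Rightarrow> ('v, 'k) mpoly) = koszul_d (mult_var_free e) N w {}"
proof -
  have "\<exists>w. (\<forall>v<N. w v \<in> forms A (j - a ! k - 1)) \<and> f k = (\<Sum>v<N. Var (e v) * w v)" if "k < length a" for k
    using no_constant_term[of "f k" "j - a ! k"] f that by (auto simp: free_forms_def)
  then obtain w where w: "\<And>k v. k < length a \<Longrightarrow> v < N \<Longrightarrow> w k v \<in> forms A (j - a ! k - 1)"
    "\<And>k. k < length a \<Longrightarrow> f k = (\<Sum>v<N. Var (e v) * w k v)" by metis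
  define W where "W = (\<lambda>T k. if k < length a then w k (the_elem T) else 0)"
  have "koszul_chain N (free_forms A a) 1 j W"
    unfolding koszul_chain_def
  proof (intro allI impI)
    fix T assume T: "T \<subseteq> {..<N}" "int (card T) = 1"
    then obtain v where v: "T = {v}" by (metis card_1_singletonE of_nat_eq_1_iff)
    have "w k v \<in> forms A (j - 1 - a ! k)" if "k < length a" for k
      using w(1)[OF that, of v] T v by (simp add: algebra_simps)
    then show "W T \<in> free_forms A a (j - 1)" using v by (simp add: free_forms_def W_def)
  qed
  moreover have "f = koszul_d (mult_var_free e) N W {}"
  proof
    fix k
    show "f k = koszul_d (mult_var_free e) N W {} k"
    proof (cases "k < length a")
      case True
      then show ?thesis unfolding koszul_d_coordinate using w(2) by (simp add: koszul_d_empty mult_var_def W_def)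
    next
      case False
      then show ?thesis unfolding koszul_d_coordinate using f(1) by (simp add: koszul_d_empty mult_var_def W_def free_forms_def)
    qed
  qed
  ultimately show ?thesis by blast
qed

lemma koszul_d_no_constant: "lkp (koszul_d (mult_var_free e) N (w :: nat set \<Rightarrow> nat \<Rightarrow> ('v, 'k) mpoly) {} k) 0 = 0"
proof -
  have "lkp (Var v * f :: ('v, 'k) mpoly) 0 = 0" for v f
  proof -
    have "sgl v (1::nat) \<noteq> 0" by (metis lookup_single_eq lookup_zero zero_neq_one)
    then show ?thesis unfolding lookup_mult_zero by (simp add: Var_def lookup_single when_def)
  qed
  then show ?thesis unfolding koszul_d_coordinate by (simp add: koszul_d_empty mult_var_def lookup_sum)
qed

text \<open>$H_0(F/U) = F/(U + \mathfrak m F) = F/\mathfrak m F$ since $U \subseteq \mathfrak m F$.\<close>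

lemma koszul_vanish_generators:
  fixes U :: "int \<Rightarrow> (nat \<Rightarrow> ('v, 'k) mpoly) set"
  assumes U: "\<And>i f k. f \<in> U i \<Longrightarrow> lkp (f k) 0 = 0" "0 \<in> U j"
  shows "koszul_vanish (mult_var_free e) N (free_forms A a) U 0 j \<longleftrightarrow> j \<notin> set a"
proof
  assume v: "koszul_vanish (mult_var_free e) N (free_forms A a) U 0 j"
  show "j \<notin> set a"
  proof
    assume "j \<in> set a"
    then obtain k where k: "k < length a" "a ! k = j" by (auto simp: in_set_conv_nth)
    define z where "z = (\<lambda>T::nat set. \<lambda>i. if i = k then 1 else (0 :: ('v, 'k) mpoly))"
    have "koszul_chain N (free_forms A a) 0 j z" using k by (auto simp: koszul_chain_def free_forms_def z_def forms_def)
    moreover have "koszul_chain N U (0 - 1) j (koszul_d (mult_var_free e) N z)" by (auto simp: koszul_chain_def)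
    ultimately obtain w where u: "koszul_chain N U 0 j (\<lambda>T. z T - koszul_d (mult_var_free e) N w T)"
      using F.koszul_vanishD[OF v] by blast
    have "z {} - koszul_d (mult_var_free e) N w {} \<in> U (j - 0)" using kcD[OF u, of "{}"] by simp
    from U(1)[OF this, of k] have "lkp (z {} k) 0 - lkp (koszul_d (mult_var_free e) N w {} k) 0 = 0"
      by (simp add: lookup_minus)
    then show False by (simp add: koszul_d_no_constant z_def)
  qed
next
  assume j: "j \<notin> set a"
  show "koszul_vanish (mult_var_free e) N (free_forms A a) U 0 j"
  proof (rule F.koszul_vanishI)
    fix z :: "nat set \<Rightarrow> nat \<Rightarrow> ('v, 'k) mpoly" assume z: "koszul_chain N (free_forms A a) 0 j z"
    have z0: "z {} \<in> free_forms A a j" using kcD[OF z, of "{}"] by simp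
    have "lkp (z {} k) 0 = 0" for k
    proof (cases "k < length a")
      case True
      then have "j - a ! k \<noteq> 0" using j nth_mem by fastforce
      moreover have "z {} k \<in> forms A (j - a ! k)" using z0 True by (simp add: free_forms_def)
      ultimately have "0 \<notin> mkeys (z {} k)" by (auto simp: forms_def)
      then show ?thesis by (simp add: in_keys_iff)
    next
      case False
      then show ?thesis using z0 by (simp add: free_forms_def)
    qed
    from free_boundary[OF z0 this] obtain w where w: "koszul_chain N (free_forms A a) 1 j w" "z {} = koszul_d (mult_var_free e) N w {}" by blast
    have "koszul_chain N U 0 j (\<lambda>T. z T - koszul_d (mult_var_free e) N w T)"
      unfolding koszul_chain_def
    proof (intro allI impI)
      fix T assume T: "T \<subseteq> {..<N}" "int (card T) = 0"
      then have "T = {}" using finite_subset_lessThan by auto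
      then show "z T - koszul_d (mult_var_free e) N w T \<in> U (j - 0)" using U(2) w(2) by simp
    qed
    then show "\<exists>w. koszul_chain N (free_forms A a) (0 + 1) j w \<and> koszul_chain N U 0 j (\<lambda>T. z T - koszul_d (mult_var_free e) N w T)"
      using w(1) by auto
  qed
qed

text \<open>Dimension shifting along $0 \to \mathrm{im}\,D \to F \to F/\mathrm{im}\,D \to 0$ with $\mathrm{im}\,D = F'/\ker D$. Homogeneity
of \<open>D\<close> allows homogeneous preimages to be chosen, by passing to components.\<close>

lemma koszul_vanish_resolution_step:
  fixes D :: "nat \<Rightarrow> nat \<Rightarrow> ('v, 'k) mpoly"
  assumes D: "hom_matrix A a a' D"
    and U: "U = mat_apply (length a) (length a') D ` free_polys A (length a')"
    and irr: "\<And>f k. f \<in> U \<Longrightarrow> lkp (f k) 0 = 0"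
    and p: "0 \<le> p"
  shows "koszul_vanish (mult_var_free e) N (free_forms A a') (\<lambda>i. {f \<in> free_polys A (length a'). mat_apply (length a) (length a') D f = 0} \<inter> free_forms A a' i) p j \<longleftrightarrow>
    koszul_vanish (mult_var_free e) N (free_forms A a) (\<lambda>i. U \<inter> free_forms A a i) (p + 1) j"
proof -
  let ?D = "mat_apply (length a) (length a') D"
  have zero: "(0 :: nat \<Rightarrow> ('v, 'k) mpoly) \<in> U"
    unfolding U by (rule image_eqI[of _ _ 0]) (auto simp: mat_apply_def fun_eq_iff free_polys_def)
  have Ud: "f - g \<in> U" if fg: "f \<in> U" "g \<in> U" for f g
  proof -
    obtain f' g' where *: "f = ?D f'" "g = ?D g'" "f' \<in> free_polys A (length a')" "g' \<in> free_polys A (length a')"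
      using fg unfolding U by blast
    then have "f' - g' \<in> free_polys A (length a')" by (auto simp: free_polys_def polys_diff)
    then show ?thesis unfolding U *(1,2) mat_apply_diff[symmetric] by (rule imageI)
  qed
  have Ux: "mult_var_free e v f \<in> U" if f: "v < N" "f \<in> U" for v f
  proof -
    obtain f' where *: "f = ?D f'" "f' \<in> free_polys A (length a')" using f unfolding U by blast
    then have "mult_var_free e v f' \<in> free_polys A (length a')"
      using polys_mult[OF forms_polys[OF Var_forms[OF e_A[OF f(1)]]]] by (auto simp: free_polys_def mult_var_free_def)
    then show ?thesis unfolding U *(1) mat_apply_mult_var_free[symmetric] by (rule imageI)
  qed
  have gU: "graded_sub (mult_var_free e) N (\<lambda>i. U \<inter> free_forms A a i)"
    using graded_free_forms[of a] zero Ud Ux unfolding graded_sub_def by auto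
  have lift: "\<exists>b\<in>free_forms A a' i. f = ?D b" if f: "f \<in> U \<inter> free_forms A a i" for f i
  proof -
    obtain f' where *: "f = ?D f'" using f unfolding U by blast
    have "f = free_part A a i (?D f')" using free_part_self[of f A a i] f * by simp
    also have "\<dots> = ?D (free_part A a' i f')" by (rule free_part_mat_apply[OF D])
    finally show ?thesis using free_part_free_forms by blast
  qed
  have img: "?D f \<in> U \<inter> free_forms A a i" if "f \<in> free_forms A a' i" for f i
    using mat_apply_free_forms[OF D that] free_forms_free_polys[OF that] unfolding U by blast
  have p1: "1 \<le> p + 1" using p by simp
  have U': "f \<in> {f \<in> free_polys A (length a'). ?D f = 0} \<inter> free_forms A a' i \<longleftrightarrow> f \<in> free_forms A a' i \<and> ?D f = 0" for f i
    using free_forms_free_polys[of f A a' i] by blast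
  interpret koszul_map "mult_var_free e" "mult_var_free e" N ?D "free_forms A a'"
    "\<lambda>i. {f \<in> free_polys A (length a'). mat_apply (length a) (length a') D f = 0} \<inter> free_forms A a' i" "free_forms A a" "\<lambda>i. U \<inter> free_forms A a i"
    by unfold_locales (use graded_free_forms gU mat_apply_free_forms[OF D] in \<open>auto simp: mat_apply_diff mat_apply_mult_var_free\<close>)
  show ?thesis
  proof
    assume v: "koszul_vanish (mult_var_free e) N (free_forms A a') (\<lambda>i. {f \<in> free_polys A (length a'). ?D f = 0} \<inter> free_forms A a' i) p j"
    show "koszul_vanish (mult_var_free e) N (free_forms A a) (\<lambda>i. U \<inter> free_forms A a i) (p + 1) j"
      by (rule koszul_vanish_shift_up[OF U' lift img free_acyclic[OF p1] v])
  next
    assume v: "koszul_vanish (mult_var_free e) N (free_forms A a) (\<lambda>i. U \<inter> free_forms A a i) (p + 1) j"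
    show "koszul_vanish (mult_var_free e) N (free_forms A a') (\<lambda>i. {f \<in> free_polys A (length a'). ?D f = 0} \<inter> free_forms A a' i) p j"
    proof (rule koszul_vanish_shift_down[OF U' lift img _ v])
      fix z assume z: "koszul_chain N (\<lambda>i. U \<inter> free_forms A a i) p j z" and dz: "koszul_chain N (\<lambda>_. {0}) (p - 1) j (koszul_d (mult_var_free e) N z)"
      have zF: "koszul_chain N (free_forms A a) p j z" using z by (auto simp: koszul_chain_def)
      show "\<exists>w. koszul_chain N (free_forms A a) (p + 1) j w \<and> koszul_chain N (\<lambda>_. {0}) p j (\<lambda>T. z T - koszul_d (mult_var_free e) N w T)"
      proof (cases "p = 0")
        case True
        have "z {} \<in> U \<inter> free_forms A a j" using kcD[OF z, of "{}"] True by simp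
        then obtain w where w: "koszul_chain N (free_forms A a) 1 j w" "z {} = koszul_d (mult_var_free e) N w {}"
          using free_boundary[of "z {}" a j] irr by blast
        have "koszul_chain N (\<lambda>_. {0}) p j (\<lambda>T. z T - koszul_d (mult_var_free e) N w T)"
          unfolding koszul_chain_def
        proof (intro allI impI)
          fix T assume T: "T \<subseteq> {..<N}" "int (card T) = p"
          then have "T = {}" using finite_subset_lessThan True by auto
          then show "z T - koszul_d (mult_var_free e) N w T \<in> {0}" using w(2) by simp
        qed
        then show ?thesis using w(1) True by auto
      next
        case False
        then have "1 \<le> p" using p by simp
        from F.koszul_vanishD[OF free_acyclic[OF this] zF dz] show ?thesis by blast
      qed
    qed
  qed
qed

end

lemma sum_fun_apply: "(sum f S) k = (\<Sum>i\<in>S. f i k)" for f :: "'i \<Rightarrow> 'j \<Rightarrow> 'a::comm_monoid_add"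
  by (induction S rule: infinite_finite_induct) auto

context poly_koszul
begin

section \<open>Graded Betti numbers are read off from Koszul homology\<close>

text \<open>The kernel of the augmentation for $i = 0$, and of the differential $F_i \to F_{i-1}$ otherwise.\<close>

definition syz :: "('v, 'k) mpoly set \<Rightarrow> (nat \<Rightarrow> int list) \<Rightarrow> (nat \<Rightarrow> ('v, 'k) mpoly) \<Rightarrow>
    (nat \<Rightarrow> nat \<Rightarrow> nat \<Rightarrow> ('v, 'k) mpoly) \<Rightarrow> nat \<Rightarrow> (nat \<Rightarrow> ('v, 'k) mpoly) set" where
  "syz J a g D i = (case i of 0 \<Rightarrow> {f \<in> free_polys A (length (a 0)). (\<Sum>k<length (a 0). f k * g k) \<in> J}
     | Suc i \<Rightarrow> {f \<in> free_polys A (length (a (Suc i))). mat_apply (length (a i)) (length (a (Suc i))) (D i) f = 0})"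

definition min_res :: "('v, 'k) mpoly set \<Rightarrow> (nat \<Rightarrow> int list) \<Rightarrow> (nat \<Rightarrow> ('v, 'k) mpoly) \<Rightarrow>
    (nat \<Rightarrow> nat \<Rightarrow> nat \<Rightarrow> ('v, 'k) mpoly) \<Rightarrow> bool" where
  "min_res J a g D \<longleftrightarrow> (\<forall>k<length (a 0). g k \<in> forms A (a 0 ! k)) \<and>
     (\<forall>i. hom_matrix A (a i) (a (Suc i)) (D i)) \<and>
     (\<exists>f\<in>free_polys A (length (a 0)). 1 - (\<Sum>k<length (a 0). f k * g k) \<in> J) \<and>
     (\<forall>i. mat_apply (length (a i)) (length (a (Suc i))) (D i) ` free_polys A (length (a (Suc i))) = syz J a g D i) \<and>
     (\<forall>i. \<forall>k<length (a i). \<forall>l<length (a (Suc i)). lkp (D i k l) 0 = 0)"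

text \<open>The augmentation induces an isomorphism from $F_0/\mathrm{syz}_0$ to $S/J$.\<close>

lemma koszul_vanish_cover:
  fixes J :: "('v, 'k) mpoly set"
  assumes J: "graded_ideal A J" and g: "\<And>k. k < length a \<Longrightarrow> g k \<in> forms A (a ! k)"
    and f: "f \<in> free_polys A (length a)" "1 - (\<Sum>k<length a. f k * g k) \<in> J"
  shows "koszul_vanish (mult_var_free e) N (free_forms A a) (\<lambda>i. {f \<in> free_polys A (length a). (\<Sum>k<length a. f k * g k) \<in> J} \<inter> free_forms A a i) p j
    \<longleftrightarrow> tor_vanish J p j"
proof -
  let ?f = "\<lambda>h :: nat \<Rightarrow> ('v, 'k) mpoly. \<Sum>k<length a. h k * g k"
  have iJ: "is_ideal J" using J by (simp add: graded_ideal_def)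
  have fH: "?f h \<in> forms A i" if "h \<in> free_forms A a i" for h i
  proof (rule forms_sum)
    fix k assume "k \<in> {..<length a}"
    then show "h k * g k \<in> forms A i" using forms_mult[of "h k" A "i - a ! k" "g k" "a ! k"] that g by (simp add: free_forms_def)
  qed
  have fx: "?f (mult_var_free e v h) = mult_var e v (?f h)" for v h
    by (simp add: mult_var_free_def mult_var_def sum_distrib_left mult.assoc)
  have fd: "?f (h - h') = ?f h - ?f h'" for h h'
    by (simp add: algebra_simps sum_subtractf)
  have comp: "?f (free_part A a i h) = form_part A i (?f h)" for i h
  proof -
    have "form_part A i (h k * g k) = form_part A (i - a ! k) (h k) * g k" if "k < length a" for k
      using form_part_mult[OF g[OF that]] by simp
    then show ?thesis by (simp add: form_part_sum free_part_def)
  qed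
  interpret koszul_map "mult_var_free e" "mult_var e" N ?f "free_forms A a"
    "\<lambda>i. {f \<in> free_polys A (length a). (\<Sum>k<length a. f k * g k) \<in> J} \<inter> free_forms A a i" "forms A" "\<lambda>i. J \<inter> forms A i"
  proof unfold_locales
    show "graded_sub (mult_var_free e) N (free_forms A a :: int \<Rightarrow> (nat \<Rightarrow> ('v, 'k) mpoly) set)" by (rule graded_free_forms)
    show "graded_sub (mult_var e) N (forms A :: int \<Rightarrow> ('v, 'k) mpoly set)" by (rule graded_forms) simp
    show "graded_sub (mult_var e) N (\<lambda>i. J \<inter> forms A i)" by (rule graded_ideal_sub[OF iJ])
  qed (simp_all only: fd fx fH, auto)
  show ?thesis
  proof (rule koszul_vanish_iso)
    show "h \<in> {f \<in> free_polys A (length a). (\<Sum>k<length a. f k * g k) \<in> J} \<inter> free_forms A a i \<longleftrightarrow>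
        h \<in> free_forms A a i \<and> ?f h \<in> J \<inter> forms A i" for h i
      using fH[of h i] free_forms_free_polys[of h A a i] by blast
    show "\<exists>h\<in>free_forms A a i. m - ?f h \<in> J \<inter> forms A i" if m: "m \<in> forms A i" for m i
    proof
      let ?h = "\<lambda>k. m * f k"
      have "m * (1 - ?f f) \<in> J" by (rule is_idealD(3)[OF iJ f(2)])
      then have "m - ?f ?h \<in> J" by (simp add: algebra_simps sum_distrib_left)
      then have "form_part A i (m - ?f ?h) \<in> J" using J by (simp add: graded_ideal_def)
      moreover have "form_part A i (m - ?f ?h) = m - ?f (free_part A a i ?h)"
        unfolding comp form_part_diff form_part_self[OF m] ..
      moreover have "form_part A i (m - ?f ?h) \<in> forms A i" by (rule form_part_forms)
      ultimately show "m - ?f (free_part A a i ?h) \<in> J \<inter> forms A i" by simp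
      show "free_part A a i ?h \<in> free_forms A a i" by (rule free_part_free_forms)
    qed
  qed
qed

lemma koszul_vanish_syz:
  fixes J :: "('v, 'k) mpoly set"
  assumes J: "graded_ideal A J" and res: "min_res J a g D" and p: "0 \<le> p"
  shows "koszul_vanish (mult_var_free e) N (free_forms A (a i)) (\<lambda>t. syz J a g D i \<inter> free_forms A (a i) t) p j \<longleftrightarrow> tor_vanish J (p + int i) j"
    and "f \<in> syz J a g D i \<Longrightarrow> lkp (f k) 0 = 0"
proof -
  have irr: "lkp (f k) 0 = 0" if f: "f \<in> syz J a g D i" for f k i
  proof -
    obtain h where h: "f = mat_apply (length (a i)) (length (a (Suc i))) (D i) h"
      using f res unfolding min_res_def by blast
    have "lkp (D i k l * h l) 0 = 0" if "k < length (a i)" "l < length (a (Suc i))" for l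
      using res that unfolding lookup_mult_zero by (simp add: min_res_def)
    then show ?thesis unfolding h by (simp add: mat_apply_def lookup_sum)
  qed
  then show "f \<in> syz J a g D i \<Longrightarrow> lkp (f k) 0 = 0" .
  show "koszul_vanish (mult_var_free e) N (free_forms A (a i)) (\<lambda>t. syz J a g D i \<inter> free_forms A (a i) t) p j \<longleftrightarrow> tor_vanish J (p + int i) j"
    using p
  proof (induction i arbitrary: p)
    case 0
    obtain f where "f \<in> free_polys A (length (a 0))" "1 - (\<Sum>k<length (a 0). f k * g k) \<in> J"
      using res unfolding min_res_def by blast
    from koszul_vanish_cover[OF J _ this, of p j] show ?case using res by (simp add: syz_def min_res_def)
  next
    case (Suc i p)
    have hm: "hom_matrix A (a i) (a (Suc i)) (D i)"
      and im: "mat_apply (length (a i)) (length (a (Suc i))) (D i) ` free_polys A (length (a (Suc i))) = syz J a g D i"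
      using res unfolding min_res_def by simp_all
    have s: "syz J a g D (Suc i) = {f \<in> free_polys A (length (a (Suc i))). mat_apply (length (a i)) (length (a (Suc i))) (D i) f = 0}"
      by (simp add: syz_def)
    have "koszul_vanish (mult_var_free e) N (free_forms A (a (Suc i))) (\<lambda>t. syz J a g D (Suc i) \<inter> free_forms A (a (Suc i)) t) p j \<longleftrightarrow>
        koszul_vanish (mult_var_free e) N (free_forms A (a i)) (\<lambda>t. syz J a g D i \<inter> free_forms A (a i) t) (p + 1) j"
      unfolding s by (rule koszul_vanish_resolution_step[OF hm im[symmetric] _ Suc.prems]) (rule irr)
    also have "\<dots> \<longleftrightarrow> tor_vanish J (p + 1 + int i) j" using Suc.prems by (intro Suc.IH) simp
    finally show ?case by (simp add: ac_simps)
  qed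
qed

theorem min_res_degrees:
  assumes "graded_ideal A J" "min_res J a g D"
  shows "j \<in> set (a i) \<longleftrightarrow> \<not> tor_vanish J (int i) j"
proof -
  have "0 \<in> syz J a g D i \<inter> free_forms A (a i) j"
  proof -
    have "mat_apply (length (a i)) (length (a (Suc i))) (D i) 0 \<in> syz J a g D i"
    proof -
      have im: "mat_apply (length (a i)) (length (a (Suc i))) (D i) ` free_polys A (length (a (Suc i))) = syz J a g D i"
        using assms(2) unfolding min_res_def by simp
      show ?thesis unfolding im[symmetric] by (rule imageI) (simp add: free_polys_def)
    qed
    moreover have "mat_apply (length (a i)) (length (a (Suc i))) (D i) 0 = 0" by (simp add: mat_apply_def fun_eq_iff)
    ultimately show ?thesis by (simp add: free_forms_def)
  qed
  then have "koszul_vanish (mult_var_free e) N (free_forms A (a i)) (\<lambda>t. syz J a g D i \<inter> free_forms A (a i) t) 0 j \<longleftrightarrow> j \<notin> set (a i)"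
    by (intro koszul_vanish_generators) (use koszul_vanish_syz(2)[OF assms order_refl] in auto)
  then show ?thesis using koszul_vanish_syz(1)[OF assms order_refl, of i j] by simp
qed

section \<open>Existence of minimal graded free resolutions\<close>

text \<open>The $K[A]$-submodule generated by \<open>G\<close>; the scalars form a subring and not a type.\<close>

inductive_set module_span :: "(nat \<Rightarrow> ('v, 'k) mpoly) set \<Rightarrow> (nat \<Rightarrow> ('v, 'k) mpoly) set" for G where
  zero: "0 \<in> module_span G"
| step: "h \<in> G \<Longrightarrow> c \<in> polys A \<Longrightarrow> f \<in> module_span G \<Longrightarrow> (\<lambda>k. c * h k) + f \<in> module_span G"

definition graded_submodule :: "int list \<Rightarrow> (nat \<Rightarrow> ('v, 'k) mpoly) set \<Rightarrow> bool" where
  "graded_submodule a U \<longleftrightarrow> U \<subseteq> free_polys A (length a) \<and> 0 \<in> U \<and> (\<forall>f\<in>U. \<forall>g\<in>U. f + g \<in> U) \<and>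
     (\<forall>c\<in>polys A. \<forall>f\<in>U. (\<lambda>k. c * f k) \<in> U) \<and> (\<forall>j. \<forall>f\<in>U. free_part A a j f \<in> U)"

lemma module_span_incl: "h \<in> G \<Longrightarrow> h \<in> module_span G"
  using module_span.step[of h G 1 0] module_span.zero[of G] by (simp add: zero_fun_def plus_fun_def)

lemma module_span_add: "f \<in> module_span G \<Longrightarrow> g \<in> module_span G \<Longrightarrow> f + g \<in> module_span G"
  by (induction rule: module_span.induct) (auto simp: add.assoc intro: module_span.step)

lemma module_span_scale: "f \<in> module_span G \<Longrightarrow> c \<in> polys A \<Longrightarrow> (\<lambda>k. c * f k) \<in> module_span G"
proof (induction rule: module_span.induct)
  case zero
  then show ?case using module_span.zero[of G] by (simp add: zero_fun_def)
next
  case (step h d f)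
  have "(\<lambda>k. c * ((\<lambda>k. d * h k) + f) k) = (\<lambda>k. (c * d) * h k) + (\<lambda>k. c * f k)"
    by (auto simp: algebra_simps)
  then show ?case using step by (auto intro: module_span.step polys_mult)
qed

lemma module_span_least:
  assumes "G \<subseteq> U" "0 \<in> U" "\<And>f g. f \<in> U \<Longrightarrow> g \<in> U \<Longrightarrow> f + g \<in> U"
    "\<And>c f. c \<in> polys A \<Longrightarrow> f \<in> U \<Longrightarrow> (\<lambda>k. c * f k) \<in> U"
  shows "module_span G \<subseteq> U"
proof
  fix f assume "f \<in> module_span G"
  then show "f \<in> U"
  proof induction
    case zero
    show ?case by (rule assms(2))
  next
    case (step h c f)
    show ?case by (rule assms(3)[OF assms(4)[OF step(2) subsetD[OF assms(1) step(1)]] step(4)])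
  qed
qed

lemma module_span_sub_span: "G \<subseteq> module_span H \<Longrightarrow> module_span G \<subseteq> module_span H"
  by (rule module_span_least) (auto intro: module_span.zero module_span_add module_span_scale)

lemma module_span_fsum: "finite S \<Longrightarrow> (\<And>i. i \<in> S \<Longrightarrow> f i \<in> module_span G) \<Longrightarrow> sum f S \<in> module_span G"
  by (induction S rule: finite_induct) (auto intro: module_span.zero module_span_add)

lemma module_span_list:
  "f \<in> module_span (set gs) \<longleftrightarrow>
    (\<exists>c. (\<forall>l<length gs. c l \<in> polys A) \<and> f = (\<lambda>k. \<Sum>l<length gs. c l * (gs ! l) k))"
proof
  assume "f \<in> module_span (set gs)"
  then show "\<exists>c. (\<forall>l<length gs. c l \<in> polys A) \<and> f = (\<lambda>k. \<Sum>l<length gs. c l * (gs ! l) k)"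
  proof induction
    case zero
    then show ?case by (intro exI[of _ "\<lambda>_. 0"]) (auto simp: fun_eq_iff)
  next
    case (step h d f)
    then obtain c where c: "\<forall>l<length gs. c l \<in> polys A" "f = (\<lambda>k. \<Sum>l<length gs. c l * (gs ! l) k)" by blast
    obtain m where m: "m < length gs" "h = gs ! m" using step(1) by (auto simp: in_set_conv_nth)
    \<comment> \<open>the list may contain other copies of \<open>h\<close>; only the coefficient of one position changes\<close>
    define c' where "c' = c(m := d + c m)"
    have "(\<Sum>l<length gs. c' l * (gs ! l) k) = d * h k + (\<Sum>l<length gs. c l * (gs ! l) k)" for k
    proof -
      have "(\<Sum>l<length gs. c' l * (gs ! l) k) = (\<Sum>l<length gs. (if l = m then d * h k else 0) + c l * (gs ! l) k)"
        by (intro sum.cong) (auto simp: c'_def m algebra_simps)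
      then show ?thesis using m by (simp add: sum.distrib)
    qed
    moreover have "\<forall>l<length gs. c' l \<in> polys A" using c(1) step(2) m by (auto simp: c'_def polys_add)
    ultimately show ?case using c(2) by (intro exI[of _ c']) (auto simp: fun_eq_iff)
  qed
next
  assume "\<exists>c. (\<forall>l<length gs. c l \<in> polys A) \<and> f = (\<lambda>k. \<Sum>l<length gs. c l * (gs ! l) k)"
  then obtain c where c: "\<forall>l<length gs. c l \<in> polys A" "f = (\<lambda>k. \<Sum>l<length gs. c l * (gs ! l) k)" by blast
  have "f = (\<Sum>l<length gs. (\<lambda>k. c l * (gs ! l) k))"
    unfolding c(2) by (rule ext) (simp add: sum_fun_apply)
  also have "\<dots> \<in> module_span (set gs)"
  proof (rule module_span_fsum)
    fix l assume "l \<in> {..<length gs}"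
    then have "gs ! l \<in> set gs" "c l \<in> polys A" using c(1) by simp_all
    then show "(\<lambda>k. c l * (gs ! l) k) \<in> module_span (set gs)" by (intro module_span_scale module_span_incl)
  qed simp
  finally show "f \<in> module_span (set gs)" .
qed

subsection \<open>Finite generation\<close>

definition scale_const :: "'k \<Rightarrow> (nat \<Rightarrow> ('v, 'k) mpoly) \<Rightarrow> nat \<Rightarrow> ('v, 'k) mpoly" where
  "scale_const c f = (\<lambda>k. sgl 0 c * f k)"

lemma vector_space_scale_const: "vector_space scale_const"
proof
  fix a b :: 'k and f g :: "nat \<Rightarrow> ('v, 'k) mpoly"
  show "scale_const a (f + g) = scale_const a f + scale_const a g" by (auto simp: scale_const_def distrib_left)
  show "scale_const (a + b) f = scale_const a f + scale_const b f" by (auto simp: scale_const_def single_add distrib_right)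
  show "scale_const a (scale_const b f) = scale_const (a * b) f" by (auto simp: scale_const_def mult_single simp flip: mult.assoc)
  show "scale_const 1 f = f" by (simp add: scale_const_def)
qed

lemma finite_monomials: "finite {m :: 'v \<Rightarrow>\<^sub>0 nat. mkeys m \<subseteq> A \<and> mono_deg m = d}"
proof -
  let ?M = "{m :: 'v \<Rightarrow>\<^sub>0 nat. mkeys m \<subseteq> A \<and> mono_deg m = d}"
  have "finite {f. \<forall>v. (v \<in> A \<longrightarrow> f v \<in> {..d}) \<and> (v \<notin> A \<longrightarrow> f v = (0::nat))}"
    by (rule finite_set_of_finite_funs) (use finite_A in auto)
  moreover have "lkp ` ?M \<subseteq> {f. \<forall>v. (v \<in> A \<longrightarrow> f v \<in> {..d}) \<and> (v \<notin> A \<longrightarrow> f v = (0::nat))}"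
  proof safe
    fix m :: "'v \<Rightarrow>\<^sub>0 nat" and v assume m: "mkeys m \<subseteq> A" "d = mono_deg m"
    show "lkp m v \<le> mono_deg m"
    proof (cases "v \<in> mkeys m")
      case True
      then show ?thesis unfolding mono_deg_def by (intro member_le_sum) auto
    next
      case False
      then show ?thesis by (simp add: in_keys_iff)
    qed
    show "lkp m v = 0" if "v \<notin> A" using m that by (auto simp: in_keys_iff)
  qed
  ultimately have "finite (lkp ` ?M)" by (rule finite_subset[rotated])
  then show ?thesis by (rule finite_imageD) (auto simp: inj_on_def lookup_inject)
qed

text \<open>A component lies in the $K$-span of the finitely many monomial vectors of its degree, so it has a finite
$K$-basis.\<close>

lemma component_finite:
  assumes "graded_submodule a U"
  shows "\<exists>G. finite G \<and> G \<subseteq> U \<inter> free_forms A a i \<and> U \<inter> free_forms A a i \<subseteq> module_span G"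
proof -
  interpret S: vector_space scale_const by (rule vector_space_scale_const)
  define mon where "mon = (\<lambda>(k0, m :: 'v \<Rightarrow>\<^sub>0 nat). \<lambda>k::nat. if k = k0 then sgl m (1::'k) else 0)"
  define E where "E = mon ` (SIGMA k:{..<length a}. {m. mkeys m \<subseteq> A \<and> mono_deg m = nat (i - a ! k)})"
  have finE: "finite E" unfolding E_def by (intro finite_imageI finite_SigmaI finite_monomials) simp
  have span: "f \<in> S.span E" if f: "f \<in> free_forms A a i" for f
  proof -
    have "f = (\<Sum>k<length a. \<Sum>m\<in>mkeys (f k). scale_const (lkp (f k) m) (mon (k, m)))"
    proof (rule ext, rule poly_mapping_eqI)
      fix k m
      have 1: "lkp (scale_const c (mon (k', m')) k) m = (if k = k' \<and> m = m' then c else 0)" for c k' m'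
        by (simp add: scale_const_def mon_def mult_single lookup_single when_def)
      have "lkp ((\<Sum>k<length a. \<Sum>m\<in>mkeys (f k). scale_const (lkp (f k) m) (mon (k, m))) k) m
          = (\<Sum>k'<length a. \<Sum>m'\<in>mkeys (f k'). if k = k' \<and> m = m' then lkp (f k') m' else 0)"
        by (simp add: sum_fun_apply lookup_sum 1)
      also have "\<dots> = (\<Sum>k'<length a. if k = k' then lkp (f k') m else 0)"
        by (rule sum.cong) (auto simp: in_keys_iff)
      also have "\<dots> = lkp (f k) m" using f by (auto simp: free_forms_def)
      finally show "lkp (f k) m = lkp ((\<Sum>k<length a. \<Sum>m\<in>mkeys (f k). scale_const (lkp (f k) m) (mon (k, m))) k) m" ..
    qed
    also have "\<dots> \<in> S.span E"
    proof (intro S.span_sum S.span_scale S.span_base)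
      fix k m assume "k \<in> {..<length a}" "m \<in> mkeys (f k)"
      moreover from this have "mkeys m \<subseteq> A \<and> int (mono_deg m) = i - a ! k" using f by (auto simp: free_forms_def forms_def)
      ultimately show "mon (k, m) \<in> E" unfolding E_def by (intro imageI) auto
    qed
    finally show ?thesis .
  qed
  obtain B where B: "B \<subseteq> U \<inter> free_forms A a i" "S.independent B" "U \<inter> free_forms A a i \<subseteq> S.span B"
    by (rule S.maximal_independent_subset)
  have "B \<subseteq> S.span E" using B(1) span by auto
  then have "finite B" using S.independent_span_bound[OF finE B(2)] by simp
  moreover have "S.span B \<subseteq> module_span B"
  proof
    fix f assume "f \<in> S.span B"
    then show "f \<in> module_span B"
    proof (induction rule: S.span_induct_alt)
      case base
      show ?case by (rule module_span.zero)
    next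
      case (step c g h)
      then show ?case unfolding scale_const_def by (intro module_span.step) simp_all
    qed
  qed
  ultimately show ?thesis using B by (intro exI[of _ B]) auto
qed

lemma free_part_decompose:
  assumes "f \<in> free_polys A (length a)"
  shows "\<exists>S. finite S \<and> f = (\<Sum>d\<in>S. free_part A a d f)"
proof -
  let ?S = "\<Union>k<length a. (\<lambda>m. a ! k + int (mono_deg m)) ` mkeys (f k)"
  have fin: "finite ?S" by simp
  have "f = (\<Sum>d\<in>?S. free_part A a d f)"
  proof (rule ext, rule poly_mapping_eqI)
    fix k m
    show "lkp (f k) m = lkp ((\<Sum>d\<in>?S. free_part A a d f) k) m"
    proof (cases "k < length a \<and> m \<in> mkeys (f k)")
      case True
      then have "mkeys m \<subseteq> A" using assms by (auto simp: free_polys_def polys_def)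
      then have "lkp (free_part A a d f k) m = (if d = a ! k + int (mono_deg m) then lkp (f k) m else 0)" for d
        using True by (auto simp: free_part_def form_part_def lookup_restr)
      moreover have "a ! k + int (mono_deg m) \<in> ?S" using True by blast
      ultimately show ?thesis using fin by (simp add: sum_fun_apply lookup_sum)
    next
      case False
      then have "lkp (f k) m = 0" using assms by (auto simp: free_polys_def in_keys_iff)
      then have "lkp (free_part A a d f k) m = 0" for d by (simp add: free_part_def form_part_def lookup_restr)
      then show ?thesis using \<open>lkp (f k) m = 0\<close> by (simp add: sum_fun_apply lookup_sum)
    qed
  qed
  then show ?thesis using fin by blast
qed

text \<open>$H_1(F/U)_j = (U/\mathfrak m U)_j$ for $U \subseteq \mathfrak m F$. If it vanishes, then an element of $U$ of degree $j$ is a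
combination of the variables with coefficients in $U$ of degree $j - 1$.\<close>

lemma generators_bounded:
  assumes U: "graded_submodule a U" and irr: "\<forall>f\<in>U. \<forall>k. lkp (f k) 0 = 0"
    and R: "\<And>j. R < j \<Longrightarrow> koszul_vanish (mult_var_free e) N (free_forms A a) (\<lambda>i. U \<inter> free_forms A a i) 1 j"
    and G: "\<And>i. i \<le> R \<Longrightarrow> U \<inter> free_forms A a i \<subseteq> module_span G"
  shows "U \<inter> free_forms A a j \<subseteq> module_span G"
proof (induction "nat (j - R)" arbitrary: j rule: less_induct)
  case less
  show ?case
  proof (cases "j \<le> R")
    case True
    then show ?thesis by (rule G)
  next
    case False
    show ?thesis
    proof
      fix u assume u: "u \<in> U \<inter> free_forms A a j"
      have "\<exists>z. koszul_chain N (free_forms A a) 1 j z \<and> u = koszul_d (mult_var_free e) N z {}"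
        by (rule free_boundary) (use u irr in auto)
      then obtain z where z: "koszul_chain N (free_forms A a) 1 j z" "u = koszul_d (mult_var_free e) N z {}" by blast
      have dz: "koszul_chain N (\<lambda>i. U \<inter> free_forms A a i) (1 - 1) j (koszul_d (mult_var_free e) N z)"
        unfolding koszul_chain_def
      proof (intro allI impI)
        fix T assume T: "T \<subseteq> {..<N}" "int (card T) = 1 - 1"
        then have "T = {}" using finite_subset_lessThan[OF T(1)] by simp
        then show "koszul_d (mult_var_free e) N z T \<in> U \<inter> free_forms A a (j - (1 - 1))" using u z(2) by simp
      qed
      have "R < j" using False by simp
      obtain y where y: "koszul_chain N (\<lambda>i. U \<inter> free_forms A a i) 1 j (\<lambda>T. z T - koszul_d (mult_var_free e) N y T)"
        using F.koszul_vanishD[OF R[OF \<open>R < j\<close>] z(1) dz] .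
      define s where "s = (\<lambda>T. z T - koszul_d (mult_var_free e) N y T)"
      have "u = koszul_d (mult_var_free e) N s {}" by (simp add: s_def F.koszul_d_diff F.koszul_d_koszul_d z(2))
      also have "\<dots> = (\<Sum>v<N. mult_var_free e v (s {v}))" by (rule koszul_d_empty)
      also have "\<dots> \<in> module_span G"
      proof (rule module_span_fsum)
        fix v assume v: "v \<in> {..<N}"
        have "s {v} \<in> U \<inter> free_forms A a (j - 1)" unfolding s_def by (rule kcD[OF y]) (use v in auto)
        moreover have "nat (j - 1 - R) < nat (j - R)" using \<open>R < j\<close> by simp
        ultimately have "s {v} \<in> module_span G" using less by blast
        then show "mult_var_free e v (s {v}) \<in> module_span G"
          unfolding mult_var_free_def by (rule module_span_scale) (use v e_A in \<open>auto intro: forms_polys Var_forms\<close>)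
      qed simp
      finally show "u \<in> module_span G" .
    qed
  qed
qed

lemma finitely_generated:
  assumes U: "graded_submodule a U" and irr: "\<forall>f\<in>U. \<forall>k. lkp (f k) 0 = 0"
    and R: "\<And>j. R < j \<Longrightarrow> koszul_vanish (mult_var_free e) N (free_forms A a) (\<lambda>i. U \<inter> free_forms A a i) 1 j"
  shows "\<exists>G. finite G \<and> (\<forall>g\<in>G. \<exists>i. g \<in> free_forms A a i) \<and> module_span G = U"
proof -
  have "\<forall>i. \<exists>G. finite G \<and> G \<subseteq> U \<inter> free_forms A a i \<and> U \<inter> free_forms A a i \<subseteq> module_span G"
    using component_finite[OF U] by simp
  from choice[OF this] obtain H where HH: "\<forall>i. finite (H i) \<and> H i \<subseteq> U \<inter> free_forms A a i \<and> U \<inter> free_forms A a i \<subseteq> module_span (H i)"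
    by (rule exE)
  have H: "finite (H i)" "H i \<subseteq> U \<inter> free_forms A a i" "U \<inter> free_forms A a i \<subseteq> module_span (H i)" for i
    using spec[OF HH, of i] by simp_all
  \<comment> \<open>there are no forms of degree below \<open>b\<close>, so finitely many degrees remain\<close>
  define b where "b = Min (insert 0 (set a))"
  define G where "G = (\<Union>i\<in>{b..R}. H i)"
  have sub: "module_span (H i) \<subseteq> module_span G" if "i \<in> {b..R}" for i
  proof (rule module_span_sub_span, rule subsetI)
    fix h assume "h \<in> H i"
    then have "h \<in> G" unfolding G_def using that by (rule UN_I[rotated])
    then show "h \<in> module_span G" by (rule module_span_incl)
  qed
  have low: "f = 0" if f: "f \<in> free_forms A a i" "i < b" for f i
  proof
    fix k
    show "f k = 0 k"
    proof (cases "k < length a")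
      case True
      then have "b \<le> a ! k" unfolding b_def by (intro Min_le) auto
      then show ?thesis using f True forms_neg[of "i - a ! k" "f k" A] by (simp add: free_forms_def)
    next
      case False
      then show ?thesis using f by (simp add: free_forms_def)
    qed
  qed
  have "U \<inter> free_forms A a i \<subseteq> module_span G" if "i \<le> R" for i
  proof (cases "i < b")
    case True
    then show ?thesis using low module_span.zero[of G] by auto
  next
    case False
    then show ?thesis using sub[of i] H(3)[of i] that by auto
  qed
  from generators_bounded[OF U irr R this] have all: "U \<inter> free_forms A a j \<subseteq> module_span G" for j by simp
  have "module_span G = U"
  proof
    show "module_span G \<subseteq> U"
    proof (rule module_span_least)
      show "G \<subseteq> U" unfolding G_def using H(2) by auto
    qed (use U in \<open>auto simp: graded_submodule_def\<close>)
    show "U \<subseteq> module_span G"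
    proof
      fix f assume f: "f \<in> U"
      then have "f \<in> free_polys A (length a)" using U by (auto simp: graded_submodule_def)
      then obtain S where S: "finite S" "f = (\<Sum>d\<in>S. free_part A a d f)" using free_part_decompose by metis
      have "free_part A a d f \<in> module_span G" for d
      proof -
        have "free_part A a d f \<in> U" using U f by (simp add: graded_submodule_def)
        then show ?thesis using all[of d] free_part_free_forms[of A a d f] by auto
      qed
      then show "f \<in> module_span G" by (subst S(2)) (rule module_span_fsum[OF S(1)])
    qed
  qed
  moreover have "finite G" unfolding G_def using H(1) by simp
  moreover have "\<exists>i. g \<in> free_forms A a i" if "g \<in> G" for g using that H(2) unfolding G_def by auto
  ultimately show ?thesis by blast
qed

subsection \<open>Minimal generators\<close>

text \<open>For a generating set of minimal cardinality, a relation with an invertible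
constant term could be solved for one of the generators, after passing to the homogeneous component in which the constant
term lies.\<close>

lemma minimal_generators:
  assumes U: "graded_submodule a U"
    and fin: "\<exists>G. finite G \<and> (\<forall>g\<in>G. \<exists>i. g \<in> free_forms A a i) \<and> module_span G = U"
  shows "\<exists>a' D. hom_matrix A a a' D \<and> mat_apply (length a) (length a') D ` free_polys A (length a') = U \<and>
    (\<forall>f k. f \<in> free_polys A (length a') \<longrightarrow> mat_apply (length a) (length a') D f = 0 \<longrightarrow> lkp (f k) 0 = 0) \<and>
    (\<forall>l<length a'. (\<lambda>k. if k < length a then D k l else 0) \<in> U)"
proof -
  define P where "P = (\<lambda>G. finite G \<and> (\<forall>g\<in>G. \<exists>i. g \<in> free_forms A a i) \<and> module_span G = U)"
  have "\<exists>G. P G" using fin unfolding P_def .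
  then obtain G where PG: "P G" and min: "\<And>H. P H \<Longrightarrow> card G \<le> card H"
    using ex_has_least_nat[of P _ card] by blast
  have G: "finite G" "\<And>g. g \<in> G \<Longrightarrow> \<exists>i. g \<in> free_forms A a i" "module_span G = U"
    using PG unfolding P_def by auto
  obtain gs where gs: "set gs = G" "distinct gs" using finite_distinct_list[OF G(1)] by blast
  define dg where "dg = (\<lambda>g :: nat \<Rightarrow> ('v, 'k) mpoly. SOME i. g \<in> free_forms A a i)"
  have dg: "g \<in> free_forms A a (dg g)" if "g \<in> G" for g
    unfolding dg_def using G(2)[OF that] by (rule someI_ex)
  define a' where "a' = map dg gs"
  define D where "D = (\<lambda>k l. (gs ! l) k)"
  have len: "length a' = length gs" by (simp add: a'_def)
  have gsl: "gs ! l \<in> G" if "l < length gs" for l using that gs(1) by auto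
  have gsFH: "gs ! l \<in> free_forms A a (a' ! l)" if "l < length gs" for l
    using dg[OF gsl[OF that]] that by (simp add: a'_def)
  have gs0: "(gs ! l) k = 0" if "l < length gs" "\<not> k < length a" for l k
    using gsFH[OF that(1)] that(2) by (simp add: free_forms_def)
  have hm: "hom_matrix A a a' D"
    unfolding hom_matrix_def
  proof (intro allI impI)
    fix k l assume "k < length a" "l < length a'"
    then show "D k l \<in> forms A (a' ! l - a ! k)" using gsFH[of l] by (simp add: free_forms_def D_def len)
  qed
  have mfD: "mat_apply (length a) (length a') D f = (\<lambda>k. \<Sum>l<length gs. f l * (gs ! l) k)" for f
  proof
    fix k
    show "mat_apply (length a) (length a') D f k = (\<Sum>l<length gs. f l * (gs ! l) k)"
      by (cases "k < length a") (simp_all add: mat_apply_def D_def len mult.commute gs0)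
  qed
  have img: "mat_apply (length a) (length a') D ` free_polys A (length a') = U"
  proof
    show "mat_apply (length a) (length a') D ` free_polys A (length a') \<subseteq> U"
    proof
      fix h assume "h \<in> mat_apply (length a) (length a') D ` free_polys A (length a')"
      then obtain f where f: "f \<in> free_polys A (length a')" "h = mat_apply (length a) (length a') D f" by (rule imageE)
      have "h \<in> module_span (set gs)" unfolding module_span_list
      proof (intro exI[of _ f] conjI)
        show "\<forall>l<length gs. f l \<in> polys A" using f(1) by (simp add: free_polys_def len)
        show "h = (\<lambda>k. \<Sum>l<length gs. f l * (gs ! l) k)" unfolding f(2) by (rule mfD)
      qed
      then show "h \<in> U" using G(3) gs(1) by simp
    qed
    show "U \<subseteq> mat_apply (length a) (length a') D ` free_polys A (length a')"
    proof
      fix h assume "h \<in> U"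
      then have "h \<in> module_span (set gs)" using G(3) gs(1) by simp
      then obtain c where c: "\<forall>l<length gs. c l \<in> polys A" "h = (\<lambda>k. \<Sum>l<length gs. c l * (gs ! l) k)"
        unfolding module_span_list by (elim exE conjE)
      let ?f = "\<lambda>l. if l < length gs then c l else 0"
      have "h = mat_apply (length a) (length a') D ?f" unfolding mfD c(2) by simp
      moreover have "?f \<in> free_polys A (length a')" using c(1) by (simp add: free_polys_def len)
      ultimately show "h \<in> mat_apply (length a) (length a') D ` free_polys A (length a')" by (rule image_eqI)
    qed
  qed
  have "lkp (f k) 0 = 0" if f: "f \<in> free_polys A (length a')" "mat_apply (length a) (length a') D f = 0" for f k
  proof (rule ccontr)
    assume c: "lkp (f k) 0 \<noteq> 0"
    define c where "c = lkp (f k) 0"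
    have kl: "k < length gs" using \<open>lkp (f k) 0 \<noteq> 0\<close> f(1) by (cases "k < length gs") (auto simp: free_polys_def len)
    \<comment> \<open>in the degree of the \<open>k\<close>-th generator, its coefficient becomes the constant \<open>c\<close>\<close>
    define h where "h = free_part A a' (a' ! k) f"
    have "mat_apply (length a) (length a') D h = free_part A a (a' ! k) (mat_apply (length a) (length a') D f)"
      unfolding h_def by (rule free_part_mat_apply[OF hm, symmetric])
    also have "\<dots> = 0" unfolding f(2) by (auto simp: free_part_def)
    finally have h0: "(\<Sum>l<length gs. h l * (gs ! l) i) = 0" for i unfolding mfD by (simp add: fun_eq_iff)
    have "f k \<in> polys A" using f(1) kl by (simp add: free_polys_def len)
    then have hk: "h k = sgl 0 c"
      using kl by (intro poly_mapping_eqI) (auto simp: h_def free_part_def len form_part_def lookup_restr lookup_single when_def c_def mono_deg_eq_0)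
    let ?g = "gs ! k"
    have gG: "?g \<in> G" by (rule gsl[OF kl])
    have "?g = (\<Sum>l\<in>{..<length gs} - {k}. (\<lambda>i. (- sgl 0 (1 / c) * h l) * (gs ! l) i))"
    proof
      fix i
      have "h k * ?g i + (\<Sum>l\<in>{..<length gs} - {k}. h l * (gs ! l) i) = 0"
        using h0[of i] kl by (subst (asm) sum.remove[of _ k]) auto
      then have "sgl 0 c * ?g i = - (\<Sum>l\<in>{..<length gs} - {k}. h l * (gs ! l) i)"
        by (simp add: hk eq_neg_iff_add_eq_0)
      then have "sgl 0 (1 / c) * (sgl 0 c * ?g i) = - sgl 0 (1 / c) * (\<Sum>l\<in>{..<length gs} - {k}. h l * (gs ! l) i)"
        by simp
      moreover have "sgl 0 (1 / c) * (sgl 0 c * ?g i) = ?g i"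
        using c by (simp add: mult_single c_def flip: mult.assoc)
      ultimately show "?g i = (\<Sum>l\<in>{..<length gs} - {k}. (\<lambda>i. (- sgl 0 (1 / c) * h l) * (gs ! l) i)) i"
        by (simp add: sum_fun_apply sum_distrib_left sum_negf mult.assoc)
    qed
    also have "\<dots> \<in> module_span (G - {?g})"
    proof (rule module_span_fsum)
      fix l assume l: "l \<in> {..<length gs} - {k}"
      then have "gs ! l \<in> G - {?g}" using gsl[of l] gs(2) kl by (auto simp: nth_eq_iff_index_eq)
      moreover have "h l \<in> polys A" using l by (auto simp: h_def free_part_def intro: forms_polys[OF form_part_forms])
      then have "- sgl 0 (1 / c) * h l \<in> polys A"
        using polys_mult[OF polys_const[of "- (1 / c)" A]] by (simp add: single_uminus)
      ultimately show "(\<lambda>i. (- sgl 0 (1 / c) * h l) * (gs ! l) i) \<in> module_span (G - {?g})"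
        by (intro module_span_scale module_span_incl)
    qed simp
    finally have "?g \<in> module_span (G - {?g})" .
    then have "x \<in> module_span (G - {?g})" if "x \<in> G" for x
      using module_span_incl[of x "G - {?g}"] that by (cases "x = ?g") simp_all
    then have "G \<subseteq> module_span (G - {?g})" by (rule subsetI)
    then have "module_span G \<subseteq> module_span (G - {?g})" by (rule module_span_sub_span)
    moreover have "module_span (G - {?g}) \<subseteq> module_span G"
      by (rule module_span_sub_span) (use module_span_incl in auto)
    ultimately have "P (G - {?g})" unfolding P_def using G by auto
    then have "card G \<le> card (G - {?g})" by (rule min)
    moreover have "card (G - {?g}) < card G" using G(1) gG by (rule card_Diff1_less)
    ultimately show False by simp
  qed
  moreover have "(\<lambda>k. if k < length a then D k l else 0) \<in> U" if "l < length a'" for l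
  proof -
    have "(\<lambda>k. if k < length a then D k l else 0) = gs ! l"
      using gs0[of l] that by (auto simp: D_def len)
    then show ?thesis using module_span_incl[OF gsl[of l]] that G(3) len by simp
  qed
  ultimately show ?thesis using hm img by blast
qed

text \<open>The properties of a syzygy module that allow the construction of the resolution to continue; each step
raises the bound \<open>R\<close> by one.\<close>

definition syz_inv :: "int list \<times> (nat \<Rightarrow> ('v, 'k) mpoly) set \<Rightarrow> bool" where
  "syz_inv s \<longleftrightarrow> graded_submodule (fst s) (snd s) \<and> (\<forall>f\<in>snd s. \<forall>k. lkp (f k) 0 = 0) \<and>
     (\<exists>R. \<forall>p j. 0 \<le> p \<longrightarrow> R + p < j \<longrightarrow> koszul_vanish (mult_var_free e) N (free_forms A (fst s)) (\<lambda>i. snd s \<inter> free_forms A (fst s) i) p j)"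

definition syz_step :: "int list \<times> (nat \<Rightarrow> ('v, 'k) mpoly) set \<Rightarrow> int list \<times> (nat \<Rightarrow> ('v, 'k) mpoly) set \<Rightarrow>
    (nat \<Rightarrow> nat \<Rightarrow> ('v, 'k) mpoly) \<Rightarrow> bool" where
  "syz_step s t D \<longleftrightarrow> hom_matrix A (fst s) (fst t) D \<and>
     mat_apply (length (fst s)) (length (fst t)) D ` free_polys A (length (fst t)) = snd s \<and>
     snd t = {f \<in> free_polys A (length (fst t)). mat_apply (length (fst s)) (length (fst t)) D f = 0} \<and>
     (\<forall>k<length (fst s). \<forall>l<length (fst t). lkp (D k l) 0 = 0)"

lemma graded_submodule_kernel:
  assumes D: "hom_matrix A a a' D"
  shows "graded_submodule a' {f \<in> free_polys A (length a'). mat_apply (length a) (length a') D f = 0}"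
  unfolding graded_submodule_def
proof (intro conjI ballI allI)
  let ?K = "{f \<in> free_polys A (length a'). mat_apply (length a) (length a') D f = 0}"
  show "?K \<subseteq> free_polys A (length a')" by auto
  show "0 \<in> ?K" by (simp add: free_polys_def mat_apply_def fun_eq_iff)
  show "f + g \<in> ?K" if "f \<in> ?K" "g \<in> ?K" for f g
  proof -
    have "mat_apply (length a) (length a') D (f + g) = mat_apply (length a) (length a') D f + mat_apply (length a) (length a') D g"
      by (auto simp: mat_apply_def fun_eq_iff distrib_left sum.distrib)
    then show ?thesis using that by (simp add: free_polys_def polys_add)
  qed
  show "(\<lambda>k. c * f k) \<in> ?K" if c: "c \<in> polys A" and f: "f \<in> ?K" for c f
  proof -
    have "mat_apply (length a) (length a') D (\<lambda>k. c * f k) = (\<lambda>k. c * mat_apply (length a) (length a') D f k)"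
      by (auto simp: mat_apply_def fun_eq_iff sum_distrib_left mult.left_commute)
    then show ?thesis using c f by (simp add: free_polys_def polys_mult fun_eq_iff)
  qed
  show "free_part A a' j f \<in> ?K" if f: "f \<in> ?K" for j f
  proof -
    have "mat_apply (length a) (length a') D (free_part A a' j f) = free_part A a j (mat_apply (length a) (length a') D f)"
      by (rule free_part_mat_apply[OF D, symmetric])
    also have "\<dots> = 0" using f by (auto simp: free_part_def)
    finally show ?thesis using free_forms_free_polys[OF free_part_free_forms[of A a' j f]] by simp
  qed
qed

lemma syz_step_exists:
  assumes s: "syz_inv s"
  shows "\<exists>t. syz_inv t \<and> (\<exists>D. syz_step s t D)"
proof -
  obtain a U where sU: "s = (a, U)" by (cases s)
  have U: "graded_submodule a U" and irr: "\<forall>f\<in>U. \<forall>k. lkp (f k) 0 = 0"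
    using s unfolding syz_inv_def sU by auto
  have "\<exists>R. \<forall>p j. 0 \<le> p \<longrightarrow> R + p < j \<longrightarrow> koszul_vanish (mult_var_free e) N (free_forms A a) (\<lambda>i. U \<inter> free_forms A a i) p j"
    using s unfolding syz_inv_def sU fst_conv snd_conv by simp
  then obtain R where RR: "\<forall>p j. 0 \<le> p \<longrightarrow> R + p < j \<longrightarrow> koszul_vanish (mult_var_free e) N (free_forms A a) (\<lambda>i. U \<inter> free_forms A a i) p j"
    by (rule exE)
  have R: "koszul_vanish (mult_var_free e) N (free_forms A a) (\<lambda>i. U \<inter> free_forms A a i) p j" if "0 \<le> p" "R + p < j" for p j
    using RR that by simp
  have R1: "koszul_vanish (mult_var_free e) N (free_forms A a) (\<lambda>i. U \<inter> free_forms A a i) 1 j" if "R + 1 < j" for j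
    using R[of 1 j] that by simp
  have "\<exists>G. finite G \<and> (\<forall>g\<in>G. \<exists>i. g \<in> free_forms A a i) \<and> module_span G = U"
    by (rule finitely_generated[OF U irr, of "R + 1"]) (rule R1)
  from minimal_generators[OF U this] obtain a' D where
    D12: "hom_matrix A a a' D" "mat_apply (length a) (length a') D ` free_polys A (length a') = U"
    and D3: "\<forall>f k. f \<in> free_polys A (length a') \<longrightarrow> mat_apply (length a) (length a') D f = 0 \<longrightarrow> lkp (f k) 0 = 0"
    and D4: "\<forall>l<length a'. (\<lambda>k. if k < length a then D k l else 0) \<in> U"
    by (elim exE conjE)
  note D = D12 spec[OF spec[OF D3], THEN mp, THEN mp] spec[OF D4, THEN mp]
  let ?K = "{f \<in> free_polys A (length a'). mat_apply (length a) (length a') D f = 0}"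
  have "lkp (D k l) 0 = 0" if "k < length a" "l < length a'" for k l
    using spec[OF bspec[OF irr D(4)[OF that(2)]], of k] that(1) by simp
  then have "syz_step s (a', ?K) D" using D(1,2) by (simp add: syz_step_def sU)
  moreover have "koszul_vanish (mult_var_free e) N (free_forms A a') (\<lambda>i. ?K \<inter> free_forms A a' i) p j" if p: "0 \<le> p" "R + 1 + p < j" for p j
  proof -
    have "koszul_vanish (mult_var_free e) N (free_forms A a') (\<lambda>i. ?K \<inter> free_forms A a' i) p j \<longleftrightarrow> koszul_vanish (mult_var_free e) N (free_forms A a) (\<lambda>i. U \<inter> free_forms A a i) (p + 1) j"
      by (rule koszul_vanish_resolution_step[OF D(1) D(2)[symmetric] _ p(1)]) (use irr in simp)
    then show ?thesis using R[of "p + 1" j] p by simp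
  qed
  then have "syz_inv (a', ?K)"
    unfolding syz_inv_def fst_conv snd_conv using graded_submodule_kernel[OF D(1)] D(3)
    by (intro conjI exI[of _ "R + 1"]) simp_all
  ultimately show ?thesis by blast
qed

theorem min_res_exists:
  assumes J: "graded_ideal A J" and irr: "\<And>f. f \<in> J \<Longrightarrow> lkp f 0 = 0"
    and R: "reg_le J R"
  shows "\<exists>a D. min_res J a (\<lambda>_. 1) D"
proof -
  let ?a0 = "[0::int]"
  define U0 where "U0 = {f \<in> free_polys A (length ?a0). (\<Sum>k<length ?a0. f k * 1) \<in> J}"
  have iJ: "is_ideal J" using J by (simp add: graded_ideal_def)
  have one: "(1 :: ('v, 'k) mpoly) \<in> forms A 0" by (simp add: forms_def)
  let ?u = "\<lambda>k::nat. if k = 0 then 1 else (0 :: ('v, 'k) mpoly)"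
  have u: "?u \<in> free_polys A (length ?a0)" by (simp add: free_polys_def)
  have u1: "1 - (\<Sum>k<length ?a0. ?u k * 1) \<in> J" using is_idealD(1)[OF iJ] by simp
  have "graded_submodule ?a0 U0"
    unfolding graded_submodule_def
  proof (intro conjI ballI allI)
    show "free_part A ?a0 j f \<in> U0" if f: "f \<in> U0" for j f
    proof -
      have "form_part A j (f 0) \<in> J" using f J by (simp add: U0_def graded_ideal_def)
      then show ?thesis using free_forms_free_polys[OF free_part_free_forms[of A ?a0 j f]] by (simp add: U0_def free_part_def)
    qed
  qed (use iJ in \<open>auto simp: U0_def free_polys_def polys_add polys_mult is_idealD\<close>)
  moreover have "lkp (f k) 0 = 0" if "f \<in> U0" for f k
    using that irr by (cases "k = 0") (auto simp: U0_def free_polys_def)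
  moreover have "koszul_vanish (mult_var_free e) N (free_forms A ?a0) (\<lambda>i. U0 \<inter> free_forms A ?a0 i) p j" if "0 \<le> p" "R + p < j" for p j
  proof -
    have "tor_vanish J p j" using R that by (simp add: reg_le_def)
    then show ?thesis
      unfolding U0_def using koszul_vanish_cover[OF J _ u u1, of p j] one by simp
  qed
  ultimately have inv0: "syz_inv (?a0, U0)"
    unfolding syz_inv_def fst_conv snd_conv by (intro conjI exI[of _ R]) simp_all
  have "\<exists>f. \<forall>n. (syz_inv (f n) \<and> (n = 0 \<longrightarrow> f n = (?a0, U0))) \<and> (\<exists>D. syz_step (f n) (f (Suc n)) D)"
  proof (rule dependent_nat_choice)
    show "\<exists>s. syz_inv s \<and> (0 = (0::nat) \<longrightarrow> s = (?a0, U0))" using inv0 by auto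
    show "\<exists>t. (syz_inv t \<and> (Suc n = 0 \<longrightarrow> t = (?a0, U0))) \<and> (\<exists>D. syz_step s t D)"
      if "syz_inv s \<and> (n = 0 \<longrightarrow> s = (?a0, U0))" for s and n :: nat
      using syz_step_exists[of s] that by simp
  qed
  then obtain f where f0: "f 0 = (?a0, U0)" and fs: "\<forall>n. \<exists>D. syz_step (f n) (f (Suc n)) D" by blast
  from choice[OF fs] obtain D where D: "\<forall>n. syz_step (f n) (f (Suc n)) (D n)" by (rule exE)
  define a where "a = (\<lambda>n. fst (f n))"
  have st: "syz_step (f n) (f (Suc n)) (D n)" for n using D by simp
  have sz: "snd (f n) = syz J a (\<lambda>_. 1) D n" for n
  proof (cases n)
    case 0
    then show ?thesis by (simp add: syz_def a_def f0 U0_def)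
  next
    case (Suc m)
    then show ?thesis using st[of m] by (simp add: syz_def a_def syz_step_def)
  qed
  have "min_res J a (\<lambda>_. 1) D"
    unfolding min_res_def
  proof (intro conjI allI impI)
    show "(1 :: ('v, 'k) mpoly) \<in> forms A (a 0 ! k)" if "k < length (a 0)" for k using that one by (simp add: a_def f0)
    show "\<exists>f\<in>free_polys A (length (a 0)). 1 - (\<Sum>k<length (a 0). f k * 1) \<in> J"
      using u u1 by (intro bexI[of _ ?u]) (simp_all add: a_def f0)
  qed (use st sz in \<open>auto simp: syz_step_def a_def\<close>)
  then show ?thesis by blast
qed

end

section \<open>Ideals of the subring and of the full polynomial ring\<close>

text \<open>Setting the variables outside \<open>A\<close> to zero turns a combination of the generators with coefficients in all
variables into one over $K[A]$.\<close>

lemma poly_ring_genideal: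
  fixes G :: "('v, 'k::field) mpoly set"
  assumes G: "G \<subseteq> polys A"
  shows "Idl\<^bsub>poly_ring A\<^esub> G = idl G \<inter> polys A"
proof
  let ?R = "poly_ring A :: ('v, 'k) mpoly ring"
  interpret R: cring ?R by (rule cring_poly_ring)
  note I = is_idealD[OF is_ideal_idl[of G]]
  have neg: "\<ominus>\<^bsub>?R\<^esub> f = - f" if "f \<in> polys A" for f
  proof (rule R.minus_equality)
    show "- f \<oplus>\<^bsub>?R\<^esub> f = \<zero>\<^bsub>?R\<^esub>" by simp
    show "f \<in> carrier ?R" "- f \<in> carrier ?R" using that polys_diff[OF polys_zero that] by (simp_all add: carrier_poly_ring)
  qed
  have "ideal (idl G \<inter> polys A) ?R"
  proof (rule idealI)
    show "ring ?R" by (rule R.ring_axioms)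
    show "subgroup (idl G \<inter> polys A) (add_monoid ?R)"
    proof (rule subgroup.intro)
      show "idl G \<inter> polys A \<subseteq> carrier (add_monoid ?R)" by (simp add: carrier_poly_ring)
      fix x assume "x \<in> idl G \<inter> polys A"
      then have x: "x \<in> idl G" "x \<in> polys A" by simp_all
      have "inv\<^bsub>add_monoid ?R\<^esub> x = - x" using neg[OF x(2)] by (simp add: a_inv_def)
      then show "inv\<^bsub>add_monoid ?R\<^esub> x \<in> idl G \<inter> polys A"
        using I(5)[OF x(1)] polys_diff[OF polys_zero x(2)] by simp
    qed (auto simp: I(1,2) polys_add)
  qed (auto simp: carrier_poly_ring I(3,4) polys_mult)
  then show "Idl\<^bsub>?R\<^esub> G \<subseteq> idl G \<inter> polys A"
    using G idl_incl by (intro R.genideal_minimal) auto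
  have Gc: "G \<subseteq> carrier ?R" using G by (simp add: carrier_poly_ring)
  interpret J: ideal "Idl\<^bsub>?R\<^esub> G" ?R by (rule R.genideal_ideal[OF Gc])
  have av: "zero_vars (UNIV - A) f \<in> Idl\<^bsub>?R\<^esub> G" if "f \<in> idl G" for f
    using that
  proof induction
    case zero
    then show ?case using J.zero_closed by simp
  next
    case (step g f c)
    have gP: "g \<in> polys A" using step(1) G by (rule subsetD[rotated])
    have "zero_vars (UNIV - A) g = g"
      unfolding zero_vars_def by (rule restr_self) (use gP in \<open>auto simp: polys_def\<close>)
    moreover have "zero_vars (UNIV - A) c \<in> polys A" by (auto simp: polys_def zero_vars_def keys_restr)
    then have "zero_vars (UNIV - A) c \<otimes>\<^bsub>?R\<^esub> g \<in> Idl\<^bsub>?R\<^esub> G"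
      using R.genideal_self[OF Gc] step(1) by (intro J.I_l_closed) (auto simp: carrier_poly_ring)
    ultimately show ?case using J.a_closed[OF _ step(3)] by (simp add: zero_vars_add zero_vars_mult)
  qed
  show "idl G \<inter> polys A \<subseteq> Idl\<^bsub>?R\<^esub> G"
  proof
    fix f assume f: "f \<in> idl G \<inter> polys A"
    have "zero_vars (UNIV - A) f = f"
      unfolding zero_vars_def by (rule restr_self) (use f in \<open>auto simp: polys_def\<close>)
    then show "f \<in> Idl\<^bsub>?R\<^esub> G" using av[of f] f by simp
  qed
qed

lemma irrelevant_ideal_iff:
  "(f :: ('v, 'k::field) mpoly) \<in> irrelevant_ideal A \<longleftrightarrow> f \<in> polys A \<and> lkp f 0 = 0"
proof -
  have V: "Var ` A \<subseteq> (polys A :: ('v, 'k) mpoly set)" using forms_polys[OF Var_forms] by auto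
  have "lkp f 0 = 0" if "f \<in> idl (Var ` A)" for f :: "('v, 'k) mpoly"
    using that
  proof induction
    case (step g f c)
    then obtain v where "g = Var v" by auto
    moreover have "sgl v (1::nat) \<noteq> 0" by (metis lookup_single_eq lookup_zero zero_neq_one)
    ultimately have "lkp g 0 = 0" by (simp add: Var_def lookup_single when_def)
    then show ?case using step by (simp add: lookup_add lookup_mult_zero)
  qed simp
  moreover have "f \<in> idl (Var ` A)" if "f \<in> polys A" "lkp f 0 = 0"
  proof (rule monomials_idl)
    fix m assume "m \<in> mkeys f"
    then have "m \<noteq> 0" "mkeys m \<subseteq> A" using that by (auto simp: polys_def in_keys_iff)
    moreover from this have "mkeys m \<noteq> {}" using mono_deg_eq_0[of m] by (auto simp: mono_deg_def)
    ultimately show "mkeys m \<inter> A \<noteq> {}" by (simp add: Int_absorb2)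
  qed
  ultimately show ?thesis unfolding irrelevant_ideal_def poly_ring_genideal[OF V] by blast
qed

section \<open>Vectors and matrices\<close>

definition vec_fun :: "('v, 'k::field) mpoly vec \<Rightarrow> nat \<Rightarrow> ('v, 'k) mpoly" where
  "vec_fun w = (\<lambda>k. if k < dim_vec w then w $ k else 0)"

lemma vec_fun_free_polys: "w \<in> free_mod A r \<Longrightarrow> vec_fun w \<in> free_polys A r"
  by (auto simp: free_mod_def free_polys_def vec_fun_def carrier_poly_ring)

lemma vec_free_mod: "f \<in> free_polys A r \<Longrightarrow> vec r f \<in> free_mod A r"
  by (auto simp: free_mod_def free_polys_def carrier_poly_ring)

lemma vec_fun_vec: "f \<in> free_polys A r \<Longrightarrow> vec_fun (vec r f) = f"
  by (auto simp: vec_fun_def free_polys_def fun_eq_iff)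

lemma vec_fun_inj: "dim_vec w = dim_vec w' \<Longrightarrow> vec_fun w = vec_fun w' \<Longrightarrow> w = w'"
  by (intro eq_vecI) (auto simp: vec_fun_def fun_eq_iff split: if_splits)

lemma vec_fun_image: "vec_fun ` free_mod A r = free_polys A r"
  using vec_fun_free_polys vec_free_mod vec_fun_vec by (metis (no_types, lifting) image_eqI image_subset_iff subset_antisym subsetI)

lemma vec_fun_mult:
  assumes "D \<in> carrier_mat r r'" "w \<in> carrier_vec r'"
  shows "vec_fun (D *\<^sub>v w) = mat_apply r r' (\<lambda>k l. D $$ (k, l)) (vec_fun w)"
proof
  fix k
  show "vec_fun (D *\<^sub>v w) k = mat_apply r r' (\<lambda>k l. D $$ (k, l)) (vec_fun w) k"
    using assms by (auto simp: vec_fun_def mat_apply_def scalar_prod_def lessThan_atLeast0 intro!: sum.cong)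
qed

lemma vec_fun_zero: "vec_fun (0\<^sub>v r) = 0"
  by (auto simp: vec_fun_def)

lemma scalar_prod_vec_fun: "w \<in> carrier_vec r \<Longrightarrow> g \<in> carrier_vec r \<Longrightarrow> w \<bullet> g = (\<Sum>k<r. vec_fun w k * g $ k)"
  by (auto simp: scalar_prod_def vec_fun_def lessThan_atLeast0 intro!: sum.cong)

lemma coset_eq_iff:
  assumes "is_ideal I" "x \<in> polys A" "y \<in> polys A"
  shows "(I \<inter> polys A) +>\<^bsub>poly_ring A\<^esub> x = (I \<inter> polys A) +>\<^bsub>poly_ring A\<^esub> y \<longleftrightarrow> x - y \<in> I"
proof -
  note I = is_idealD[OF assms(1)]
  have c: "(I \<inter> polys A) +>\<^bsub>poly_ring A\<^esub> z = {h. h - z \<in> I \<and> h \<in> polys A}" if "z \<in> polys A" for z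
  proof
    show "(I \<inter> polys A) +>\<^bsub>poly_ring A\<^esub> z \<subseteq> {h. h - z \<in> I \<and> h \<in> polys A}"
      using that by (auto simp: a_r_coset_def' polys_add)
    show "{h. h - z \<in> I \<and> h \<in> polys A} \<subseteq> (I \<inter> polys A) +>\<^bsub>poly_ring A\<^esub> z"
    proof
      fix h assume "h \<in> {h. h - z \<in> I \<and> h \<in> polys A}"
      then have "h = (h - z) + z" "h - z \<in> I \<inter> polys A" using that by (auto simp: polys_diff)
      then show "h \<in> (I \<inter> polys A) +>\<^bsub>poly_ring A\<^esub> z"
        unfolding a_r_coset_def' by (intro UN_I[of "h - z"]) simp_all
    qed
  qed
  show ?thesis
  proof
    assume "(I \<inter> polys A) +>\<^bsub>poly_ring A\<^esub> x = (I \<inter> polys A) +>\<^bsub>poly_ring A\<^esub> y"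
    moreover have "x \<in> {h. h - x \<in> I \<and> h \<in> polys A}" using assms(2) I(1) by simp
    ultimately show "x - y \<in> I" unfolding c[OF assms(2)] c[OF assms(3)] by blast
  next
    assume xy: "x - y \<in> I"
    have "h - x \<in> I \<longleftrightarrow> h - y \<in> I" for h
    proof
      assume "h - x \<in> I"
      from I(2)[OF this xy] show "h - y \<in> I" by simp
    next
      assume "h - y \<in> I"
      from I(6)[OF this xy] show "h - x \<in> I" by simp
    qed
    then show "(I \<inter> polys A) +>\<^bsub>poly_ring A\<^esub> x = (I \<inter> polys A) +>\<^bsub>poly_ring A\<^esub> y"
      unfolding c[OF assms(2)] c[OF assms(3)] by simp
  qed
qed

lemma coset_zero_iff:
  assumes "is_ideal I" "x \<in> polys A"
  shows "(I \<inter> polys A) +>\<^bsub>poly_ring A\<^esub> x = \<zero>\<^bsub>poly_ring A Quot (I \<inter> polys A)\<^esub> \<longleftrightarrow> x \<in> I"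
proof -
  have "\<zero>\<^bsub>poly_ring A Quot (I \<inter> polys A)\<^esub> = I \<inter> polys A" by (simp add: FactRing_def)
  also have "\<dots> = (I \<inter> polys A) +>\<^bsub>poly_ring A\<^esub> 0" by (auto simp: a_r_coset_def')
  finally show ?thesis using coset_eq_iff[OF assms polys_zero] by simp
qed

lemma Quot_carrier:
  "carrier (poly_ring A Quot J) = (\<lambda>x. J +>\<^bsub>poly_ring A\<^esub> x) ` polys A"
  by (auto simp: FactRing_def A_RCOSETS_def' carrier_poly_ring)

context poly_koszul
begin

text \<open>Translates vectors, matrices and cosets into functions on indices and membership in \<open>I\<close>. The
augmentation is onto iff $1$ is in its image.\<close>

lemma minimal_resolution_iff:
  fixes I :: "('v, 'k) mpoly set"
  assumes I: "is_ideal I" and g: "g \<in> carrier_vec (length (a 0))"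
    and D: "\<And>i. D i \<in> carrier_mat (length (a i)) (length (a (Suc i)))"
  shows "minimal_graded_free_resolution A (I \<inter> polys A) a g D \<longleftrightarrow>
    min_res I a (\<lambda>k. g $ k) (\<lambda>i k l. D i $$ (k, l))"
proof -
  let ?r = "\<lambda>i. length (a i)" and ?S = "poly_ring A :: ('v, 'k) mpoly ring"
  let ?D = "\<lambda>i k l. D i $$ (k, l)" and ?J = "I \<inter> polys A"
  let ?mat_apply = "\<lambda>i. mat_apply (?r i) (?r (Suc i)) (?D i)"
  let ?aug = "\<lambda>w. ?J +>\<^bsub>?S\<^esub> (w \<bullet> g)"
  let ?sy = "syz I a (\<lambda>k. g $ k) ?D"
  have fm: "w \<in> free_mod A r \<Longrightarrow> w \<in> carrier_vec r" for w :: "('v, 'k) mpoly vec" and r by (simp add: free_mod_def)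
  have im: "vec_fun ` (\<lambda>w. D i *\<^sub>v w) ` free_mod A (?r (Suc i)) = ?mat_apply i ` free_polys A (?r (Suc i))" for i
    unfolding vec_fun_image[symmetric] image_image
    by (rule image_cong[OF refl]) (rule vec_fun_mult[OF D fm])
  have dimim: "w \<in> (\<lambda>w. D i *\<^sub>v w) ` free_mod A (?r (Suc i)) \<Longrightarrow> dim_vec w = ?r i" for i w
    using D[of i] by auto
  have set_eq: "W = W' \<longleftrightarrow> vec_fun ` W = vec_fun ` W'"
    if "\<And>w. w \<in> W \<Longrightarrow> dim_vec w = r" "\<And>w. w \<in> W' \<Longrightarrow> dim_vec w = r" for W W' and r
  proof
    assume eq: "vec_fun ` W = vec_fun ` W'"
    have "w \<in> W2" if "w \<in> W1" "vec_fun ` W1 = vec_fun ` W2" "\<And>w. w \<in> W1 \<Longrightarrow> dim_vec w = r" "\<And>w. w \<in> W2 \<Longrightarrow> dim_vec w = r"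
      for w W1 W2
    proof -
      have "vec_fun w \<in> vec_fun ` W2" using that(1,2) by auto
      then obtain w' where "w' \<in> W2" "vec_fun w = vec_fun w'" by (rule imageE)
      moreover from this have "w = w'" using that by (intro vec_fun_inj) auto
      ultimately show ?thesis by simp
    qed
    from this[of _ W W'] this[of _ W' W] show "W = W'" using that eq by auto
  qed simp
  have homg: "(g \<in> free_mod A (?r 0) \<and> (\<forall>k < ?r 0. homogeneous (a 0 ! k) (g $ k))) \<longleftrightarrow>
      (\<forall>k < ?r 0. g $ k \<in> forms A (a 0 ! k))"
    using g by (auto simp: free_mod_def forms_iff carrier_poly_ring)
  have homD: "(\<forall>i. D i \<in> carrier_mat (?r i) (?r (Suc i)) \<and> (\<forall>k < ?r i. \<forall>l < ?r (Suc i).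
      D i $$ (k, l) \<in> carrier ?S \<and> homogeneous (a (Suc i) ! l - a i ! k) (D i $$ (k, l)))) \<longleftrightarrow>
      (\<forall>i. hom_matrix A (a i) (a (Suc i)) (?D i))"
    using D by (auto simp: hom_matrix_def forms_iff carrier_poly_ring)
  have irr: "(\<forall>i. \<forall>k < ?r i. \<forall>l < ?r (Suc i). D i $$ (k, l) \<in> irrelevant_ideal A) \<longleftrightarrow>
      (\<forall>i. \<forall>k < ?r i. \<forall>l < ?r (Suc i). lkp (?D i k l) 0 = 0)"
    if "\<forall>i. hom_matrix A (a i) (a (Suc i)) (?D i)"
    using that by (auto simp: irrelevant_ideal_iff hom_matrix_def dest: forms_polys)
  have sp: "w \<bullet> g = (\<Sum>k<?r 0. vec_fun w k * g $ k)" if "w \<in> free_mod A (?r 0)" for w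
    by (rule scalar_prod_vec_fun[OF fm[OF that] g])
  have kers: "{w \<in> free_mod A (?r (Suc i)). D i *\<^sub>v w = 0\<^sub>v (?r i)} = (\<lambda>w. D (Suc i) *\<^sub>v w) ` free_mod A (?r (Suc (Suc i)))
      \<longleftrightarrow> ?mat_apply (Suc i) ` free_polys A (?r (Suc (Suc i))) = ?sy (Suc i)" for i
  proof -
    have z: "D i *\<^sub>v w = 0\<^sub>v (?r i) \<longleftrightarrow> ?mat_apply i (vec_fun w) = 0" if w: "w \<in> free_mod A (?r (Suc i))" for w
      unfolding vec_fun_mult[OF D fm[OF w], symmetric]
      using vec_fun_inj[of "D i *\<^sub>v w" "0\<^sub>v (?r i)"] D[of i] by (auto simp: vec_fun_zero)
    have "{w \<in> free_mod A (?r (Suc i)). D i *\<^sub>v w = 0\<^sub>v (?r i)} = {w \<in> free_mod A (?r (Suc i)). ?mat_apply i (vec_fun w) = 0}"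
      using z by auto
    then have "vec_fun ` {w \<in> free_mod A (?r (Suc i)). D i *\<^sub>v w = 0\<^sub>v (?r i)} = {f \<in> vec_fun ` free_mod A (?r (Suc i)). ?mat_apply i f = 0}"
      by auto
    then have k: "vec_fun ` {w \<in> free_mod A (?r (Suc i)). D i *\<^sub>v w = 0\<^sub>v (?r i)} = ?sy (Suc i)"
      unfolding vec_fun_image by (simp add: syz_def)
    have "{w \<in> free_mod A (?r (Suc i)). D i *\<^sub>v w = 0\<^sub>v (?r i)} = (\<lambda>w. D (Suc i) *\<^sub>v w) ` free_mod A (?r (Suc (Suc i)))
      \<longleftrightarrow> vec_fun ` {w \<in> free_mod A (?r (Suc i)). D i *\<^sub>v w = 0\<^sub>v (?r i)} = vec_fun ` (\<lambda>w. D (Suc i) *\<^sub>v w) ` free_mod A (?r (Suc (Suc i)))"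
    proof (rule set_eq)
      show "dim_vec w = ?r (Suc i)" if "w \<in> {w \<in> free_mod A (?r (Suc i)). D i *\<^sub>v w = 0\<^sub>v (?r i)}" for w :: "('v, 'k) mpoly vec"
        using that by (simp add: free_mod_def)
    qed (rule dimim)
    then show ?thesis unfolding k im by (simp only: eq_commute)
  qed
  have sPA: "(\<Sum>k<?r 0. f k * g $ k) \<in> polys A"
    if "f \<in> free_polys A (?r 0)" "\<forall>k < ?r 0. g $ k \<in> forms A (a 0 ! k)" for f
    using that by (intro polys_sum polys_mult) (auto simp: free_polys_def dest: forms_polys)
  have ker0: "{w \<in> free_mod A (?r 0). ?aug w = \<zero>\<^bsub>?S Quot ?J\<^esub>} = (\<lambda>w. D 0 *\<^sub>v w) ` free_mod A (?r (Suc 0))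
      \<longleftrightarrow> ?mat_apply 0 ` free_polys A (?r (Suc 0)) = ?sy 0"
    if gH: "\<forall>k < ?r 0. g $ k \<in> forms A (a 0 ! k)"
  proof -
    have z: "?aug w = \<zero>\<^bsub>?S Quot ?J\<^esub> \<longleftrightarrow> (\<Sum>k<?r 0. vec_fun w k * g $ k) \<in> I" if w: "w \<in> free_mod A (?r 0)" for w
      unfolding sp[OF w] by (rule coset_zero_iff[OF I sPA[OF vec_fun_free_polys[OF w] gH]])
    have "{w \<in> free_mod A (?r 0). ?aug w = \<zero>\<^bsub>?S Quot ?J\<^esub>} = {w \<in> free_mod A (?r 0). (\<Sum>k<?r 0. vec_fun w k * g $ k) \<in> I}"
      using z by auto
    then have "vec_fun ` {w \<in> free_mod A (?r 0). ?aug w = \<zero>\<^bsub>?S Quot ?J\<^esub>} = {f \<in> vec_fun ` free_mod A (?r 0). (\<Sum>k<?r 0. f k * g $ k) \<in> I}"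
      by auto
    then have k: "vec_fun ` {w \<in> free_mod A (?r 0). ?aug w = \<zero>\<^bsub>?S Quot ?J\<^esub>} = ?sy 0"
      unfolding vec_fun_image by (simp add: syz_def)
    have "{w \<in> free_mod A (?r 0). ?aug w = \<zero>\<^bsub>?S Quot ?J\<^esub>} = (\<lambda>w. D 0 *\<^sub>v w) ` free_mod A (?r (Suc 0))
      \<longleftrightarrow> vec_fun ` {w \<in> free_mod A (?r 0). ?aug w = \<zero>\<^bsub>?S Quot ?J\<^esub>} = vec_fun ` (\<lambda>w. D 0 *\<^sub>v w) ` free_mod A (?r (Suc 0))"
    proof (rule set_eq)
      show "dim_vec w = ?r 0" if "w \<in> {w \<in> free_mod A (?r 0). ?aug w = \<zero>\<^bsub>?S Quot ?J\<^esub>}" for w :: "('v, 'k) mpoly vec"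
        using that by (simp add: free_mod_def)
    qed (rule dimim)
    then show ?thesis unfolding k im by (simp only: eq_commute)
  qed
  have onto: "?aug ` free_mod A (?r 0) = carrier (?S Quot ?J) \<longleftrightarrow>
      (\<exists>f\<in>free_polys A (?r 0). 1 - (\<Sum>k<?r 0. f k * g $ k) \<in> I)"
    if gH: "\<forall>k < ?r 0. g $ k \<in> forms A (a 0 ! k)"
  proof
    assume "?aug ` free_mod A (?r 0) = carrier (?S Quot ?J)"
    then have "?J +>\<^bsub>?S\<^esub> 1 \<in> ?aug ` free_mod A (?r 0)" unfolding Quot_carrier by simp
    then obtain w where w: "w \<in> free_mod A (?r 0)" "?J +>\<^bsub>?S\<^esub> 1 = ?aug w" by (rule imageE)
    have "1 - (\<Sum>k<?r 0. vec_fun w k * g $ k) \<in> I"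
      using w(2) unfolding sp[OF w(1)] coset_eq_iff[OF I polys_one sPA[OF vec_fun_free_polys[OF w(1)] gH]] .
    then show "\<exists>f\<in>free_polys A (?r 0). 1 - (\<Sum>k<?r 0. f k * g $ k) \<in> I" using vec_fun_free_polys[OF w(1)] by (rule bexI)
  next
    assume "\<exists>f\<in>free_polys A (?r 0). 1 - (\<Sum>k<?r 0. f k * g $ k) \<in> I"
    then obtain f where f: "f \<in> free_polys A (?r 0)" "1 - (\<Sum>k<?r 0. f k * g $ k) \<in> I" by (rule bexE)
    show "?aug ` free_mod A (?r 0) = carrier (?S Quot ?J)"
      unfolding Quot_carrier
    proof
      show "?aug ` free_mod A (?r 0) \<subseteq> (\<lambda>x. ?J +>\<^bsub>?S\<^esub> x) ` polys A"
      proof (rule image_subsetI)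
        fix w :: "('v, 'k) mpoly vec" assume w: "w \<in> free_mod A (?r 0)"
        show "?aug w \<in> (\<lambda>x. ?J +>\<^bsub>?S\<^esub> x) ` polys A"
          unfolding sp[OF w] by (rule imageI) (rule sPA[OF vec_fun_free_polys[OF w] gH])
      qed
      show "(\<lambda>x. ?J +>\<^bsub>?S\<^esub> x) ` polys A \<subseteq> ?aug ` free_mod A (?r 0)"
      proof (rule image_subsetI)
        fix s :: "('v, 'k) mpoly" assume s: "s \<in> polys A"
        let ?f = "\<lambda>k. s * f k"
        have fU: "?f \<in> free_polys A (?r 0)" using f(1) s by (simp add: free_polys_def polys_mult)
        let ?w = "vec (?r 0) ?f"
        have w: "?w \<in> free_mod A (?r 0)" by (rule vec_free_mod[OF fU])
        have "?w \<bullet> g = (\<Sum>k<?r 0. ?f k * g $ k)" unfolding sp[OF w] vec_fun_vec[OF fU] ..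
        moreover have "s - (\<Sum>k<?r 0. ?f k * g $ k) = s * (1 - (\<Sum>k<?r 0. f k * g $ k))"
          by (simp add: right_diff_distrib sum_distrib_left mult.assoc)
        then have "s - (\<Sum>k<?r 0. ?f k * g $ k) \<in> I" using is_idealD(3)[OF I f(2)] by simp
        ultimately have "?J +>\<^bsub>?S\<^esub> s = ?aug ?w"
          using coset_eq_iff[OF I s sPA[OF fU gH]] by simp
        then show "?J +>\<^bsub>?S\<^esub> s \<in> ?aug ` free_mod A (?r 0)" using w by (rule image_eqI)
      qed
    qed
  qed
  have split: "(\<forall>i. P i) \<longleftrightarrow> P 0 \<and> (\<forall>i. P (Suc i))" for P :: "nat \<Rightarrow> bool"
    by (metis not0_implies_Suc)
  show ?thesis
    unfolding minimal_graded_free_resolution_def graded_free_resolution_def Let_def min_res_def One_nat_def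
      split[of "\<lambda>i. ?mat_apply i ` free_polys A (?r (Suc i)) = ?sy i"] kers
    using homg homD irr ker0 onto by argo
qed

end

section \<open>The regularity in terms of Koszul homology\<close>

context poly_koszul
begin

lemma koszul_vanish_low: "j < p \<Longrightarrow> is_ideal I \<Longrightarrow> tor_vanish I p j"
proof (rule K.koszul_vanishI)
  fix z :: "nat set \<Rightarrow> ('v, 'k) mpoly" assume jp: "j < p" and I: "is_ideal I" and z: "koszul_chain N (forms A) p j z"
  have "z T = 0" if "T \<subseteq> {..<N}" "int (card T) = p" for T
    using kcD[OF z that] jp forms_neg[of "j - p" "z T" A] by simp
  then have "koszul_chain N (\<lambda>i. I \<inter> forms A i) p j (\<lambda>T. z T - koszul_d (mult_var e) N (\<lambda>_. 0) T)"
    using is_idealD(1)[OF I] by (simp add: koszul_chain_def K.koszul_d_zero)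
  then show "\<exists>w. koszul_chain N (forms A) (p + 1) j w \<and> koszul_chain N (\<lambda>i. I \<inter> forms A i) p j (\<lambda>T. z T - koszul_d (mult_var e) N w T)"
    by (intro exI[of _ "\<lambda>_. 0"]) (simp add: koszul_chain_def)
qed

lemma resolution_degrees_iff:
  fixes I :: "('v, 'k) mpoly set"
  assumes I: "graded_ideal A I" and irr: "\<forall>f\<in>I. lkp f 0 = 0" and R: "reg_le I R"
  shows "j \<in> set (resolution_degrees A (I \<inter> polys A) i) \<longleftrightarrow> \<not> tor_vanish I (int i) j"
proof -
  have iI: "is_ideal I" using I by (simp add: graded_ideal_def)
  have "\<exists>a D. min_res I a (\<lambda>_. 1) D"
    by (rule min_res_exists[OF I _ R]) (rule bspec[OF irr])
  then obtain a D where aD: "min_res I a (\<lambda>_. 1) D" by (elim exE)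
  define g where "g = vec (length (a 0)) (\<lambda>_. 1 :: ('v, 'k) mpoly)"
  define M where "M = (\<lambda>i. mat (length (a i)) (length (a (Suc i))) (\<lambda>(k, l). D i k l))"
  have "min_res I a (\<lambda>k. g $ k) (\<lambda>i k l. M i $$ (k, l))"
  proof -
    have "mat_apply (length (a i)) (length (a (Suc i))) (\<lambda>k l. M i $$ (k, l)) = mat_apply (length (a i)) (length (a (Suc i))) (D i)" for i
      by (auto simp: mat_apply_def M_def fun_eq_iff)
    moreover have "(\<Sum>k<length (a 0). f k * g $ k) = (\<Sum>k<length (a 0). f k * 1)" for f
      by (rule sum.cong) (auto simp: g_def)
    moreover from calculation have "syz I a (\<lambda>k. g $ k) (\<lambda>i k l. M i $$ (k, l)) = syz I a (\<lambda>_. 1) D"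
      by (auto simp: syz_def fun_eq_iff split: nat.splits)
    moreover have "hom_matrix A (a i) (a (Suc i)) (\<lambda>k l. M i $$ (k, l)) = hom_matrix A (a i) (a (Suc i)) (D i)" for i
      by (auto simp: hom_matrix_def M_def)
    moreover have "g $ k = 1" "l < length (a (Suc i)) \<Longrightarrow> k' < length (a i) \<Longrightarrow> M i $$ (k', l) = D i k' l"
      if "k < length (a 0)" for k k' l i
      using that by (auto simp: g_def M_def)
    moreover have "M i $$ (k', l) = D i k' l" if "l < length (a (Suc i))" "k' < length (a i)" for k' l i
      using that by (auto simp: M_def)
    ultimately show ?thesis using aD unfolding min_res_def by simp
  qed
  then have "minimal_graded_free_resolution A (I \<inter> polys A) a g M"
    by (subst minimal_resolution_iff[OF iI]) (auto simp: g_def M_def)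
  then have ex: "\<exists>a g D. minimal_graded_free_resolution A (I \<inter> polys A) a g D" by blast
  obtain g D where gD: "minimal_graded_free_resolution A (I \<inter> polys A) (resolution_degrees A (I \<inter> polys A)) g D"
    using someI_ex[OF ex] unfolding resolution_degrees_def by (elim exE)
  have "min_res I (resolution_degrees A (I \<inter> polys A)) (\<lambda>k. g $ k) (\<lambda>i k l. D i $$ (k, l))"
  proof (subst minimal_resolution_iff[OF iI, symmetric])
    show "g \<in> carrier_vec (length (resolution_degrees A (I \<inter> polys A) 0))"
      using gD unfolding minimal_graded_free_resolution_def graded_free_resolution_def Let_def free_mod_def by simp
    show "D i \<in> carrier_mat (length (resolution_degrees A (I \<inter> polys A) i)) (length (resolution_degrees A (I \<inter> polys A) (Suc i)))" for i
      using gD unfolding minimal_graded_free_resolution_def graded_free_resolution_def Let_def by simp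
  qed (rule gD)
  from min_res_degrees[OF I this] show ?thesis .
qed

text \<open>The maximum is taken over a nonempty set that is finite: the bound \<open>R\<close> limits it from above, and $j \ge i$
holds because the coefficients of a chain cannot have negative degree.\<close>

lemma regularity_bounds:
  fixes I :: "('v, 'k) mpoly set"
  assumes I: "graded_ideal A I" and irr: "\<forall>f\<in>I. lkp f 0 = 0" and R: "reg_le I R"
    and nz: "\<not> tor_vanish I (int i) j"
  shows "j - int i \<le> regularity A (I \<inter> polys A)" "regularity A (I \<inter> polys A) \<le> R"
proof -
  let ?S = "{j - int i | i j. graded_betti A (I \<inter> polys A) i j \<noteq> 0}"
  have iI: "is_ideal I" using I by (simp add: graded_ideal_def)
  have b: "graded_betti A (I \<inter> polys A) i j \<noteq> 0 \<longleftrightarrow> \<not> tor_vanish I (int i) j" for i j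
    using resolution_degrees_iff[OF I irr R, of j i] by (simp add: graded_betti_def count_list_0_iff)
  have up: "s \<le> R" if s: "s \<in> ?S" for s
  proof -
    obtain i j where ij: "s = j - int i" "graded_betti A (I \<inter> polys A) i j \<noteq> 0" using s by blast
    then show ?thesis using R b[of i j] by (force simp: reg_le_def)
  qed
  have low: "0 \<le> s" if s: "s \<in> ?S" for s
  proof -
    obtain i j where ij: "s = j - int i" "graded_betti A (I \<inter> polys A) i j \<noteq> 0" using s by blast
    then show ?thesis using koszul_vanish_low[of j "int i", OF _ iI] b[of i j] by force
  qed
  have fin: "finite ?S" 
  proof (rule finite_subset[of _ "{0..R}"])
    show "?S \<subseteq> {0..R}"
    proof
      fix s assume "s \<in> ?S"
      from up[OF this] low[OF this] show "s \<in> {0..R}" by simp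
    qed
  qed simp
  have mem: "j - int i \<in> ?S" using nz b[of i j] by blast
  show "j - int i \<le> regularity A (I \<inter> polys A)"
    unfolding regularity_def by (rule Max_ge[OF fin mem])
  have "Max ?S \<in> ?S" by (rule Max_in[OF fin]) (use mem in blast)
  then show "regularity A (I \<inter> polys A) \<le> R"
    unfolding regularity_def by (rule up)
qed

end

section \<open>The bipartite complement of a cycle\<close>

lemma binomial_edge_ideal_graph_gens:
  assumes "\<And>a b. {a, b} \<in> E \<Longrightarrow> a \<in> V"
  shows "(binomial_edge_ideal V E :: ('w edge_var, 'k::field) mpoly set) =
    idl (graph_gens {} {(a, b). {a, b} \<in> E}) \<inter> polys (edge_vars V)"
proof -
  have G: "{Var (X a) * Var (Y b) - Var (X b) * Var (Y a) | a b. {a, b} \<in> E} =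
      (graph_gens {} {(a, b). {a, b} \<in> E} :: ('w edge_var, 'k) mpoly set)"
    by (auto simp: graph_gens_def edge_binoms_def edge_binom_def)
  have "(graph_gens {} {(a, b). {a, b} \<in> E} :: ('w edge_var, 'k) mpoly set) \<subseteq> polys (edge_vars V)"
  proof
    fix g :: "('w edge_var, 'k) mpoly" assume "g \<in> graph_gens {} {(a, b). {a, b} \<in> E}"
    then obtain a b where ab: "g = edge_binom a b" "{a, b} \<in> E" by (auto simp: graph_gens_def edge_binoms_def)
    then have "a \<in> V" "b \<in> V" using assms[of a b] assms[of b a] by (auto simp: insert_commute)
    from forms_polys[OF edge_binom_forms[OF this]] show "g \<in> polys (edge_vars V)" unfolding ab(1) .
  qed
  from poly_ring_genideal[OF this] show ?thesis unfolding binomial_edge_ideal_def G .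
qed

lemma enumeration_exists:
  assumes "finite (A :: 'v set)" "B \<subseteq> A"
  shows "\<exists>(e :: nat \<Rightarrow> 'v) N N'. bij_betw e {..<N} A \<and> N' \<le> N \<and> e ` {..<N'} = B"
proof -
  obtain xs where xs: "set xs = B" "distinct xs" using assms finite_subset finite_distinct_list by metis
  obtain ys where ys: "set ys = A - B" "distinct ys" using assms finite_distinct_list[of "A - B"] by auto
  have b1: "bij_betw ((!) (xs @ ys)) {..<length (xs @ ys)} A"
    by (rule bij_betw_nth) (use xs ys assms(2) in auto)
  have b2: "(!) (xs @ ys) ` {..<length xs} = B"
    using xs(1) by (force simp: nth_append set_conv_nth)
  have b3: "length xs \<le> length (xs @ ys)" by simp
  show ?thesis by (intro exI conjI, rule b1, rule b3, rule b2)
qed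

definition G_rel :: "nat \<Rightarrow> ((nat + nat) \<times> (nat + nat)) set" where
  "G_rel n = {(a, b). {a, b} \<in> G_edges n}"

lemma G_rel_iff:
  "(Inl i, Inr j) \<in> G_rel n \<longleftrightarrow> i < n \<and> j < n \<and> j \<noteq> i \<and> j \<noteq> (if i = 0 then n - 1 else i - 1)"
  "(Inr j, Inl i) \<in> G_rel n \<longleftrightarrow> (Inl i, Inr j) \<in> G_rel n"
  "(Inl i, Inl i') \<notin> G_rel n" "(Inr j, Inr j') \<notin> G_rel n"
proof -
  have e: "[int j = int i] (mod int n) \<longleftrightarrow> j = i" if "i < n" "j < n"
    using that by (simp add: cong_def)
  have f: "[int j = int i - 1] (mod int n) \<longleftrightarrow> j = (if i = 0 then n - 1 else i - 1)" if "i < n" "j < n"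
  proof (cases "i = 0")
    case True
    have "(- 1) mod int n = int n - 1" using that by (simp add: zmod_minus1)
    then show ?thesis using that True by (auto simp: cong_def)
  next
    case False
    then have eq: "int i - 1 = int (i - 1)" by simp
    show ?thesis unfolding cong_def eq zmod_int[symmetric] of_nat_eq_iff using that False by simp
  qed
  show "(Inl i, Inr j) \<in> G_rel n \<longleftrightarrow> i < n \<and> j < n \<and> j \<noteq> i \<and> j \<noteq> (if i = 0 then n - 1 else i - 1)"
    using e f by (auto simp: G_rel_def G_edges_def doubleton_eq_iff)
  show "(Inr j, Inl i) \<in> G_rel n \<longleftrightarrow> (Inl i, Inr j) \<in> G_rel n" by (simp add: G_rel_def insert_commute)
  show "(Inl i, Inl i') \<notin> G_rel n" "(Inr j, Inr j') \<notin> G_rel n"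
    by (auto simp: G_rel_def G_edges_def doubleton_eq_iff)
qed

lemma G_rel_props:
  "sym (G_rel n)" "irrefl (G_rel n)" "G_rel n \<subseteq> G_verts n \<times> G_verts n"
proof -
  show "sym (G_rel n)" by (auto simp: sym_def G_rel_def insert_commute)
  show "irrefl (G_rel n)" by (auto simp: irrefl_def G_rel_def G_edges_def)
  show "G_rel n \<subseteq> G_verts n \<times> G_verts n"
    by (auto simp: G_rel_def G_edges_def G_verts_def doubleton_eq_iff)
qed

lemma card_G_verts: "card (G_verts n) = 2 * n"
  unfolding G_verts_def by (subst card_Un_disjoint) (auto simp: card_image)

text \<open>The path $u_1 v_1 u_2 v_2 u_3 v_3 u_4$ of $C_{2n}$ has the following bipartite complement, which is again a path.\<close>

definition path7 :: "nat \<Rightarrow> nat + nat" where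
  "path7 i = [Inl 2, Inr 3, Inl 1, Inr 2, Inl 4, Inr 1, Inl 3] ! i"

lemma le_6_cases: "i \<le> 6 \<Longrightarrow> i = 0 \<or> i = 1 \<or> i = 2 \<or> i = 3 \<or> i = 4 \<or> i = 5 \<or> i = (6::nat)"
  by linarith

lemma path7_simps:
  "path7 0 = Inl 2" "path7 (Suc 0) = Inr 3" "path7 2 = Inl 1" "path7 3 = Inr 2" "path7 4 = Inl 4"
  "path7 5 = Inr 1" "path7 6 = Inl 3"
  by (simp_all add: path7_def)

lemma path7_induced:
  assumes "5 \<le> n"
  shows "inj_on path7 {..6}" "path7 ` {..6} \<subseteq> G_verts n"
    "i < 6 \<Longrightarrow> (path7 i, path7 (Suc i)) \<in> G_rel n"
    "i \<le> 6 \<Longrightarrow> j \<le> 6 \<Longrightarrow> (path7 i, path7 j) \<in> G_rel n \<Longrightarrow> j = Suc i \<or> i = Suc j"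
proof -
  show "inj_on path7 {..6}"
  proof (rule inj_onI)
    fix x y assume xy: "x \<in> {..6}" "y \<in> {..6}" "path7 x = path7 y"
    have "distinct [Inl 2, Inr 3, Inl 1, Inr 2, Inl 4, Inr 1, Inl 3 :: nat + nat]" by simp
    then show "x = y" using xy unfolding path7_def by (subst (asm) nth_eq_iff_index_eq) auto
  qed
  show "path7 ` {..6} \<subseteq> G_verts n"
  proof (rule image_subsetI)
    fix i :: nat assume "i \<in> {..6}"
    then have "i \<le> 6" by simp
    then show "path7 i \<in> G_verts n"
      using le_6_cases[of i] assms by (auto simp: path7_simps G_verts_def)
  qed
  show "(path7 i, path7 (Suc i)) \<in> G_rel n" if "i < 6"
  proof -
    have "i = 0 \<or> i = 1 \<or> i = 2 \<or> i = 3 \<or> i = 4 \<or> i = 5" using that by linarith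
    then show ?thesis using assms by (auto simp: path7_def G_rel_iff)
  qed
  show "j = Suc i \<or> i = Suc j" if "i \<le> 6" "j \<le> 6" "(path7 i, path7 j) \<in> G_rel n"
    using le_6_cases[OF that(1)] le_6_cases[OF that(2)] that(3) assms
    by (auto simp: path7_simps G_rel_iff)
qed

text \<open>Ohtani's sequence for the vertex $u_0$, whose neighbours include $v_1, v_2, v_3$.\<close>

lemma reg_le_G:
  assumes gk: "graph_koszul (G_verts n) e N" and n: "5 \<le> n"
  shows "poly_koszul.reg_le (edge_vars (G_verts n)) e N
    (idl (graph_gens {} (G_rel n)) :: ((nat + nat) edge_var, 'k::field) mpoly set) (2 * int n - 2)"
proof -
  let ?V = "G_verts n"
  interpret graph_koszul ?V e N "TYPE('k)" by (rule gk)
  let ?E = "G_rel n" and ?v = "Inl 0 :: nat + nat"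
  let ?c = "complete_nbhd ?E ?v"
  note E = G_rel_props[of n]
  have vV: "?v \<in> ?V" using n by (simp add: G_verts_def)
  have cV: "card (?V - {}) = 2 * n" "card (?V - {?v}) = 2 * n - 1"
    using vV finV by (simp_all add: card_G_verts)
  have nb: "(?v, Inr 1) \<in> ?E" "(?v, Inr 2) \<in> ?E" "(?v, Inr 3) \<in> ?E"
    using n by (simp_all add: G_rel_iff)
  have t: "(Inr 1, Inr 2) \<in> del_vertex ?c ?v" "(Inr 1, Inr 3) \<in> del_vertex ?c ?v" "(Inr 2, Inr 3) \<in> del_vertex ?c ?v"
    using nb by (auto simp: del_vertex_def complete_nbhd_def)
  have tri: "triangle (del_vertex ?c ?v)" unfolding triangle_def using t by blast
  have tric: "triangle ?c"
    unfolding triangle_def using t by (auto simp: del_vertex_def)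
  have c: "sym ?c" "irrefl ?c" "?c \<subseteq> ?V \<times> ?V"
    using E by (auto simp: complete_nbhd_def sym_def irrefl_def)
  have d: "sym (del_vertex F ?v)" "irrefl (del_vertex F ?v)" "del_vertex F ?v \<subseteq> (?V - {?v}) \<times> (?V - {?v})"
    if "sym F" "irrefl F" "F \<subseteq> ?V \<times> ?V" for F
    using that by (auto simp: sym_def irrefl_def del_vertex_def)
  have "reg_le (idl (graph_gens (edge_vars {}) ?E)) (2 * int n - 2)"
  proof (rule reg_le_Ohtani)
    show "reg_le (idl (graph_gens (edge_vars {}) ?c)) (2 * int n - 2)"
      by (rule reg_le_graph) (use c tric cV in auto)
    show "reg_le (idl (graph_gens (edge_vars {?v}) (del_vertex ?E ?v))) (2 * int n - 2)"
      by (rule reg_le_graph[OF _ d[OF E]]) (use vV cV n in auto)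
    show "reg_le (idl (graph_gens (edge_vars {?v}) (del_vertex ?c ?v))) (2 * int n - 2 - 1)"
      by (rule reg_le_graph[OF _ d[OF c]]) (use vV cV tri n in auto)
  qed (use vV E in auto)
  moreover have "edge_vars {} = ({} :: (nat + nat) edge_var set)" by (simp add: edge_vars_def)
  ultimately show ?thesis by simp
qed

theorem corollary7p2:
  fixes n :: nat
  assumes "n \<ge> 5"
  shows "let J = (binomial_edge_ideal (G_verts n) (G_edges n)
                    :: ((nat + nat) edge_var, 'k::field) mpoly set);
             r = regularity (edge_vars (G_verts n)) J
         in 6 \<le> r \<and> r \<le> 2 * int n - 2"
proof -
  let ?V = "G_verts n" and ?I = "idl (graph_gens {} (G_rel n)) :: ((nat + nat) edge_var, 'k) mpoly set"
  let ?P = "path7 ` {..6}"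
  note sv = path7_induced[OF assms]
  have finV: "finite ?V" by (simp add: G_verts_def)
  have sub: "edge_vars ?P \<subseteq> edge_vars ?V" using sv(2) by (auto simp: edge_vars_def)
  have fin: "finite (edge_vars ?V)" using finV by (simp add: edge_vars_def)
  from enumeration_exists[OF fin sub] obtain e and N N' :: nat where
    e: "bij_betw e {..<N} (edge_vars ?V)" "N' \<le> N" "e ` {..<N'} = edge_vars ?P"
    by (elim exE conjE)
  interpret graph_koszul ?V e N "TYPE('k)"
    by unfold_locales (use e(1) finV in auto)
  have J: "binomial_edge_ideal ?V (G_edges n) = ?I \<inter> polys (edge_vars ?V)"
    unfolding G_rel_def by (rule binomial_edge_ideal_graph_gens) (use G_rel_props(3)[of n] in \<open>auto simp: G_rel_def\<close>)
  have hom: "homgen (graph_gens {} (G_rel n))" by (rule homgen_graph_gens) (use G_rel_props(3) in auto)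
  have gI: "graded_ideal (edge_vars ?V) ?I" by (rule graded_ideal_idl) (use hom in auto)
  have irr: "\<forall>f\<in>?I. lkp f 0 = 0"
  proof
    fix f assume "f \<in> ?I"
    then show "lkp f 0 = 0"
  proof induction
    case (step g f c)
    then obtain a b where ab: "g = edge_binom a b" by (auto simp: graph_gens_def edge_binoms_def)
    have "g \<in> forms (edge_vars {a, b}) 2" unfolding ab by (rule edge_binom_forms) simp_all
    then have "0 \<notin> mkeys g" by (auto simp: forms_def)
    then have "lkp g 0 = 0" by (simp add: in_keys_iff)
    then show ?case using step(3) by (simp add: lookup_add lookup_mult_zero)
  qed simp
  qed
  have R: "reg_le ?I (2 * int n - 2)" by (rule reg_le_G[OF graph_koszul_axioms assms])
  have nz: "\<not> tor_vanish ?I (int 6) (2 * int 6)"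
    by (rule koszul_vanish_induced_path[OF sv(1,2) e(2,3) sv(3,4)])
  have "6 \<le> regularity (edge_vars ?V) (?I \<inter> polys (edge_vars ?V))"
    using regularity_bounds(1)[OF gI irr R nz] by simp
  moreover have "regularity (edge_vars ?V) (?I \<inter> polys (edge_vars ?V)) \<le> 2 * int n - 2"
    using regularity_bounds(2)[OF gI irr R nz] by simp
  ultimately show ?thesis unfolding Let_def J by simp
qed

end
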